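(* Let $0<\alpha<2$, let $\sigma$ be a finite symmetric measure on $S^{d-1}$ not concentrated on any $(d-1)$-dimensional subspace of $\mathbb{R}^d$, and for $\lambda\ge0$ let $\mathbb{M}_\lambda$ be the associated $\mathbb{R}^d$-valued independently scattered random measure on $\mathbb{R}^n$ (exponentially tempered stable for $\lambda>0$, symmetric $\alpha$-stable for $\lambda=0$). Let $E\in Q(\mathbb{R}^n)$ with trace $q$, let $\varphi:\mathbb{R}^n\to[0,\infty)$ be $E$-homogeneous and $(\beta,E)$-admissible for some $\beta>0$, and let $D\in Q(\mathbb{R}^d)$ be such that the maximum $H$ of the real parts of the eigenvalues of $D$ fulfills $H<\beta$. For $\lambda\ge0$ let $\mathbb{X}_\lambda=\{X_\lambda(t):t\in\mathbb{R}^n\}$ with $$X_\lambda(t)=\int_{\mathbb{R}^n}\left[\varphi(t-s)^{D-\frac q\alpha I}-\varphi(-s)^{D-\frac q\alpha I}\right]\mathbb{M}_\lambda(ds).$$ Then for every $\lambda>0$ and $x\in\mathbb{R}^n$ the field $\mathbb{X}_\lambda$ is $(E,D)$-localisable at $x$ with tangent field $\mathbb{X}'=\mathbb{X}_0$ (not depending on $x$); that is, as $c\to0$ ($c>0$), the finite-dimensional distributions of $\{c^{-D}(X_\lambda(x+c^Et)-X_\lambda(x)):t\in\mathbb{R}^n\}$ converge to those of $\{X_0(t):t\in\mathbb{R}^n\}$.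
   Context: Notation: $L(\mathbb{R}^m)$ is the space of real $m\times m$ matrices, $I=I_d$ the identity on $\mathbb{R}^d$, $\|\cdot\|$ the Euclidean norm, $f^*$ the adjoint (transpose). $Q(\mathbb{R}^m)$ is the set of $E\in L(\mathbb{R}^m)$ all of whose eigenvalues have strictly positive real part. For $c>0$ and a matrix $B$, $c^B:=\exp((\log c)B)$. For $E\in Q(\mathbb{R}^n)$ there is a norm $\|\cdot\|_E$ on $\mathbb{R}^n$ such that, with $S_E^{n-1}=\{x:\|x\|_E=1\}$, the map $(0,\infty)\times S_E^{n-1}\to\mathbb{R}^n\setminus\{0\}$, $(c,\theta)\mapsto c^E\theta$, is a homeomorphism; fix such a norm and write $x=\tau(x)^El(x)$ with $\tau(x)>0$, $l(x)\in S_E^{n-1}$ for $x\ne0$; $\tau(0)=0$. A function $\varphi$ on $\mathbb{R}^n$ is $E$-homogeneous if $\varphi(c^Ex)=c\,\varphi(x)$ for all $c>0$, $x\ne0$. $\varphi:\mathbb{R}^n\to[0,\infty)$ is $(\beta,E)$-admissible ($\beta>0$) if (i) $\varphi(x)>0$ for all $x\ne0$, and (ii) $\varphi$ is continuous and for any $0<A<B$ there is $C>0$ such that for $A\le\|y\|\le B$: $\tau(x)\le1\Rightarrow|\varphi(x+y)-\varphi(y)|\le C\tau(x)^\beta$. Random measures: for $\lambda\ge0$ let $\phi_\lambda(A)=\int_{S^{d-1}}\int_0^\infty\mathbf{1}_A(r\theta)r^{-\alpha-1}e^{-\lambda r}\,dr\,\sigma(d\theta)$ and $\psi_\lambda(u)=\int_{\mathbb{R}^d}(\cos\langle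 u,x\rangle-1)\phi_\lambda(dx)$. $\mathbb{M}_\lambda$ is a family of $\mathbb{R}^d$-valued random vectors $\mathbb{M}_\lambda(A)$, indexed by Borel sets $A\subset\mathbb{R}^n$ of finite Lebesgue measure $|A|$, independent over disjoint sets, a.s. $\sigma$-additive over disjoint sequences whose union has finite measure, with $\mathbb{M}_\lambda(A)$ having log-characteristic function $|A|\psi_\lambda$. Stochastic integral: for simple $f=\sum_jD_j\mathbf{1}_{A_j}$ put $I(f)=\sum_jD_j\mathbb{M}_\lambda(A_j)$. A measurable $f:\mathbb{R}^n\to L(\mathbb{R}^d)$ belongs to $\mathcal{I}(\mathbb{M}_\lambda)$ if there are simple $f_k\to f$ a.e. such that $I(f_k\mathbf{1}_A)$ converges in probability for every Borel $A$; then $I(f)=\int f\,d\mathbb{M}_\lambda=\lim I(f_k)$. Known facts: $f\in\mathcal{I}(\mathbb{M}_\lambda)$ iff $\int_{\mathbb{R}^n}\int_{\mathbb{R}^d}(1\wedge\|f(s)x\|^2)\phi_\lambda(dx)ds<\infty$ (may be taken as the definition); $I$ is linear; $(I(f_1),\dots,I(f_k))^t$ has log-characteristic function $(u_1,\dots,u_k)^t\mapsto\int_{\mathbb{R}^n}\psi_\lambda(\sum_jf_j(s)^*u_j)ds$. Integrands need only be defined for Lebesgue-a.e. $s$. Under the stated hypotheses all integrals defining $X_\lambda(t)$, $\lambda\ge0$, exist. Localisability: an $\mathbb{R}^d$-valued random field $\mathbb{X}=\{X(t):t\in\mathbb{R}^n\}$ is $(E,D)$-localisable at $x$ with tangent field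 (local form) $\mathbb{X}'=\{X'(t):t\in\mathbb{R}^n\}$ if all finite-dimensional distributions of $\{c^{-D}(X(x+c^Et)-X(x)):t\in\mathbb{R}^n\}$ converge to those of $\mathbb{X}'$ as $c\to0$. *)

theory Defs
  imports "HOL-Probability.Probability"
begin

section \<open>Matrix powers and spectra\<close>

text \<open>HOL-Analysis provides no exponential for \<^typ>\<open>real^'m^'m\<close>: the type is not a
  \<^class>\<open>real_normed_algebra_1\<close>, and its \<open>*\<close> is componentwise.\<close>

primrec matrix_pow :: "real^'m^'m \<Rightarrow> nat \<Rightarrow> real^'m^'m" where
  "matrix_pow A 0 = mat 1"
| "matrix_pow A (Suc k) = A ** matrix_pow A k"

definition matrix_exp :: "real^'m^'m \<Rightarrow> real^'m^'m" where
  "matrix_exp A = (\<Sum>k. matrix_pow A k /\<^sub>R fact k)"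

text \<open>Meaningful for \<open>c > 0\<close>; since \<^prop>\<open>ln (0::real) = 0\<close>, the junk value at \<open>c = 0\<close> is the
  identity matrix.\<close>

definition matrix_powr :: "real \<Rightarrow> real^'m^'m \<Rightarrow> real^'m^'m" where
  "matrix_powr c B = matrix_exp (ln c *\<^sub>R B)"

definition eigenvalues :: "real^'m^'m \<Rightarrow> complex set" where
  "eigenvalues A = {z. \<exists>v. v \<noteq> 0 \<and> map_matrix complex_of_real A *v v = z *s v}"

definition pos_spectrum :: "(real^'m^'m) set" where
  "pos_spectrum = {A. \<forall>z\<in>eigenvalues A. Re z > 0}"

section \<open>Generalized polar coordinates and admissible functions\<close>

definition is_norm :: "('a::real_vector \<Rightarrow> real) \<Rightarrow> bool" where
  "is_norm N \<longleftrightarrow> (\<forall>x. N x \<ge> 0) \<and> (\<forall>x. N x = 0 \<longleftrightarrow> x = 0) \<and>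
     (\<forall>a x. N (a *\<^sub>R x) = \<bar>a\<bar> * N x) \<and> (\<forall>x y. N (x + y) \<le> N x + N y)"

definition polar_norm :: "real^'n^'n \<Rightarrow> (real^'n \<Rightarrow> real) \<Rightarrow> bool" where
  "polar_norm E N \<longleftrightarrow> is_norm N \<and>
     (\<exists>g. homeomorphism ({0<..} \<times> {\<theta>. N \<theta> = 1}) (UNIV - {0})
            (\<lambda>(c, \<theta>). matrix_powr c E *v \<theta>) g)"

definition polar_radius :: "real^'n^'n \<Rightarrow> (real^'n \<Rightarrow> real) \<Rightarrow> real^'n \<Rightarrow> real" where
  "polar_radius E N x =
     (if x = 0 then 0 else THE c. c > 0 \<and> (\<exists>\<theta>. N \<theta> = 1 \<and> x = matrix_powr c E *v \<theta>))"

definition E_homogeneous :: "real^'n^'n \<Rightarrow> (real^'n \<Rightarrow> real) \<Rightarrow> bool" where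
  "E_homogeneous E \<phi> \<longleftrightarrow> (\<forall>c>0. \<forall>x. x \<noteq> 0 \<longrightarrow> \<phi> (matrix_powr c E *v x) = c * \<phi> x)"

definition admissible ::
  "real \<Rightarrow> real^'n^'n \<Rightarrow> (real^'n \<Rightarrow> real) \<Rightarrow> (real^'n \<Rightarrow> real) \<Rightarrow> bool" where
  "admissible \<beta> E N \<phi> \<longleftrightarrow>
     (\<forall>x. \<phi> x \<ge> 0) \<and> (\<forall>x. x \<noteq> 0 \<longrightarrow> \<phi> x > 0) \<and> continuous_on UNIV \<phi> \<and>
     (\<forall>A B. 0 < A \<and> A < B \<longrightarrow>
        (\<exists>C>0. \<forall>x y. A \<le> norm y \<and> norm y \<le> B \<and> polar_radius E N x \<le> 1 \<longrightarrow>
           \<bar>\<phi> (x + y) - \<phi> y\<bar> \<le> C * polar_radius E N x powr \<beta>))"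

section \<open>Spectral measure and tempered stable random measure\<close>

definition spectral_measure :: "(real^'d) measure \<Rightarrow> bool" where
  "spectral_measure \<sigma> \<longleftrightarrow>
     sets \<sigma> = sets (restrict_space borel (sphere 0 1)) \<and> finite_measure \<sigma> \<and>
     (\<forall>A\<in>sets \<sigma>. emeasure \<sigma> (uminus ` A) = emeasure \<sigma> A) \<and>
     (\<forall>V. subspace V \<and> dim V = CARD('d) - 1 \<longrightarrow> emeasure \<sigma> (sphere 0 1 - V) \<noteq> 0)"

definition tempered_levy :: "(real^'d) measure \<Rightarrow> real \<Rightarrow> real \<Rightarrow> (real^'d) measure" where
  "tempered_levy \<sigma> \<alpha> l = measure_of UNIV (sets borel)
     (\<lambda>A. \<integral>\<^sup>+ \<theta>. (\<integral>\<^sup>+ r. indicator {0<..} r *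
        (indicator A (r *\<^sub>R \<theta>) * ennreal (r powr (- \<alpha> - 1) * exp (- l * r))) \<partial>lborel) \<partial>\<sigma>)"

lemma emeasure_tempered_levy:
  fixes \<sigma> :: "(real^'d) measure"
  assumes \<sigma>: "sets \<sigma> = sets (restrict_space borel (sphere 0 1))" and A: "A \<in> sets borel"
  shows "emeasure (tempered_levy \<sigma> \<alpha> l) A =
    (\<integral>\<^sup>+ \<theta>. (\<integral>\<^sup>+ r. indicator {0<..} r *
        (indicator A (r *\<^sub>R \<theta>) * ennreal (r powr (- \<alpha> - 1) * exp (- l * r))) \<partial>lborel) \<partial>\<sigma>)"
proof -
  define f where "f A \<theta> r = indicator {0<..} r *
    (indicator A (r *\<^sub>R \<theta>) * ennreal (r powr (- \<alpha> - 1) * exp (- l * r)))"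
    for A and \<theta> :: "real^'d" and r :: real
  have id: "(\<lambda>x. x) \<in> \<sigma> \<rightarrow>\<^sub>M borel"
    by (subst measurable_cong_sets[OF \<sigma> refl]) (rule measurable_restrict_space1, simp)
  have f: "(\<lambda>(\<theta>, r). f A \<theta> r) \<in> borel_measurable (\<sigma> \<Otimes>\<^sub>M lborel)" if A: "A \<in> sets borel" for A
  proof -
    have "(\<lambda>p. snd p *\<^sub>R fst p) \<in> \<sigma> \<Otimes>\<^sub>M lborel \<rightarrow>\<^sub>M borel"
      using measurable_compose[OF measurable_fst id, of lborel]
        measurable_compose[OF measurable_snd, of id lborel borel \<sigma>]
      by (intro borel_measurable_scaleR) (simp_all add: id_def)
    from measurable_compose[OF this borel_measurable_indicator[OF A]]
    show ?thesis unfolding f_def case_prod_beta by measurable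
  qed
  have f1: "f A \<theta> \<in> borel_measurable lborel" if A: "A \<in> sets borel" for A \<theta>
  proof -
    have "(\<lambda>r. r *\<^sub>R \<theta>) \<in> lborel \<rightarrow>\<^sub>M borel" by simp
    from measurable_compose[OF this borel_measurable_indicator[OF A]]
    show ?thesis unfolding f_def by measurable
  qed
  have f2: "(\<lambda>\<theta>. \<integral>\<^sup>+ r. f A \<theta> r \<partial>lborel) \<in> borel_measurable \<sigma>" if "A \<in> sets borel" for A
    using lborel.borel_measurable_nn_integral[OF f[OF that]] .
  have eq: "tempered_levy \<sigma> \<alpha> l =
      measure_of UNIV (sets borel) (\<lambda>A. \<integral>\<^sup>+ \<theta>. (\<integral>\<^sup>+ r. f A \<theta> r \<partial>lborel) \<partial>\<sigma>)"
    unfolding tempered_levy_def f_def ..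
  have sets_eq: "sets (tempered_levy \<sigma> \<alpha> l) = sets borel"
    using sets.sigma_sets_eq[of borel] by (simp add: tempered_levy_def)
  have "emeasure (tempered_levy \<sigma> \<alpha> l) A = (\<integral>\<^sup>+ \<theta>. (\<integral>\<^sup>+ r. f A \<theta> r \<partial>lborel) \<partial>\<sigma>)"
  proof (rule emeasure_measure_of[OF eq])
    show "positive (sets (tempered_levy \<sigma> \<alpha> l)) (\<lambda>A. \<integral>\<^sup>+ \<theta>. (\<integral>\<^sup>+ r. f A \<theta> r \<partial>lborel) \<partial>\<sigma>)"
      by (simp add: positive_def f_def)
    show "countably_additive (sets (tempered_levy \<sigma> \<alpha> l))
            (\<lambda>A. \<integral>\<^sup>+ \<theta>. (\<integral>\<^sup>+ r. f A \<theta> r \<partial>lborel) \<partial>\<sigma>)"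
    proof (rule countably_additiveI)
      fix B :: "nat \<Rightarrow> (real^'d) set"
      assume "range B \<subseteq> sets (tempered_levy \<sigma> \<alpha> l)" and disj: "disjoint_family B"
      then have B: "B i \<in> sets borel" for i
        by (auto simp: sets_eq)
      have "(\<Sum>i. f (B i) \<theta> r) = f (\<Union>i. B i) \<theta> r" for \<theta> r
        using suminf_indicator[OF disj, of "r *\<^sub>R \<theta>"] by (simp add: f_def)
      then show "(\<Sum>i. \<integral>\<^sup>+ \<theta>. (\<integral>\<^sup>+ r. f (B i) \<theta> r \<partial>lborel) \<partial>\<sigma>) =
            (\<integral>\<^sup>+ \<theta>. (\<integral>\<^sup>+ r. f (\<Union>i. B i) \<theta> r \<partial>lborel) \<partial>\<sigma>)"
        using f1[OF B] f2[OF B] by (simp flip: nn_integral_suminf)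
    qed
    show "A \<in> sets (tempered_levy \<sigma> \<alpha> l)"
      using A by (simp add: sets_eq)
  qed simp
  then show ?thesis by (simp add: f_def)
qed

definition log_char :: "(real^'d) measure \<Rightarrow> real \<Rightarrow> real \<Rightarrow> real^'d \<Rightarrow> real" where
  "log_char \<sigma> \<alpha> l u = (\<integral>x. (cos (u \<bullet> x) - 1) \<partial>tempered_levy \<sigma> \<alpha> l)"

definition tempered_random_measure ::
  "(real^'d) measure \<Rightarrow> real \<Rightarrow> real \<Rightarrow> 'w measure \<Rightarrow>
   ((real^'n) set \<Rightarrow> 'w \<Rightarrow> real^'d) \<Rightarrow> bool" where
  "tempered_random_measure \<sigma> \<alpha> l P M \<longleftrightarrow>
     prob_space P \<and>
     (\<forall>A\<in>fmeasurable lborel. M A \<in> borel_measurable P) \<and>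
     (\<forall>A :: nat \<Rightarrow> (real^'n) set. range A \<subseteq> fmeasurable lborel \<and> disjoint_family A \<longrightarrow>
        prob_space.indep_vars P (\<lambda>_. borel) (\<lambda>i. M (A i)) UNIV) \<and>
     (\<forall>A :: nat \<Rightarrow> (real^'n) set. range A \<subseteq> fmeasurable lborel \<and> disjoint_family A \<and>
          (\<Union>i. A i) \<in> fmeasurable lborel \<longrightarrow>
        (AE w in P. (\<lambda>i. M (A i) w) sums M (\<Union>i. A i) w)) \<and>
     (\<forall>A\<in>fmeasurable lborel. \<forall>u.
        (\<integral>w. iexp (u \<bullet> M A w) \<partial>P) = exp (complex_of_real (measure lborel A * log_char \<sigma> \<alpha> l u)))"

section \<open>Stochastic integral\<close>

text \<open>The integral of a simple integrand, computed from its canonical representation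
  \<open>f = (\<Sum>D\<noteq>0. D * indicator {s. f s = D})\<close>; by additivity of \<open>M\<close>, any other representation gives
  the same value almost surely.\<close>

definition simple_stoch_integral ::
  "((real^'n) set \<Rightarrow> 'w \<Rightarrow> real^'d) \<Rightarrow> (real^'n \<Rightarrow> real^'d^'d) \<Rightarrow> 'w \<Rightarrow> real^'d" where
  "simple_stoch_integral M f w = (\<Sum>D\<in>range f - {0}. D *v M {s. f s = D} w)"

definition converges_in_prob ::
  "'w measure \<Rightarrow> (nat \<Rightarrow> 'w \<Rightarrow> 'v::euclidean_space) \<Rightarrow> ('w \<Rightarrow> 'v) \<Rightarrow> bool" where
  "converges_in_prob P Y Z \<longleftrightarrow>
     (\<forall>\<epsilon>>0. (\<lambda>k. measure P {w \<in> space P. norm (Y k w - Z w) > \<epsilon>}) \<longlonglongrightarrow> 0)"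

text \<open>\<open>f\<close> is integrable with respect to \<open>M\<close>, and the random vector \<open>Z\<close> is (a version of) its
  integral, which is unique only up to almost sure equality.\<close>

definition has_stoch_integral ::
  "'w measure \<Rightarrow> ((real^'n) set \<Rightarrow> 'w \<Rightarrow> real^'d) \<Rightarrow> (real^'n \<Rightarrow> real^'d^'d) \<Rightarrow>
   ('w \<Rightarrow> real^'d) \<Rightarrow> bool" where
  "has_stoch_integral P M f Z \<longleftrightarrow>
     f \<in> borel_measurable borel \<and> Z \<in> borel_measurable P \<and>
     (\<exists>F. (\<forall>k. Bochner_Integration.simple_bochner_integrable lborel (F k)) \<and>
        (AE s in lborel. (\<lambda>k. F k s) \<longlonglongrightarrow> f s) \<and>
        (\<forall>A\<in>sets borel. \<exists>Y\<in>borel_measurable P.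
           converges_in_prob P (\<lambda>k. simple_stoch_integral M (\<lambda>s. indicator A s *\<^sub>R F k s)) Y) \<and>
        converges_in_prob P (\<lambda>k. simple_stoch_integral M (F k)) Z)"

section \<open>Localisability\<close>

definition random_field :: "'w measure \<Rightarrow> ('t \<Rightarrow> 'w \<Rightarrow> 'v::euclidean_space) \<Rightarrow> bool" where
  "random_field P X \<longleftrightarrow> prob_space P \<and> (\<forall>t. X t \<in> borel_measurable P)"

text \<open>Weak convergence of all finite-dimensional distributions, tested against bounded continuous
  functions of the values at finitely many points.\<close>

definition fdd_converges ::
  "'w measure \<Rightarrow> ('c \<Rightarrow> 't \<Rightarrow> 'w \<Rightarrow> 'v::euclidean_space) \<Rightarrow>
   'w' measure \<Rightarrow> ('t \<Rightarrow> 'w' \<Rightarrow> 'v) \<Rightarrow> 'c filter \<Rightarrow> bool" where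
  "fdd_converges P Y P' X' F \<longleftrightarrow>
     (\<forall>T g. finite T \<and> continuous_map (product_topology (\<lambda>_. euclidean) T) euclideanreal g \<and>
        bounded (g ` (T \<rightarrow>\<^sub>E UNIV)) \<longrightarrow>
        ((\<lambda>c. \<integral>w. g (\<lambda>t\<in>T. Y c t w) \<partial>P) \<longlongrightarrow> (\<integral>w. g (\<lambda>t\<in>T. X' t w) \<partial>P')) F)"

definition localisable ::
  "real^'n^'n \<Rightarrow> real^'d^'d \<Rightarrow> real^'n \<Rightarrow> 'w measure \<Rightarrow> (real^'n \<Rightarrow> 'w \<Rightarrow> real^'d) \<Rightarrow>
   'w' measure \<Rightarrow> (real^'n \<Rightarrow> 'w' \<Rightarrow> real^'d) \<Rightarrow> bool" where
  "localisable E D x P X P' X' \<longleftrightarrow>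
     random_field P X \<and> random_field P' X' \<and>
     fdd_converges P
       (\<lambda>c t w. matrix_powr c (- D) *v (X (x + matrix_powr c E *v t) w - X x w)) P' X' (at_right 0)"

text \<open>The value at the two points \<open>s = t\<close> and \<open>s = 0\<close>, where \<open>\<phi>\<close> is evaluated at \<open>0\<close>, is
  immaterial.\<close>

definition ma_kernel ::
  "real \<Rightarrow> real^'n^'n \<Rightarrow> real^'d^'d \<Rightarrow> (real^'n \<Rightarrow> real) \<Rightarrow> real^'n \<Rightarrow> real^'n \<Rightarrow> real^'d^'d" where
  "ma_kernel \<alpha> E D \<phi> t s =
     matrix_powr (\<phi> (t - s)) (D - (trace E / \<alpha>) *\<^sub>R mat 1) -
     matrix_powr (\<phi> (- s)) (D - (trace E / \<alpha>) *\<^sub>R mat 1)"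

end

theory Submission
  imports Defs "HOL-Computational_Algebra.Fundamental_Theorem_Algebra"
begin

text \<open>By homogeneity of \<open>\<phi>\<close> and the substitution \<open>s \<mapsto> x + c\<^sup>E s\<close>, whose Jacobian determinant is
  \<open>c\<^sup>q\<close>, the log-characteristic function of the rescaled increments at \<open>x\<close> is the integral of
  \<open>c\<^sup>q \<psi>\<^sub>\<lambda> (c powr (- q / \<alpha>) v(s)) = \<psi>\<^sub>\<mu> (v(s))\<close> with \<open>\<mu> = \<lambda> c powr (q / \<alpha>)\<close>, where \<open>v\<close> is the linear
  combination of kernels belonging to \<open>\<X>\<^sub>0\<close>. As \<open>q > 0\<close>, tempering disappears when \<open>c \<rightarrow> 0\<close>, and
  \<open>|\<psi>\<^sub>\<mu>| \<le> |\<psi>\<^sub>0|\<close> allows dominated convergence; a finite-dimensional Levy continuity theorem concludes.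

  The characteristic function of a stochastic integral is obtained from the quasi-triangle
  inequality \<open>p (v + w) \<le> (1 + \<eta>) p v + (1 + 1/\<eta>) p w\<close> for \<open>p = - \<psi>\<^sub>\<lambda>\<close>: if the integrals of simple functions \<open>V\<^sub>k\<close>
  converge in probability, then the integral of \<open>p (V\<^sub>k - V\<^sub>m)\<close> is small for large \<open>k, m\<close>, and Fatou's
  lemma replaces \<open>V\<^sub>m\<close> by its limit.\<close>

section \<open>Matrix exponentials\<close>

text \<open>What is known of an integral is only its approximation by simple integrands, which
  converge merely almost everywhere, so nothing dominates \<open>exponent l (V k s)\<close>. The
  missing control is read off the random side: for simple \<open>v\<close> the number
  \<open>1 - exp (- mean_exponent v)\<close> is the distance of a characteristic function from 1,
  and a truncated mean bounds it. The same argument makes \<open>mean_exponent\<close> of the limit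
  finite; for \<open>l = 0\<close> this is the integrable majorant of the final passage to the
  limit, supplied by the existence of the integrals \<open>X 0 t\<close>. Joint laws reduce to real
  random variables: pairing the value at \<open>t\<close> with \<open>u t\<close> and adding over
  \<open>t\<close> gives the integral of one vector-valued function, the sum of the
  \<open>u t v* f t s\<close>, where \<open>u v* A\<close> is the transpose of \<open>A\<close>
  applied to \<open>u\<close>. The two fields live on different probability spaces and are compared
  through characteristic functions alone.\<close>

text \<open>Endomorphisms with operator norm and composition as product form a Banach algebra, so the
  library's \<^const>\<open>exp\<close> applies to them; \<^const>\<open>matrix_exp\<close> is transported from there.\<close>

typedef (overloaded) ('a::euclidean_space) endo = "UNIV :: ('a \<Rightarrow>\<^sub>L 'a) set"
  morphisms blinfun_of_endo endo_of_blinfun ..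

setup_lifting type_definition_endo

instantiation endo :: (euclidean_space) real_normed_algebra_1
begin

lift_definition zero_endo :: "'a endo" is 0 .
lift_definition one_endo :: "'a endo" is id_blinfun .
lift_definition plus_endo :: "'a endo \<Rightarrow> 'a endo \<Rightarrow> 'a endo" is "(+)" .
lift_definition minus_endo :: "'a endo \<Rightarrow> 'a endo \<Rightarrow> 'a endo" is "(-)" .
lift_definition uminus_endo :: "'a endo \<Rightarrow> 'a endo" is uminus .
lift_definition times_endo :: "'a endo \<Rightarrow> 'a endo \<Rightarrow> 'a endo" is blinfun_compose .
lift_definition scaleR_endo :: "real \<Rightarrow> 'a endo \<Rightarrow> 'a endo" is scaleR .
lift_definition norm_endo :: "'a endo \<Rightarrow> real" is norm .
definition dist_endo :: "'a endo \<Rightarrow> 'a endo \<Rightarrow> real" where "dist_endo x y = norm (x - y)"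
definition sgn_endo :: "'a endo \<Rightarrow> 'a endo" where "sgn_endo x = inverse (norm x) *\<^sub>R x"
definition [code del]:
  "(uniformity :: ('a endo \<times> 'a endo) filter) = (INF e\<in>{0<..}. principal {(x, y). dist x y < e})"
definition open_endo :: "'a endo set \<Rightarrow> bool" where
  "open_endo U = (\<forall>x\<in>U. eventually (\<lambda>(x', y). x' = x \<longrightarrow> y \<in> U) uniformity)"

instance
proof
  fix x y z :: "'a endo" and a b :: real
  show "x * y * z = x * (y * z)"
    by transfer (auto intro: blinfun_eqI)
  show "(x + y) * z = x * z + y * z" "x * (y + z) = x * y + x * z"
    by (transfer, auto intro!: blinfun_eqI simp: blinfun.add_left blinfun.add_right)+
  show "a *\<^sub>R x * y = a *\<^sub>R (x * y)" "x * a *\<^sub>R y = a *\<^sub>R (x * y)"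
    by (transfer, auto intro!: blinfun_eqI simp: blinfun.scaleR_left blinfun.scaleR_right)+
  show "1 * x = x" "x * 1 = x"
    by (transfer, auto intro: blinfun_eqI)+
  show "(0::'a endo) \<noteq> 1"
  proof
    assume "(0::'a endo) = 1"
    then have "norm (0::'a endo) = norm (1::'a endo)" by (rule arg_cong)
    then show False by transfer simp
  qed
  show "norm (x * y) \<le> norm x * norm y"
    by transfer (rule norm_blinfun_compose)
  show "norm (1 :: 'a endo) = 1"
    by transfer simp
  show "norm (x + y) \<le> norm x + norm y"
    by transfer (rule norm_triangle_ineq)
  show "norm (a *\<^sub>R x) = \<bar>a\<bar> * norm x" "norm x = 0 \<longleftrightarrow> x = 0"
    by (transfer, simp)+
  show "x + y + z = x + (y + z)" "x + y = y + x" "0 + x = x" "- x + x = 0" "x - y = x + - y"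
    "a *\<^sub>R (x + y) = a *\<^sub>R x + a *\<^sub>R y" "(a + b) *\<^sub>R x = a *\<^sub>R x + b *\<^sub>R x"
    "a *\<^sub>R b *\<^sub>R x = (a * b) *\<^sub>R x" "1 *\<^sub>R x = x"
    by (transfer, simp add: scaleR_add_left scaleR_add_right)+
qed (simp_all add: dist_endo_def sgn_endo_def uniformity_endo_def open_endo_def)

end

lemma bounded_linear_blinfun_of_endo: "bounded_linear blinfun_of_endo"
  by (rule bounded_linear_intro[where K = 1])
    (simp_all add: plus_endo.rep_eq scaleR_endo.rep_eq norm_endo.rep_eq)

instance endo :: (euclidean_space) banach
proof
  fix X :: "nat \<Rightarrow> 'a endo"
  assume "Cauchy X"
  then have "Cauchy (\<lambda>k. blinfun_of_endo (X k))"
    by (rule bounded_linear.Cauchy[OF bounded_linear_blinfun_of_endo])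
  then obtain L where "(\<lambda>k. blinfun_of_endo (X k)) \<longlonglongrightarrow> L"
    unfolding Cauchy_convergent_iff convergent_def by blast
  then have "(\<lambda>k. norm (blinfun_of_endo (X k) - L)) \<longlonglongrightarrow> 0"
    by (rule tendsto_norm_zero[OF LIM_zero])
  then have "(\<lambda>k. norm (X k - endo_of_blinfun L)) \<longlonglongrightarrow> 0"
    by (simp add: norm_endo.rep_eq minus_endo.rep_eq endo_of_blinfun_inverse)
  then have "X \<longlonglongrightarrow> endo_of_blinfun L"
    by (rule LIM_zero_cancel[OF tendsto_norm_zero_cancel])
  then show "convergent X"
    unfolding convergent_def by blast
qed

section \<open>Transport between matrices and endomorphisms; matrix powers\<close>

definition endo_of_matrix :: "real^'m^'m \<Rightarrow> (real^'m) endo" where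
  "endo_of_matrix A = endo_of_blinfun (Blinfun ((*v) A))"

definition matrix_of_endo :: "(real^'m) endo \<Rightarrow> real^'m^'m" where
  "matrix_of_endo x = matrix (blinfun_apply (blinfun_of_endo x))"

lemma blinfun_of_endo_of_matrix:
  "blinfun_apply (blinfun_of_endo (endo_of_matrix A)) v = A *v v"
  by (simp add: endo_of_matrix_def endo_of_blinfun_inverse bounded_linear_Blinfun_apply)

lemma matrix_of_endo_vec: "matrix_of_endo x *v v = blinfun_apply (blinfun_of_endo x) v"
  unfolding matrix_of_endo_def
  using bounded_linear.linear[OF blinfun.bounded_linear_right]
  by (intro matrix_works) (simp only: linear_matrix_vector_mul_eq)

lemma matrix_of_endo_of_matrix [simp]: "matrix_of_endo (endo_of_matrix A) = A"
  by (simp add: matrix_eq matrix_of_endo_vec blinfun_of_endo_of_matrix)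

lemma matrix_of_endo_inject: "matrix_of_endo x = matrix_of_endo y \<longleftrightarrow> x = y"
proof
  assume "matrix_of_endo x = matrix_of_endo y"
  then have "blinfun_of_endo x = blinfun_of_endo y"
    by (intro blinfun_eqI) (simp flip: matrix_of_endo_vec)
  then show "x = y" by (simp add: blinfun_of_endo_inject)
qed simp

lemma matrix_of_endo_mult: "matrix_of_endo (x * y) = matrix_of_endo x ** matrix_of_endo y"
  by (simp add: matrix_eq flip: matrix_vector_mul_assoc)
     (simp add: matrix_of_endo_vec times_endo.rep_eq)

lemma matrix_of_endo_one: "matrix_of_endo 1 = mat 1"
  by (simp add: matrix_eq matrix_of_endo_vec one_endo.rep_eq)

lemma matrix_of_endo_add: "matrix_of_endo (x + y) = matrix_of_endo x + matrix_of_endo y"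
  by (simp add: matrix_eq matrix_of_endo_vec plus_endo.rep_eq blinfun.add_left
      matrix_vector_mult_add_rdistrib)

lemma matrix_of_endo_scaleR: "matrix_of_endo (a *\<^sub>R x) = a *\<^sub>R matrix_of_endo x"
  by (simp add: matrix_eq matrix_of_endo_vec scaleR_endo.rep_eq blinfun.scaleR_left
      flip: scaleR_matrix_vector_assoc)

lemma endo_of_matrix_add: "endo_of_matrix (A + B) = endo_of_matrix A + endo_of_matrix B"
  by (simp add: matrix_of_endo_add flip: matrix_of_endo_inject)

lemma endo_of_matrix_scaleR: "endo_of_matrix (a *\<^sub>R A) = a *\<^sub>R endo_of_matrix A"
  by (simp add: matrix_of_endo_scaleR flip: matrix_of_endo_inject)

lemma endo_of_matrix_mult: "endo_of_matrix (A ** B) = endo_of_matrix A * endo_of_matrix B"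
  by (simp add: matrix_of_endo_mult flip: matrix_of_endo_inject)

lemma endo_of_matrix_one: "endo_of_matrix (mat 1) = 1"
  by (simp add: matrix_of_endo_one flip: matrix_of_endo_inject)

text \<open>Matrices converge entrywise, so continuity of the single entries is enough to carry
  series and derivatives over from \<open>endo\<close>, without comparing the operator norm with the
  norm of matrices.\<close>

lemma bounded_linear_matrix_of_endo_nth: "bounded_linear (\<lambda>x. matrix_of_endo x $ i $ j)"
proof -
  have "bounded_linear (\<lambda>x. blinfun_apply (blinfun_of_endo x) (axis j 1) $ i)"
    by (intro bounded_linear_compose[OF bounded_linear_vec_nth]
        bounded_linear_compose[OF blinfun.bounded_linear_left bounded_linear_blinfun_of_endo])
  then show ?thesis
    by (simp add: matrix_of_endo_def matrix_def)
qed

lemma matrix_exp_eq_endo_exp: "matrix_exp A = matrix_of_endo (exp (endo_of_matrix A))"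
proof -
  have pow: "matrix_pow A k = matrix_of_endo (endo_of_matrix A ^ k)" for k
    by (induction k) (simp_all add: matrix_of_endo_one matrix_of_endo_mult)
  have "(\<lambda>k. (matrix_pow A k /\<^sub>R fact k) $ i $ j) sums (matrix_of_endo (exp (endo_of_matrix A)) $ i $ j)"
    for i j
    using bounded_linear.sums[OF bounded_linear_matrix_of_endo_nth exp_converges[of "endo_of_matrix A"]]
    by (simp add: pow matrix_of_endo_scaleR)
  then have "(\<lambda>k. matrix_pow A k /\<^sub>R fact k) sums matrix_of_endo (exp (endo_of_matrix A))"
    unfolding sums_def by (intro vec_tendstoI) simp
  then show ?thesis
    by (simp add: matrix_exp_def sums_iff)
qed

lemma matrix_exp_add:
  assumes "A ** B = B ** A"
  shows "matrix_exp (A + B) = matrix_exp A ** matrix_exp B"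
proof -
  have "endo_of_matrix A * endo_of_matrix B = endo_of_matrix B * endo_of_matrix A"
    using assms by (simp flip: endo_of_matrix_mult)
  then show ?thesis
    by (simp add: matrix_exp_eq_endo_exp endo_of_matrix_add exp_add_commuting matrix_of_endo_mult)
qed

lemma matrix_exp_scaleR_mat_1: "matrix_exp (a *\<^sub>R mat 1) = exp a *\<^sub>R (mat 1 :: real^'m^'m)"
proof -
  have "exp (a *\<^sub>R (1 :: (real^'m) endo)) = exp a *\<^sub>R 1"
    using exp_of_real[of a, where 'a = "(real^'m) endo"] by (simp add: of_real_def)
  then show ?thesis
    by (simp add: matrix_exp_eq_endo_exp endo_of_matrix_scaleR endo_of_matrix_one
        matrix_of_endo_scaleR matrix_of_endo_one)
qed

lemma matrix_exp_zero: "matrix_exp 0 = mat 1"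
  using matrix_exp_scaleR_mat_1[of 0] by simp

lemma matrix_exp_has_derivative_at_0:
  "((\<lambda>t. matrix_exp (t *\<^sub>R A) $ i $ j) has_field_derivative A $ i $ j) (at 0)"
proof -
  let ?x = "endo_of_matrix A"
  have "((\<lambda>t. exp (t *\<^sub>R ?x)) has_vector_derivative exp (0 *\<^sub>R ?x) * ?x) (at 0)"
    by (rule exp_scaleR_has_vector_derivative_right)
  from bounded_linear.has_vector_derivative[OF bounded_linear_matrix_of_endo_nth this, of i j]
  show ?thesis
    by (simp add: matrix_exp_eq_endo_exp endo_of_matrix_scaleR has_real_derivative_iff_has_vector_derivative)
qed

lemma matrix_scaleR_mult_commute:
  fixes A B :: "real^'m^'m"
  shows "A ** (a *\<^sub>R B) = a *\<^sub>R (A ** B)" "(a *\<^sub>R A) ** B = a *\<^sub>R (A ** B)"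
  by (simp_all add: matrix_eq flip: matrix_vector_mul_assoc scaleR_matrix_vector_assoc)
     (simp add: matrix_vector_mult_scaleR)

text \<open>Differentiating the Leibniz formula leaves products over all rows but one. A permutation
  other than the identity moves at least two points, \<open>k\<close> and \<open>p k\<close>, so
  whichever row is omitted, an off-diagonal entry of \<open>mat 1\<close> remains and kills the
  product. The field is general because real matrices are needed for the exponential and complex
  ones for the characteristic polynomial.\<close>

lemma has_field_derivative_det_at_mat_1:
  fixes M :: "'a::real_normed_field \<Rightarrow> 'a^'n^'n"
  assumes M: "M a = mat 1"
    and D: "\<And>i j. ((\<lambda>t. M t $ i $ j) has_field_derivative M' $ i $ j) (at a)"
  shows "((\<lambda>t. det (M t)) has_field_derivative trace M') (at a)"
proof -
  let ?p = "\<lambda>p. of_int (sign p) * (\<Sum>i\<in>UNIV. M' $ i $ p i * (\<Prod>k\<in>UNIV - {i}. M a $ k $ p k))"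
  have "((\<lambda>t. det (M t)) has_field_derivative (\<Sum>p | p permutes (UNIV :: 'n set). ?p p)) (at a)"
    unfolding det_def
    by (intro DERIV_sum DERIV_cmult has_field_derivative_prod D)
  moreover have "(\<Sum>p | p permutes (UNIV :: 'n set). ?p p) = (\<Sum>p | p permutes (UNIV :: 'n set). if p = id then trace M' else 0)"
  proof (rule sum.cong[OF refl])
    fix p assume "p \<in> {p. p permutes (UNIV :: 'n set)}"
    then have p: "p permutes UNIV" by simp
    show "?p p = (if p = id then trace M' else 0)"
    proof (cases "p = id")
      case True
      then show ?thesis by (simp add: M mat_def trace_def)
    next
      case False
      have "(\<Prod>k\<in>UNIV - {i}. M a $ k $ p k) = 0" for i
      proof -
        obtain k where k: "p k \<noteq> k" using False by (auto simp: fun_eq_iff)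
        obtain k where "k \<noteq> i" "p k \<noteq> k"
        proof (cases "k = i")
          case True
          have "p (p k) \<noteq> p k" using k p by (simp add: permutes_def bij_def inj_def) (metis permutes_inj injD)
          with k True that[of "p k"] show ?thesis by auto
        qed (use k that in auto)
        then show ?thesis
          by (intro prod_zero bexI[of _ k]) (auto simp: M mat_def)
      qed
      then have "?p p = 0" by (simp only: mult_zero_right sum.neutral_const)
      with False show ?thesis by simp
    qed
  qed
  ultimately show ?thesis
    by (simp add: finite_permutations)
qed

lemma matrix_exp_scaleR_add:
  "matrix_exp ((s + t) *\<^sub>R A) = matrix_exp (s *\<^sub>R A) ** matrix_exp (t *\<^sub>R A)"
  unfolding scaleR_add_left
  by (rule matrix_exp_add) (simp only: matrix_scaleR_mult_commute scaleR_left_commute)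

text \<open>The function \<open>d\<close> is multiplicative in \<open>t\<close>, so its derivative
  at 0 yields the equation \<open>d' = trace A * d\<close> everywhere, with \<open>d 0 = 1\<close>.
  The product with the inverse of the expected solution has derivative zero and is constant.\<close>

lemma det_matrix_exp: "det (matrix_exp A) = exp (trace A)" for A :: "real^'n^'n"
proof -
  define d where "d t = det (matrix_exp (t *\<^sub>R A))" for t
  have add: "d (s + t) = d s * d t" for s t
    by (simp only: d_def matrix_exp_scaleR_add det_mul)
  have d0: "(d has_field_derivative trace A) (at 0)"
    unfolding d_def
    by (rule has_field_derivative_det_at_mat_1) (simp_all add: matrix_exp_zero matrix_exp_has_derivative_at_0)
  have d: "(d has_field_derivative d t * trace A) (at t)" for t
  proof -
    have "((\<lambda>h. d t * d h) has_field_derivative d t * trace A) (at (t - t))"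
      using d0 by (intro DERIV_cmult) simp
    then have "((\<lambda>s. d t * d (s + - t)) has_field_derivative d t * trace A) (at t)"
      using DERIV_shift[of "\<lambda>s. d t * d (s + - t)" "d t * trace A" 0 t] by simp
    then show ?thesis by (simp only: add[symmetric] add_uminus_conv_diff add_diff_cancel_left' diff_add_cancel add.commute[of t])
  qed
  have "((\<lambda>t. exp (- trace A * t)) has_field_derivative exp (- trace A * t) * - trace A) (at t)" for t
    by (auto intro!: derivative_eq_intros)
  from DERIV_mult[OF d this]
  have "((\<lambda>t. d t * exp (- trace A * t)) has_field_derivative 0) (at t)" for t
    by (simp add: algebra_simps)
  then have "d 1 * exp (- trace A * 1) = d 0 * exp (- trace A * 0)"
    by (intro DERIV_isconst_all[where f = "\<lambda>t. d t * exp (- trace A * t)"]) simp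
  then have "d 1 * exp (- trace A) * exp (trace A) = exp (trace A)"
    by (simp add: d_def matrix_exp_zero)
  then have "d 1 = exp (trace A)"
    by (simp only: mult.assoc exp_add[symmetric]) simp
  then show ?thesis by (simp add: d_def)
qed

lemma matrix_powr_mult:
  assumes "a > 0" "b > 0"
  shows "matrix_powr (a * b) B = matrix_powr a B ** matrix_powr b B"
  using assms by (simp only: matrix_powr_def ln_mult_pos matrix_exp_scaleR_add)

lemma matrix_powr_uminus: "matrix_powr c (- B) ** matrix_powr c B = mat 1"
  using matrix_exp_scaleR_add[of "- ln c" "ln c" B]
  by (simp only: matrix_powr_def scaleR_minus_left scaleR_minus_right add.left_inverse scaleR_zero_left matrix_exp_zero)

text \<open>Splits a factor of the kernel into a power of \<open>D\<close>, which the normalisation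
  by \<open>matrix_powr c (- D)\<close> undoes, and a scalar, which combines with the Jacobian of
  the substitution.\<close>

lemma matrix_powr_diff_scaled_mat_1:
  assumes "c > 0"
  shows "matrix_powr c (B - a *\<^sub>R mat 1) = c powr (- a) *\<^sub>R matrix_powr c B"
proof -
  have "matrix_exp (ln c *\<^sub>R B + (- a * ln c) *\<^sub>R mat 1) = matrix_exp (ln c *\<^sub>R B) ** matrix_exp ((- a * ln c) *\<^sub>R mat 1)"
    by (rule matrix_exp_add) (simp only: matrix_scaleR_mult_commute matrix_mul_lid matrix_mul_rid, rule scaleR_left_commute)
  then have "matrix_exp (ln c *\<^sub>R B + (- a * ln c) *\<^sub>R mat 1) = exp (- a * ln c) *\<^sub>R matrix_exp (ln c *\<^sub>R B)"
    by (simp only: matrix_exp_scaleR_mat_1 matrix_scaleR_mult_commute matrix_mul_rid)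
  then show ?thesis
    using assms by (simp add: matrix_powr_def powr_def scaleR_diff_right mult.commute)
qed

lemma det_matrix_powr: "c > 0 \<Longrightarrow> det (matrix_powr c A) = c powr trace A"
  by (simp add: matrix_powr_def det_matrix_exp powr_def trace_def sum_distrib_left mult.commute)


section \<open>Positivity of the trace\<close>

lemma det_poly_entries:
  fixes P :: "'a::comm_ring_1 poly^'n^'n"
  shows "poly (det P) h = det (\<chi> i j. poly (P $ i $ j) h)"
proof -
  have "poly (of_int (sign p)) h = of_int (sign p)" for p :: "'n \<Rightarrow> 'n"
    by (simp add: sign_def)
  then show ?thesis
    by (simp add: det_def poly_sum poly_prod)
qed

text \<open>A polynomial with value 1 at 0 is the product of the factors \<open>1 - h / z\<close>
  over its roots \<open>z\<close>, so its derivative at 0 is minus the sum of the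
  \<open>1 / z\<close>. The induction removes one root; the weak inequality covers the constant
  polynomial left at the end.\<close>

lemma Re_poly_pderiv_0:
  fixes p :: "complex poly"
  assumes "poly p 0 = 1" and "\<And>z. poly p z = 0 \<Longrightarrow> Re (1 / z) > 0"
  shows "Re (poly (pderiv p) 0) \<le> 0 \<and> (degree p > 0 \<longrightarrow> Re (poly (pderiv p) 0) < 0)"
  using assms
proof (induction "degree p" arbitrary: p)
  case 0
  then have "pderiv p = 0" by (simp add: pderiv_eq_0_iff)
  with 0 show ?case by simp
next
  case (Suc n)
  then have "\<not> constant (poly p)"
    by (simp add: constant_degree)
  then obtain z where z: "poly p z = 0"
    using fundamental_theorem_of_algebra by blast
  have z0: "z \<noteq> 0" and Rez: "Re (1 / z) > 0"
    using z Suc.prems by auto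
  obtain r where "p = [:- z, 1:] * r"
    using z by (auto simp: poly_eq_0_iff_dvd dvd_def)
  \<comment> \<open>With the linear factor normalised in this way, the cofactor again takes the
    value 1 at 0.\<close>
  moreover have "[:- z, 1:] = smult (- z) [:1, - 1 / z:]"
    using z0 by simp
  ultimately have p: "p = [:1, - 1 / z:] * smult (- z) r"
    by (simp only: mult_smult_left mult_smult_right)
  define r' where "r' = smult (- z) r"
  have p: "p = [:1, - 1 / z:] * r'"
    by (simp add: p r'_def)
  have "p \<noteq> 0" using Suc.hyps by auto
  then have "r' \<noteq> 0" using p by auto
  then have deg: "degree r' = n"
    using Suc.hyps z0 by (simp add: p degree_mult_eq del: mult_pCons_left)
  have "Re (poly (pderiv r') 0) \<le> 0"
    using Suc.hyps(1)[of r'] deg Suc.prems by (simp add: p del: mult_pCons_left)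
  moreover have "poly (pderiv p) 0 = poly (pderiv r') 0 - 1 / z"
    using Suc.prems(1) by (simp add: p pderiv_mult pderiv_pCons del: mult_pCons_left)
  ultimately show ?case
    using Rez by simp
qed

lemma eigenvalue_if_det_eq_0:
  fixes A :: "real^'n^'n"
  assumes "det (mat z - map_matrix complex_of_real A) = 0"
  shows "z \<in> eigenvalues A"
proof -
  let ?B = "mat z - map_matrix complex_of_real A :: complex^'n^'n"
  have "\<not> invertible ?B"
    using assms by (simp add: invertible_det_nz)
  then obtain v where "v \<noteq> 0" "?B *v v = 0"
    unfolding invertible_left_inverse matrix_left_invertible_ker by auto
  moreover have "(mat z :: complex^'n^'n) *v v = z *s v"
    by (simp add: vec_eq_iff matrix_vector_mult_def mat_def if_distrib if_distribR sum.delta cong: if_cong)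
  ultimately show ?thesis
    by (auto simp: eigenvalues_def matrix_vector_mult_diff_rdistrib)
qed

text \<open>With \<open>p(h) = det (1 - h A)\<close> one has \<open>p(0) = 1\<close> and \<open>p'(0) = - tr A\<close>, and the inverses of the roots of \<open>p\<close> are
  eigenvalues of \<open>A\<close>.\<close>

lemma trace_pos_if_pos_spectrum:
  fixes A :: "real^'n^'n"
  assumes "A \<in> pos_spectrum"
  shows "trace A > 0"
proof -
  let ?A = "map_matrix complex_of_real A"
  have pos: "Re z > 0" if "det (mat z - ?A) = 0" for z
    using assms eigenvalue_if_det_eq_0[OF that] by (auto simp: pos_spectrum_def)
  \<comment> \<open>The entry \<open>[:a, b:]\<close> stands for \<open>a + b * h\<close>;
    \<open>r\<close> is the characteristic polynomial and \<open>p\<close> its reversal.\<close>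
  define p where "p = det (\<chi> i j. [:mat 1 $ i $ j, - ?A $ i $ j:])"
  define r where "r = det (\<chi> i j. [:- ?A $ i $ j, mat 1 $ i $ j:])"
  have p: "poly p h = det (mat 1 - map_matrix ((*) h) ?A)" for h
    unfolding p_def det_poly_entries by (rule arg_cong[where f = det]) (simp add: vec_eq_iff mat_def map_matrix_def)
  have r: "poly r h = det (mat h - ?A)" for h
    unfolding r_def det_poly_entries by (rule arg_cong[where f = det]) (simp add: vec_eq_iff mat_def map_matrix_def)
  have r_p: "poly r z = z ^ CARD('n) * poly p (1 / z)" if "z \<noteq> 0" for z
  proof -
    have "mat z - ?A = (\<chi> i. z *s (mat 1 - map_matrix ((*) (1 / z)) ?A) $ i)"
      using that by (simp add: vec_eq_iff mat_def map_matrix_def field_simps)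
    then show ?thesis
      unfolding p r by (simp only: det_rows_mul vec_lambda_eta prod_constant)
  qed
  have zero: "map_matrix ((*) 0) ?A = 0"
    by (simp add: vec_eq_iff map_matrix_def)
  have p0: "poly p 0 = 1"
    by (simp add: p zero)
  have root: "Re (1 / z) > 0" if "poly p z = 0" for z
  proof -
    have "z \<noteq> 0" using that p0 by auto
    then have "poly r (1 / z) = 0"
      using r_p[of "1 / z"] that by simp
    then show ?thesis using pos r by auto
  qed
  \<comment> \<open>If \<open>p\<close> were constant, the characteristic polynomial would agree
    with \<open>z ^ CARD('n)\<close> off 0, hence be equal to it, and 0 would be an eigenvalue. The
    positive degree makes the inequality for the trace strict.\<close>
  have "degree p > 0"
  proof (rule ccontr)
    assume "\<not> degree p > 0"
    then obtain c where "p = [:c:]" by (metis degree_eq_zeroE gr0I)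
    with p0 have "poly p z = 1" for z by simp
    then have *: "poly (r - monom 1 CARD('n)) z = 0" if "z \<noteq> 0" for z
      using r_p[OF that] by (simp add: poly_monom)
    have "r - monom 1 CARD('n) = 0"
    proof (rule ccontr)
      assume "r - monom 1 CARD('n) \<noteq> 0"
      then have "finite {z. poly (r - monom 1 CARD('n)) z = 0}"
        by (rule poly_roots_finite)
      then have "finite (- {0 :: complex})"
        by (rule finite_subset[rotated]) (use * in auto)
      then show False
        by (simp add: infinite_UNIV_char_0)
    qed
    then have "poly r 0 = 0"
      by (simp add: poly_monom)
    then show False using pos[of 0] r by auto
  qed
  then have "Re (poly (pderiv p) 0) < 0"
    using Re_poly_pderiv_0[OF p0 root] by blast
  moreover have "poly (pderiv p) 0 = - trace ?A"
  proof -
    have "((\<lambda>h. det (mat 1 - map_matrix ((*) h) ?A)) has_field_derivative trace (- ?A)) (at 0)"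
    proof (rule has_field_derivative_det_at_mat_1)
      show "mat 1 - map_matrix ((*) 0) ?A = mat 1"
        by (simp add: zero)
      show "((\<lambda>h. (mat 1 - map_matrix ((*) h) ?A) $ i $ j) has_field_derivative (- ?A) $ i $ j) (at 0)" for i j
        by (auto intro!: derivative_eq_intros simp: map_matrix_def)
    qed
    then have "(poly p has_field_derivative trace (- ?A)) (at 0)"
      using p by presburger
    then show ?thesis
      using DERIV_unique[OF poly_DERIV] by (fastforce simp: trace_def sum_negf)
  qed
  moreover have "Re (trace ?A) = trace A"
    by (simp add: trace_def)
  ultimately show ?thesis by simp
qed

section \<open>Linear change of variables\<close>

text \<open>\<open>measure_shear_interval\<close> asks for a box with nonnegative
  \<open>n\<close>-th coordinates. Translating the box by \<open>- a $ n\<close> along that axis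
  achieves this, and since the shear is additive its image is only translated.\<close>

lemma measure_shear_cbox:
  fixes a b :: "real^'n"
  assumes "m \<noteq> n"
  shows "measure lebesgue ((\<lambda>x. \<chi> i. if i = m then x $ m + x $ n else x $ i) ` cbox a b) =
    measure lebesgue (cbox a b)"
proof (cases "cbox a b = {}")
  case False
  let ?h = "\<lambda>x::real^'n. \<chi> i. if i = m then x $ m + x $ n else x $ i"
  let ?v = "axis n (- a $ n)"
  have h: "?h (x + y) = ?h x + ?h y" for x y
    by (simp add: vec_eq_iff)
  have box: "cbox (?v + a) (?v + b) = (+) ?v ` cbox a b"
    by (rule cbox_translation)
  have "?h ` cbox (?v + a) (?v + b) = (+) (?h ?v) ` ?h ` cbox a b"
    by (simp only: box image_image h)
  then have "measure lebesgue (?h ` cbox a b) = measure lebesgue (?h ` cbox (?v + a) (?v + b))"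
    by (simp only: measure_translation)
  also have "\<dots> = measure lebesgue (cbox (?v + a) (?v + b))"
  proof (rule measure_shear_interval[OF assms])
    show "cbox (?v + a) (?v + b) \<noteq> {}"
      using False by (simp only: box image_is_empty not_False_eq_True)
    show "0 \<le> (?v + a) $ n"
      by (simp add: axis_def)
  qed
  also have "\<dots> = measure lebesgue (cbox a b)"
    by (simp only: box measure_translation)
  finally show ?thesis .
qed simp

text \<open>The library version of the next lemma needs a well-ordered index type.\<close>

lemma measure_lebesgue_linear_image:
  fixes f :: "real^'n \<Rightarrow> real^'n"
  assumes "linear f" "S \<in> lmeasurable"
  shows "f ` S \<in> lmeasurable \<and> measure lebesgue (f ` S) = \<bar>det (matrix f)\<bar> * measure lebesgue S"
proof -
  define P where "P f \<longleftrightarrow> (\<forall>S\<in>lmeasurable. f ` S \<in> lmeasurable \<and>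
    measure lebesgue (f ` S) = \<bar>det (matrix f)\<bar> * measure lebesgue S)" for f :: "real^'n \<Rightarrow> real^'n"
  have "P f"
  proof (rule induct_linear_elementary[where P = P, OF \<open>linear f\<close>])
    fix f g :: "real^'n \<Rightarrow> real^'n"
    assume 1: "linear f" "linear g" "P f" "P g"
    show "P (f \<circ> g)"
      unfolding P_def
    proof
      fix S :: "(real^'n) set"
      assume "S \<in> lmeasurable"
      with 1(3,4) have g: "g ` S \<in> lmeasurable" "measure lebesgue (g ` S) = \<bar>det (matrix g)\<bar> * measure lebesgue S"
        by (auto simp: P_def)
      with 1(3,4) have "f ` g ` S \<in> lmeasurable"
        "measure lebesgue (f ` g ` S) = \<bar>det (matrix f)\<bar> * measure lebesgue (g ` S)"
        by (auto simp: P_def)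
      with g show "(f \<circ> g) ` S \<in> lmeasurable \<and>
          measure lebesgue ((f \<circ> g) ` S) = \<bar>det (matrix (f \<circ> g))\<bar> * measure lebesgue S"
        by (simp only: image_comp[symmetric] matrix_compose[OF 1(2,1)] det_mul abs_mult mult.assoc simp_thms)
    qed
  next
    fix f :: "real^'n \<Rightarrow> real^'n" and i
    assume 2: "linear f" "\<And>x. f x $ i = 0"
    have "\<not> surj f"
    proof
      assume "surj f"
      then obtain x where "f x = 1" by (metis surjD)
      with 2(2)[of x] show False by simp
    qed
    with 2(1) have "\<not> inj f"
      using linear_injective_imp_surjective by blast
    then have "det (matrix f) = 0" "negligible (f ` S)" for S
      using det_nz_iff_inj[OF 2(1)] negligible_linear_singular_image[OF 2(1)] by blast+
    then show "P f"
      by (simp add: P_def negligible_iff_measure)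
  next
    show "P (\<lambda>x. \<chi> i. c i * x $ i)" for c
      by (auto simp: P_def measurable_stretch measure_stretch matrix_def axis_def det_diagonal)
  next
    fix m n :: 'n
    let ?h = "\<lambda>x::real^'n. \<chi> i. x $ Transposition.transpose m n i"
    have lin: "linear ?h"
      by (rule linearI) (simp_all add: vec_eq_iff)
    have hh: "?h (?h x) = x" for x
      by (simp add: vec_eq_iff)
    have box: "measure lebesgue (?h ` cbox a b) = 1 * measure lebesgue (cbox a b)" for a b :: "real^'n"
    proof (cases "cbox a b = {}")
      case False
      have sub: "?h ` cbox c d \<subseteq> cbox (?h c) (?h d)" for c d
        by (simp add: image_subset_iff mem_box_cart)
      have "y \<in> ?h ` cbox a b" if "y \<in> cbox (?h a) (?h b)" for y
      proof (rule image_eqI)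
        show "?h y \<in> cbox a b"
          using sub[of "?h a" "?h b"] that by (simp only: image_subset_iff hh)
      qed (simp only: hh)
      with sub[of a b] have eq: "?h ` cbox a b = cbox (?h a) (?h b)"
        by blast
      have "cbox (?h a) (?h b) \<noteq> {}"
        using False eq by blast
      moreover have "(\<Prod>i\<in>UNIV. b $ Transposition.transpose m n i - a $ Transposition.transpose m n i) =
          (\<Prod>i\<in>UNIV. b $ i - a $ i)"
        by (rule prod.reindex_bij_betw[where g = "\<lambda>i. b $ i - a $ i"]) simp
      ultimately show ?thesis
        using False by (simp add: eq content_cbox_cart)
    qed simp
    \<comment> \<open>An involution has determinant 1 or -1, which settles the absolute value
      without the sign of a permutation.\<close>
    have "matrix ?h ** matrix ?h = mat 1"
      using matrix_compose[OF lin lin] hh by (simp add: o_def matrix_id_mat_1[unfolded id_def])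
    then have "det (matrix ?h) * det (matrix ?h) = 1"
      by (metis det_I det_mul)
    then have d: "\<bar>det (matrix ?h)\<bar> = 1"
      by (auto simp: square_eq_1_iff)
    show "P ?h"
      unfolding P_def d
    proof
      fix S :: "(real^'n) set"
      assume "S \<in> lmeasurable"
      from measure_linear_sufficient[OF lin this box]
      show "?h ` S \<in> lmeasurable \<and> measure lebesgue (?h ` S) = 1 * measure lebesgue S"
        by (rule conjE) (intro conjI, assumption, rule sym, assumption)
    qed
  next
    fix m n :: 'n
    assume 5: "m \<noteq> n"
    let ?h = "\<lambda>x::real^'n. \<chi> i. if i = m then x $ m + x $ n else x $ i"
    have lin: "linear ?h"
      by (rule linearI) (simp_all add: vec_eq_iff algebra_simps)
    \<comment> \<open>The shear adds row \<open>n\<close> of the identity to row \<open>m\<close>,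
      and such row operations preserve the determinant.\<close>
    have "matrix ?h = (\<chi> k. if k = m then row m (mat 1) + 1 *s row n (mat 1) else row k (mat 1))"
      by (simp add: vec_eq_iff matrix_def axis_def mat_def row_def)
    then have d: "\<bar>det (matrix ?h)\<bar> = 1"
      using det_row_operation[OF 5, of "mat 1 :: real^'n^'n" 1] by simp
    have box: "measure lebesgue (?h ` cbox a b) = 1 * measure lebesgue (cbox a b)" for a b
      using measure_shear_cbox[OF 5] by (simp only: mult_1)
    show "P ?h"
      unfolding P_def d
    proof
      fix S :: "(real^'n) set"
      assume "S \<in> lmeasurable"
      from measure_linear_sufficient[OF lin this box]
      show "?h ` S \<in> lmeasurable \<and> measure lebesgue (?h ` S) = 1 * measure lebesgue S"
        by (rule conjE) (intro conjI, assumption, rule sym, assumption)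
    qed
  qed
  with assms show ?thesis by (simp add: P_def)
qed

text \<open>Lebesgue measure is determined by its values on boxes. The preimage of a box under the
  affine map is the image of a translated box under the inverse matrix \<open>B\<close>; its volume
  carries the factor \<open>\<bar>det B\<bar>\<close>, which the density cancels because
  \<open>det A * det B = 1\<close>.\<close>

lemma nn_integral_lborel_affine_matrix:
  fixes A :: "real^'n^'n" and f :: "real^'n \<Rightarrow> ennreal"
  assumes det: "det A \<noteq> 0" and f: "f \<in> borel_measurable borel"
  shows "(\<integral>\<^sup>+ x. f x \<partial>lborel) = ennreal \<bar>det A\<bar> * (\<integral>\<^sup>+ x. f (b + A *v x) \<partial>lborel)"
proof -
  obtain B where BA: "B ** A = mat 1" and AB: "A ** B = mat 1"
    using det by (auto simp: invertible_def simp flip: invertible_det_nz)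
  have inv: "A *v (B *v x) = x" "B *v (A *v x) = x" for x
    by (simp_all add: matrix_vector_mul_assoc AB BA)
  have meas: "(\<lambda>x. b + A *v x) \<in> borel_measurable borel"
    by (intro borel_measurable_continuous_onI continuous_intros matrix_vector_mult_linear_continuous_on)
  have "lborel = density (distr lborel borel (\<lambda>x. b + A *v x)) (\<lambda>_. ennreal \<bar>det A\<bar>)"
  proof (rule lborel_eqI)
    fix l u :: "real^'n"
    assume le: "\<And>i. i \<in> Basis \<Longrightarrow> l \<bullet> i \<le> u \<bullet> i"
    let ?S = "(+) (- b) ` box l u"
    have S: "?S \<in> lmeasurable" "measure lebesgue ?S = measure lebesgue (box l u)"
      by (rule measurable_translation[OF lmeasurable_box], rule measure_translation)
    have eq: "(\<lambda>x. b + A *v x) -` box l u = (*v) B ` ?S"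
    proof (intro set_eqI iffI)
      fix x assume "x \<in> (\<lambda>x. b + A *v x) -` box l u"
      then have "- b + (b + A *v x) \<in> ?S" by blast
      then have "A *v x \<in> ?S" by (simp only: minus_add_cancel)
      then have "B *v (A *v x) \<in> (*v) B ` ?S" by (rule imageI)
      then show "x \<in> (*v) B ` ?S" by (simp only: inv)
    next
      fix x assume "x \<in> (*v) B ` ?S"
      then show "x \<in> (\<lambda>x. b + A *v x) -` box l u"
        by (auto simp: inv)
    qed
    have BS: "(*v) B ` ?S \<in> lmeasurable"
      "measure lebesgue ((*v) B ` ?S) = \<bar>det B\<bar> * measure lebesgue ?S"
      using measure_lebesgue_linear_image[OF matrix_vector_mul_linear S(1), of B]
      by (simp_all only: matrix_of_matrix_vector_mul)
    have box: "(\<lambda>x. b + A *v x) -` box l u \<in> sets borel"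
      using measurable_sets[OF meas, of "box l u"] by simp
    then have "emeasure lborel ((\<lambda>x. b + A *v x) -` box l u) = emeasure lebesgue ((\<lambda>x. b + A *v x) -` box l u)"
      by simp
    also have "\<dots> = ennreal (\<bar>det B\<bar> * measure lebesgue (box l u))"
      unfolding eq emeasure_eq_measure2[OF BS(1)] BS(2) S(2) ..
    finally have em: "emeasure lborel ((\<lambda>x. b + A *v x) -` box l u) = ennreal (\<bar>det B\<bar> * measure lebesgue (box l u))" .
    have "det A * det B = 1"
      using AB by (metis det_I det_mul)
    then have "\<bar>det A\<bar> * \<bar>det B\<bar> = 1"
      by (simp flip: abs_mult)
    have "emeasure (density (distr lborel borel (\<lambda>x. b + A *v x)) (\<lambda>_. ennreal \<bar>det A\<bar>)) (box l u) =
        ennreal \<bar>det A\<bar> * emeasure lborel ((\<lambda>x. b + A *v x) -` box l u)"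
      using meas by (simp add: emeasure_density_const emeasure_distr)
    also have "\<dots> = ennreal (\<bar>det A\<bar> * \<bar>det B\<bar> * measure lebesgue (box l u))"
      unfolding em mult.assoc by (rule ennreal_mult[symmetric]) simp_all
    also have "\<dots> = ennreal (\<Prod>i\<in>Basis. (u - l) \<bullet> i)"
      using \<open>\<bar>det A\<bar> * \<bar>det B\<bar> = 1\<close> measure_lborel_box[OF le] by simp
    finally show "emeasure (density (distr lborel borel (\<lambda>x. b + A *v x)) (\<lambda>_. ennreal \<bar>det A\<bar>)) (box l u) =
        ennreal (\<Prod>i\<in>Basis. (u - l) \<bullet> i)" .
  qed simp
  then have "(\<integral>\<^sup>+ x. f x \<partial>lborel) = (\<integral>\<^sup>+ x. f x \<partial>density (distr lborel borel (\<lambda>x. b + A *v x)) (\<lambda>_. ennreal \<bar>det A\<bar>))"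
    by simp
  also have "\<dots> = ennreal \<bar>det A\<bar> * (\<integral>\<^sup>+ x. f (b + A *v x) \<partial>lborel)"
    using f meas by (simp add: nn_integral_density nn_integral_distr nn_integral_cmult)
  finally show ?thesis .
qed

section \<open>Weak convergence of finite-dimensional distributions\<close>

text \<open>The Stone--Weierstrass theorem of the library is stated for types of class
  \<^class>\<open>t2_space\<close>, which functions on an uncountable type are not yet known to form.\<close>

lemma open_vimage_apply: "open ((\<lambda>h :: 'a \<Rightarrow> 'b::topological_space. h i) -` W)" if "open W"
  using that by (intro open_vimage continuous_on_product_coordinates)

instance "fun" :: (type, t0_space) t0_space
proof
  fix f g :: "'a \<Rightarrow> 'b"
  assume "f \<noteq> g"
  then obtain i where "f i \<noteq> g i" by auto
  then obtain U where "open U" "\<not> (f i \<in> U \<longleftrightarrow> g i \<in> U)"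
    using separation_t0[of "f i" "g i"] by auto
  then show "\<exists>U. open U \<and> \<not> (f \<in> U \<longleftrightarrow> g \<in> U)"
    by (intro exI[of _ "(\<lambda>h. h i) -` U"]) (simp add: open_vimage_apply)
qed

instance "fun" :: (type, t1_space) t1_space
proof
  fix f g :: "'a \<Rightarrow> 'b"
  assume "f \<noteq> g"
  then obtain i where "f i \<noteq> g i" by auto
  then obtain U where "open U" "f i \<in> U" "g i \<notin> U"
    using t1_space by blast
  then show "\<exists>U. open U \<and> f \<in> U \<and> g \<notin> U"
    by (intro exI[of _ "(\<lambda>h. h i) -` U"]) (simp add: open_vimage_apply)
qed

instance "fun" :: (type, t2_space) t2_space
proof
  fix f g :: "'a \<Rightarrow> 'b"
  assume "f \<noteq> g"
  then obtain i where "f i \<noteq> g i" by auto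
  then obtain U V where "open U" "open V" "f i \<in> U" "g i \<in> V" "U \<inter> V = {}"
    by (meson hausdorff)
  then show "\<exists>U V. open U \<and> open V \<and> f \<in> U \<and> g \<in> V \<and> U \<inter> V = {}"
    by (intro exI[of _ "(\<lambda>h. h i) -` U"] exI[of _ "(\<lambda>h. h i) -` V"]) (auto simp: open_vimage_apply)
qed

section \<open>Trigonometric sums and their density\<close>

text \<open>Expectations of these functions are determined by joint characteristic functions. The
  phase \<open>b\<close> includes the sines, and by the product formula such cosines alone already
  span an algebra.\<close>

inductive trig_sum :: "'t set \<Rightarrow> (('t \<Rightarrow> 'v::real_inner) \<Rightarrow> real) \<Rightarrow> bool" for T where
  cos: "trig_sum T (\<lambda>x. a * cos (b + (\<Sum>t\<in>T. u t \<bullet> x t)))"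
| add: "trig_sum T f \<Longrightarrow> trig_sum T g \<Longrightarrow> trig_sum T (\<lambda>x. f x + g x)"

lemma trig_sum_mult:
  assumes "trig_sum T f" "trig_sum T g"
  shows "trig_sum T (\<lambda>x. f x * g x)"
  using assms(1)
proof induction
  case (cos a b u)
  from assms(2) show ?case
  proof induction
    case (cos a' b' u')
    have "a * cos (b + (\<Sum>t\<in>T. u t \<bullet> x t)) * (a' * cos (b' + (\<Sum>t\<in>T. u' t \<bullet> x t))) =
        (a * a' / 2) * cos ((b - b') + (\<Sum>t\<in>T. (u t - u' t) \<bullet> x t)) +
        (a * a' / 2) * cos ((b + b') + (\<Sum>t\<in>T. (u t + u' t) \<bullet> x t))" for x
    proof -
      have *: "a * cos p * (a' * cos q) = (a * a' / 2) * cos (p - q) + (a * a' / 2) * cos (p + q)" for p q :: real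
        by (simp add: cos_diff cos_add field_simps)
      have "(b - b') + (\<Sum>t\<in>T. (u t - u' t) \<bullet> x t) = (b + (\<Sum>t\<in>T. u t \<bullet> x t)) - (b' + (\<Sum>t\<in>T. u' t \<bullet> x t))"
        "(b + b') + (\<Sum>t\<in>T. (u t + u' t) \<bullet> x t) = (b + (\<Sum>t\<in>T. u t \<bullet> x t)) + (b' + (\<Sum>t\<in>T. u' t \<bullet> x t))"
        by (simp_all add: inner_diff_left inner_add_left sum_subtractf sum.distrib)
      then show ?thesis by (simp only: *)
    qed
    moreover have "trig_sum T (\<lambda>x. (a * a' / 2) * cos ((b - b') + (\<Sum>t\<in>T. (u t - u' t) \<bullet> x t)) +
        (a * a' / 2) * cos ((b + b') + (\<Sum>t\<in>T. (u t + u' t) \<bullet> x t)))"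
      by (intro trig_sum.add trig_sum.cos)
    ultimately show ?case by simp
  next
    case (add f g)
    then show ?case by (simp add: distrib_left trig_sum.add)
  qed
next
  case (add f h)
  then show ?case by (simp add: distrib_right trig_sum.add)
qed

lemma trig_sum_const: "trig_sum T (\<lambda>x. c)"
  using trig_sum.cos[of T c 0 "\<lambda>_. 0"] by simp

lemma trig_sum_coordinate:
  assumes "finite T" "t \<in> T"
  shows "trig_sum T (\<lambda>x. cos (k * (x t \<bullet> b)))" "trig_sum T (\<lambda>x. sin (k * (x t \<bullet> b)))"
proof -
  have *: "(\<Sum>s\<in>T. (if s = t then k *\<^sub>R b else 0) \<bullet> x s) = k * (x t \<bullet> b)" for x
  proof -
    have "(\<Sum>s\<in>T. (if s = t then k *\<^sub>R b else 0) \<bullet> x s) = (\<Sum>s\<in>T. if s = t then k * (x t \<bullet> b) else 0)"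
      by (intro sum.cong) (auto simp: inner_commute)
    then show ?thesis using assms by simp
  qed
  show "trig_sum T (\<lambda>x. cos (k * (x t \<bullet> b)))"
    using trig_sum.cos[of T 1 0 "\<lambda>s. if s = t then k *\<^sub>R b else 0"] by (simp add: *)
  show "trig_sum T (\<lambda>x. sin (k * (x t \<bullet> b)))"
    using trig_sum.cos[of T 1 "- pi / 2" "\<lambda>s. if s = t then k *\<^sub>R b else 0"]
    by (simp add: * cos_diff)
qed

text \<open>Composing \<open>g\<close> with the triangle wave \<open>y \<mapsto> (2 K / \<pi>) arcsin (sin (\<pi> y / (2 K)))\<close> in every coordinate
  gives a continuous function on a torus that agrees with \<open>g\<close> where all coordinates are at most \<open>K\<close>.\<close>

lemma trig_sum_approximation:
  fixes g :: "('t \<Rightarrow> 'v::euclidean_space) \<Rightarrow> real"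
  assumes T: "finite T"
    and g: "continuous_map (product_topology (\<lambda>_. euclidean) T) euclideanreal g"
    and B: "\<And>x. x \<in> T \<rightarrow>\<^sub>E UNIV \<Longrightarrow> \<bar>g x\<bar> \<le> B"
    and K: "K > 0" and e: "e > 0"
  shows "\<exists>p. trig_sum T p \<and> (\<forall>x. \<bar>p x\<bar> \<le> B + e) \<and>
    (\<forall>x. (\<forall>t\<in>T. \<forall>b\<in>Basis. \<bar>x t \<bullet> b\<bar> \<le> K) \<longrightarrow> \<bar>g (restrict x T) - p x\<bar> < e)"
proof -
  define k where "k = pi / (2 * K)"
  have k: "k > 0" using K by (simp add: k_def)
  define J where "J = T \<times> (Basis :: 'v set)"
  \<comment> \<open>The index type may be infinite; fixing the coordinates outside the finite set
    \<open>J\<close> at 1 gives a torus inside the full product, compact by Tychonoff's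
    theorem.\<close>
  define S where "S = (\<Pi>\<^sub>E p\<in>(UNIV :: ('t \<times> 'v) set). if p \<in> J then sphere 0 1 else {1 :: complex})"
  define \<iota> where "\<iota> x = (\<lambda>p. if p \<in> J then cis (k * (x (fst p) \<bullet> snd p)) else 1)" for x :: "'t \<Rightarrow> 'v"
  define q where "q z = (\<lambda>t\<in>T. \<Sum>b\<in>Basis. (arcsin (Im (z (t, b))) / k) *\<^sub>R b)" for z :: "'t \<times> 'v \<Rightarrow> complex"
  define R where "R = {f :: ('t \<times> 'v \<Rightarrow> complex) \<Rightarrow> real. continuous_on S f \<and> trig_sum T (\<lambda>x. f (\<iota> x))}"
  have \<iota>: "\<iota> x \<in> S" for x
    by (auto simp: S_def \<iota>_def PiE_iff)
  have coord: "continuous_on S (\<lambda>z. z p)" for p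
    by (rule continuous_on_subset[OF continuous_on_product_coordinates]) simp
  have S: "z p \<in> (if p \<in> J then sphere 0 1 else {1})" if "z \<in> S" for z p
    using that unfolding S_def by (rule PiE_mem) simp
  have SJ: "cmod (z p) = 1" if "z \<in> S" "p \<in> J" for z p
    using S[of z p] that by simp
  have "compact S"
  proof -
    have "compactin (product_topology (\<lambda>_. euclidean) UNIV) S"
      unfolding S_def by (subst compactin_PiE) auto
    then show ?thesis
      by (simp add: euclidean_product_topology)
  qed
  interpret function_ring_on R S
  proof
    show "compact S" by fact
    fix f h assume "f \<in> R" "h \<in> R"
    then show "(\<lambda>x. f x + h x) \<in> R" "(\<lambda>x. f x * h x) \<in> R"
      by (auto simp: R_def intro: continuous_intros trig_sum.add trig_sum_mult)
  next
    \<comment> \<open>Two points of \<open>S\<close> can differ only in a coordinate from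
      \<open>J\<close>, and the real and imaginary parts of that coordinate pull back along
      \<open>\<iota>\<close> to a cosine and a sine.\<close>
    fix z y assume "z \<in> S" "y \<in> S" "z \<noteq> y"
    then obtain p where p: "z p \<noteq> y p" unfolding fun_eq_iff by blast
    then have "p \<in> J"
      using S[OF \<open>z \<in> S\<close>, of p] S[OF \<open>y \<in> S\<close>, of p] by (auto split: if_splits)
    then have R: "(\<lambda>z. Re (z p)) \<in> R" "(\<lambda>z. Im (z p)) \<in> R"
      using trig_sum_coordinate[OF T, of "fst p" k "snd p"]
      by (auto simp: R_def J_def \<iota>_def mem_Times_iff intro!: continuous_intros coord)
    show "\<exists>f\<in>R. f z \<noteq> f y"
    proof (cases "Re (z p) = Re (y p)")
      case True
      with p have "Im (z p) \<noteq> Im (y p)" by (simp add: complex_eq_iff)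
      then show ?thesis by (rule bexI[OF _ R(2)])
    qed (rule bexI[OF _ R(1)])
  qed (auto simp: R_def trig_sum_const)
  have "continuous_on S (\<lambda>z. g (q z))"
  proof -
    have "continuous_map (top_of_set S) (product_topology (\<lambda>_. euclidean) T) q"
    proof (subst continuous_map_componentwise, intro conjI ballI)
      fix t assume "t \<in> T"
      then have "\<bar>Im (z (t, b))\<bar> \<le> 1" if "z \<in> S" "b \<in> Basis" for z b
        using SJ[OF that(1), of "(t, b)"] that(2) abs_Im_le_cmod[of "z (t, b)"] by (simp add: J_def)
      then have "continuous_on S (\<lambda>z. \<Sum>b\<in>Basis. (arcsin (Im (z (t, b))) / k) *\<^sub>R b)"
        using k by (intro continuous_intros coord) (auto simp: abs_le_iff minus_le_iff)
      then show "continuous_map (top_of_set S) euclidean (\<lambda>z. q z t)"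
        using \<open>t \<in> T\<close> by (simp add: q_def)
    qed (auto simp: q_def)
    from continuous_map_compose[OF this g] show ?thesis
      by (simp add: o_def)
  qed
  from Stone_Weierstrass_basic[OF this e] obtain r where r: "r \<in> R" "\<And>z. z \<in> S \<Longrightarrow> \<bar>g (q z) - r z\<bar> < e"
    by blast
  show ?thesis
  proof (intro exI[of _ "\<lambda>x. r (\<iota> x)"] conjI allI impI)
    show "trig_sum T (\<lambda>x. r (\<iota> x))"
      using r(1) by (simp add: R_def)
    fix x :: "'t \<Rightarrow> 'v"
    \<comment> \<open>The folded point lies in the domain of \<open>g\<close> for every
      \<open>x\<close>, so the approximating sum is bounded outside the cube as well. This is what
      makes tail events cheap later.\<close>
    have "\<bar>g (q (\<iota> x))\<bar> \<le> B"
      by (rule B) (simp add: q_def)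
    with r(2)[OF \<iota>, of x] show "\<bar>r (\<iota> x)\<bar> \<le> B + e" by linarith
  next
    fix x :: "'t \<Rightarrow> 'v"
    assume x: "\<forall>t\<in>T. \<forall>b\<in>Basis. \<bar>x t \<bullet> b\<bar> \<le> K"
    have "arcsin (Im (\<iota> x (t, b))) / k = x t \<bullet> b" if "t \<in> T" "b \<in> Basis" for t b
    proof -
      have "\<bar>k * (x t \<bullet> b)\<bar> \<le> k * K"
        using x that k by (simp add: abs_mult)
      also have "\<dots> = pi / 2"
        using K by (simp add: k_def)
      finally have "arcsin (sin (k * (x t \<bullet> b))) = k * (x t \<bullet> b)"
        by (intro arcsin_sin) (auto simp: abs_le_iff)
      then show ?thesis
        using that k by (simp add: \<iota>_def J_def)
    qed
    then have "q (\<iota> x) t = restrict x T t" for t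
      by (simp add: q_def euclidean_representation)
    then have "q (\<iota> x) = restrict x T" by blast
    with r(2)[OF \<iota>, of x] show "\<bar>g (restrict x T) - r (\<iota> x)\<bar> < e" by simp
  qed
qed

section \<open>Levy continuity in finite dimensions\<close>

lemma (in prob_space) borel_measurable_trig_sum:
  fixes Y :: "'t \<Rightarrow> 'a \<Rightarrow> 'v::euclidean_space"
  assumes "trig_sum T f" "\<And>t. t \<in> T \<Longrightarrow> Y t \<in> borel_measurable M"
  shows "(\<lambda>w. f (\<lambda>t. Y t w)) \<in> borel_measurable M \<and> integrable M (\<lambda>w. f (\<lambda>t. Y t w))"
  using assms(1)
proof induction
  case (cos a b u)
  have [measurable]: "(\<lambda>w. \<Sum>t\<in>T. u t \<bullet> Y t w) \<in> borel_measurable M"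
    using assms(2) by (intro borel_measurable_sum borel_measurable_inner) auto
  have "integrable M (\<lambda>w. a * cos (b + (\<Sum>t\<in>T. u t \<bullet> Y t w)))"
    by (rule integrable_const_bound[where B = "\<bar>a\<bar>"]) (auto simp: abs_mult mult_left_le)
  then show ?case by auto
qed auto

lemma tendsto_integral_trig_sum:
  fixes Y :: "'n \<Rightarrow> 't \<Rightarrow> 'w \<Rightarrow> 'v::euclidean_space" and Z :: "'t \<Rightarrow> 'w' \<Rightarrow> 'v"
  assumes "prob_space P" "prob_space P'"
    and Y: "\<And>n t. t \<in> T \<Longrightarrow> Y n t \<in> borel_measurable P" and Z: "\<And>t. t \<in> T \<Longrightarrow> Z t \<in> borel_measurable P'"
    and cf: "\<And>u. ((\<lambda>n. \<integral>w. iexp (\<Sum>t\<in>T. u t \<bullet> Y n t w) \<partial>P) \<longlongrightarrow> (\<integral>w. iexp (\<Sum>t\<in>T. u t \<bullet> Z t w) \<partial>P')) F"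
    and f: "trig_sum T f"
  shows "((\<lambda>n. \<integral>w. f (\<lambda>t. Y n t w) \<partial>P) \<longlongrightarrow> (\<integral>w. f (\<lambda>t. Z t w) \<partial>P')) F"
proof -
  interpret P: prob_space P by fact
  interpret P': prob_space P' by fact
  have eq: "(\<integral>w. a * cos (b + (\<Sum>t\<in>T. u t \<bullet> X t w)) \<partial>Q) = a * Re (cis b * (\<integral>w. iexp (\<Sum>t\<in>T. u t \<bullet> X t w) \<partial>Q))"
    if "prob_space Q" and X: "\<And>t. t \<in> T \<Longrightarrow> X t \<in> borel_measurable Q" for Q :: "'z measure" and X :: "'t \<Rightarrow> 'z \<Rightarrow> 'v" and a b u
  proof -
    interpret Q: prob_space Q by fact
    let ?s = "\<lambda>w. \<Sum>t\<in>T. u t \<bullet> X t w"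
    have [measurable]: "?s \<in> borel_measurable Q"
      using X by (intro borel_measurable_sum borel_measurable_inner) auto
    have int: "integrable Q (\<lambda>w. iexp (?s w))"
    proof (rule Q.integrable_const_bound[where B = 1])
      show "(\<lambda>w. iexp (?s w)) \<in> borel_measurable Q" by measurable
    qed (simp del: of_real_sum)
    have cos: "cos (b + s) = Re (cis b * iexp s)" for s
      by (simp add: cis_mult flip: cis_conv_exp)
    have "(\<integral>w. cos (b + ?s w) \<partial>Q) = (\<integral>w. Re (cis b * iexp (?s w)) \<partial>Q)"
      by (simp only: cos)
    also have "\<dots> = Re (cis b * (\<integral>w. iexp (?s w) \<partial>Q))"
      using int by simp
    finally show ?thesis by simp
  qed
  from f show ?thesis
  proof induction
    case (cos a b u)
    have "(\<integral>w. a * cos (b + (\<Sum>t\<in>T. u t \<bullet> Y n t w)) \<partial>P) =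
        a * Re (cis b * (\<integral>w. iexp (\<Sum>t\<in>T. u t \<bullet> Y n t w) \<partial>P))" for n
      by (rule eq[OF assms(1) Y])
    moreover have "(\<integral>w. a * cos (b + (\<Sum>t\<in>T. u t \<bullet> Z t w)) \<partial>P') =
        a * Re (cis b * (\<integral>w. iexp (\<Sum>t\<in>T. u t \<bullet> Z t w) \<partial>P'))"
      by (rule eq[OF assms(2) Z])
    ultimately show ?case
      by (simp only:) (intro tendsto_intros cf)
  next
    case (add f g)
    then show ?case
      using P.borel_measurable_trig_sum[OF add.hyps(1) Y] P.borel_measurable_trig_sum[OF add.hyps(2) Y]
        P'.borel_measurable_trig_sum[OF add.hyps(1) Z] P'.borel_measurable_trig_sum[OF add.hyps(2) Z]
      by (simp add: tendsto_add)
  qed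
qed

text \<open>The one-dimensional Levy theorem gives weak convergence, and testing against a
  continuous ramp passes a tail bound of the limit on to all large \<open>n\<close>.\<close>

lemma tight_if_char_tendsto:
  fixes V :: "nat \<Rightarrow> 'w \<Rightarrow> real" and Z :: "'z \<Rightarrow> real"
  assumes "prob_space P" "prob_space P'"
    and V[measurable]: "\<And>n. V n \<in> borel_measurable P" and Z[measurable]: "Z \<in> borel_measurable P'"
    and cf: "\<And>s. (\<lambda>n. \<integral>w. iexp (s * V n w) \<partial>P) \<longlonglongrightarrow> (\<integral>w. iexp (s * Z w) \<partial>P')"
    and e: "e > 0"
  obtains K where "K > 0" "measure P' {w\<in>space P'. \<bar>Z w\<bar> > K} < e"
    "\<forall>\<^sub>F n in sequentially. measure P {w\<in>space P. \<bar>V n w\<bar> > K} < e"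
proof -
  interpret P: prob_space P by fact
  interpret P': prob_space P' by fact
  interpret D: real_distribution "distr P borel (V n)" for n
    using V by (rule P.real_distribution_distr)
  interpret D': real_distribution "distr P' borel Z"
    using Z by (rule P'.real_distribution_distr)
  have wc: "weak_conv_m (\<lambda>n. distr P borel (V n)) (distr P' borel Z)"
  proof (rule levy_continuity)
    show "(\<lambda>n. char (distr P borel (V n)) s) \<longlonglongrightarrow> char (distr P' borel Z) s" for s
      using cf[of s] by (simp add: char_def integral_distr)
  qed unfold_locales
  have "(\<lambda>k. measure P' {w\<in>space P'. \<bar>Z w\<bar> > real k}) \<longlonglongrightarrow> measure P' (\<Inter>k. {w\<in>space P'. \<bar>Z w\<bar> > real k})"
    by (rule P'.finite_Lim_measure_decseq) (auto simp: decseq_def)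
  moreover have "(\<Inter>k. {w\<in>space P'. \<bar>Z w\<bar> > real k}) = {}"
    by auto (meson linorder_not_less order_less_imp_le real_arch_simple)
  ultimately have "(\<lambda>k. measure P' {w\<in>space P'. \<bar>Z w\<bar> > real k}) \<longlonglongrightarrow> 0"
    by simp
  then obtain k where k: "measure P' {w\<in>space P'. \<bar>Z w\<bar> > real k} < e"
    using order_tendstoD(2)[OF _ e] by (fastforce simp: eventually_sequentially)
  \<comment> \<open>The ramp lies between the indicators of the tails beyond \<open>k + 1\<close>
    and beyond \<open>k\<close>, which is why the final radius is \<open>k + 1\<close>.\<close>
  define h :: "real \<Rightarrow> real" where "h x = min 1 (max 0 (\<bar>x\<bar> - real k))" for x
  have h: "isCont h x" "\<bar>h x\<bar> \<le> 1" "h x \<le> indicator {x. \<bar>x\<bar> > real k} x" "indicator {x. \<bar>x\<bar> > real k + 1} x \<le> h x" for x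
    unfolding h_def by (auto intro!: continuous_intros simp: indicator_def)
  have [measurable]: "h \<in> borel_measurable borel"
    using h(1) by (intro borel_measurable_continuous_onI) (simp add: continuous_at_imp_continuous_on)
  have "(\<lambda>n. integral\<^sup>L (distr P borel (V n)) h) \<longlonglongrightarrow> integral\<^sup>L (distr P' borel Z) h"
    using D.real_distribution_axioms D'.real_distribution_axioms wc
    by (rule weak_conv_imp_integral_bdd_continuous_conv[where B = 1]) (use h in auto)
  then have lim: "(\<lambda>n. \<integral>w. h (V n w) \<partial>P) \<longlonglongrightarrow> (\<integral>w. h (Z w) \<partial>P')"
    by (simp add: integral_distr)
  have "(\<integral>w. h (Z w) \<partial>P') \<le> (\<integral>w. indicator {w\<in>space P'. \<bar>Z w\<bar> > real k} w \<partial>P')"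
  proof (rule integral_mono)
    show "integrable P' (\<lambda>w. h (Z w))"
      by (rule P'.integrable_const_bound[where B = 1]) (use h(2) in auto)
    show "h (Z w) \<le> indicator {w\<in>space P'. \<bar>Z w\<bar> > real k} w" if "w \<in> space P'" for w
      using h(3)[of "Z w"] that by (simp add: indicator_def)
    show "integrable P' (indicator {w\<in>space P'. \<bar>Z w\<bar> > real k} :: _ \<Rightarrow> real)"
      by (rule P'.integrable_const_bound[where B = 1]) auto
  qed
  also have "\<dots> < e"
    using k by (simp add: Int_def conj_commute)
  finally have "\<forall>\<^sub>F n in sequentially. (\<integral>w. h (V n w) \<partial>P) < e"
    using order_tendstoD(2)[OF lim] by blast
  moreover have "measure P {w\<in>space P. \<bar>V n w\<bar> > real k + 1} \<le> (\<integral>w. h (V n w) \<partial>P)" for n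
  proof -
    have "(\<integral>w. indicator {w\<in>space P. \<bar>V n w\<bar> > real k + 1} w \<partial>P) \<le> (\<integral>w. h (V n w) \<partial>P)"
    proof (rule integral_mono)
      show "integrable P (\<lambda>w. h (V n w))"
        by (rule P.integrable_const_bound[where B = 1]) (use h(2) in auto)
      show "indicator {w\<in>space P. \<bar>V n w\<bar> > real k + 1} w \<le> h (V n w)" if "w \<in> space P" for w
        using h(4)[of "V n w"] that by (simp add: indicator_def)
      show "integrable P (indicator {w\<in>space P. \<bar>V n w\<bar> > real k + 1} :: _ \<Rightarrow> real)"
        by (rule P.integrable_const_bound[where B = 1]) auto
    qed
    then show ?thesis by (simp add: Int_def conj_commute)
  qed
  ultimately have "\<forall>\<^sub>F n in sequentially. measure P {w\<in>space P. \<bar>V n w\<bar> > real k + 1} < e"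
    by (auto elim!: eventually_mono intro: le_less_trans)
  moreover have "measure P' {w\<in>space P'. \<bar>Z w\<bar> > real k + 1} \<le> measure P' {w\<in>space P'. \<bar>Z w\<bar> > real k}"
    by (rule P'.finite_measure_mono) auto
  ultimately show ?thesis
    using k by (intro that[of "real k + 1"]) auto
qed

lemma (in prob_space) integral_diff_le_if_close:
  fixes f g :: "'a \<Rightarrow> real"
  assumes [measurable]: "f \<in> borel_measurable M" "g \<in> borel_measurable M" "A \<in> sets M"
    and "\<And>w. w \<in> space M \<Longrightarrow> \<bar>f w\<bar> \<le> B" "\<And>w. w \<in> space M \<Longrightarrow> \<bar>g w\<bar> \<le> B"
    and close: "\<And>w. w \<in> space M - A \<Longrightarrow> \<bar>f w - g w\<bar> \<le> e" and "e \<ge> 0"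
  shows "\<bar>(\<integral>w. f w \<partial>M) - (\<integral>w. g w \<partial>M)\<bar> \<le> e + 2 * B * measure M A"
proof -
  have int: "integrable M f" "integrable M g"
    by (rule integrable_const_bound[where B = B]; use assms in auto)+
  have "B \<ge> 0" using assms(4) not_empty by (fastforce intro: order_trans[OF abs_ge_zero])
  have ind: "integrable M (indicator A :: 'a \<Rightarrow> real)"
    by (rule integrable_const_bound[where B = 1]) auto
  have "\<bar>(\<integral>w. f w \<partial>M) - (\<integral>w. g w \<partial>M)\<bar> = \<bar>\<integral>w. f w - g w \<partial>M\<bar>"
    using int by simp
  also have "\<dots> \<le> (\<integral>w. \<bar>f w - g w\<bar> \<partial>M)"
    by (rule integral_abs_bound)
  also have "\<dots> \<le> (\<integral>w. e + 2 * B * indicator A w \<partial>M)"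
  proof (rule integral_mono)
    show "\<bar>f w - g w\<bar> \<le> e + 2 * B * indicator A w" if "w \<in> space M" for w
      using assms(4)[OF that] assms(5)[OF that] close[of w] that \<open>e \<ge> 0\<close> by (auto simp: indicator_def)
  qed (use int ind in auto)
  also have "\<dots> = e + 2 * B * measure M A"
    using ind by (simp add: prob_space)
  finally show ?thesis .
qed

text \<open>The composition is a pointwise limit of trigonometric sums accurate to
  \<open>1 / (n + 1)\<close> on the cube of radius \<open>n + 1\<close>, since the values at each
  sample point eventually lie in these cubes. No product sigma-algebra enters.\<close>

lemma borel_measurable_continuous_map_PiE:
  fixes g :: "('t \<Rightarrow> 'v::euclidean_space) \<Rightarrow> real"
  assumes "prob_space P" "finite T"
    and g: "continuous_map (product_topology (\<lambda>_. euclidean) T) euclideanreal g"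
    and B: "\<And>x. x \<in> T \<rightarrow>\<^sub>E UNIV \<Longrightarrow> \<bar>g x\<bar> \<le> B"
    and Y: "\<And>t. t \<in> T \<Longrightarrow> Y t \<in> borel_measurable P"
  shows "(\<lambda>w. g (\<lambda>t\<in>T. Y t w)) \<in> borel_measurable P"
proof -
  interpret prob_space P by fact
  have "\<exists>p. trig_sum T p \<and> (\<forall>x. (\<forall>t\<in>T. \<forall>b\<in>Basis. \<bar>x t \<bullet> b\<bar> \<le> real n + 1) \<longrightarrow>
      \<bar>g (restrict x T) - p x\<bar> < inverse (real (Suc n)))" for n
    using trig_sum_approximation[OF assms(2) g B, of "real n + 1" "inverse (real (Suc n))"] by auto
  then obtain p where p: "\<And>n. trig_sum T (p n)"
    "\<And>n x. (\<forall>t\<in>T. \<forall>b\<in>Basis. \<bar>x t \<bullet> b\<bar> \<le> real n + 1) \<Longrightarrow> \<bar>g (restrict x T) - p n x\<bar> < inverse (real (Suc n))"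
    by metis
  show ?thesis
  proof (rule borel_measurable_LIMSEQ_real)
    show "(\<lambda>w. p n (\<lambda>t. Y t w)) \<in> borel_measurable P" for n
      using borel_measurable_trig_sum[of T "p n" Y] p(1) Y by blast
    fix w
    define K where "K = (\<Sum>t\<in>T. norm (Y t w))"
    have K: "\<bar>Y t w \<bullet> b\<bar> \<le> K" if "t \<in> T" "b \<in> Basis" for t b
      using Basis_le_norm[OF that(2), of "Y t w"] member_le_sum[of t T "\<lambda>t. norm (Y t w)"] that(1) assms(2)
      by (auto simp: K_def)
    have "\<forall>\<^sub>F n in sequentially. \<bar>p n (\<lambda>t. Y t w) - g (\<lambda>t\<in>T. Y t w)\<bar> \<le> inverse (real (Suc n))"
      using eventually_ge_at_top[of "nat \<lceil>K\<rceil>"]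
    proof eventually_elim
      case (elim n)
      then have "K \<le> real n + 1" by linarith
      then have "\<bar>g (restrict (\<lambda>t. Y t w) T) - p n (\<lambda>t. Y t w)\<bar> < inverse (real (Suc n))"
        using K by (intro p(2)) (blast intro: order_trans)
      then show ?case by (simp add: abs_minus_commute)
    qed
    then have "(\<lambda>n. p n (\<lambda>t. Y t w) - g (\<lambda>t\<in>T. Y t w)) \<longlonglongrightarrow> 0"
      by (intro Lim_null_comparison[OF _ LIMSEQ_inverse_real_of_nat]) simp
    then show "(\<lambda>n. p n (\<lambda>t. Y t w)) \<longlonglongrightarrow> g (\<lambda>t\<in>T. Y t w)"
      by (rule LIM_zero_cancel)
  qed
qed

text \<open>Every coordinate is a one-dimensional case with its own radius. The sum of the radii
  serves all of them, and a union bound adds up the tails.\<close>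

lemma tight_family_if_char_tendsto:
  fixes Y :: "nat \<Rightarrow> 't \<Rightarrow> 'w \<Rightarrow> 'v::euclidean_space" and Z :: "'t \<Rightarrow> 'w' \<Rightarrow> 'v"
  assumes prob: "prob_space P" "prob_space P'" and T: "finite T"
    and Y: "\<And>n t. t \<in> T \<Longrightarrow> Y n t \<in> borel_measurable P" and Z: "\<And>t. t \<in> T \<Longrightarrow> Z t \<in> borel_measurable P'"
    and cf: "\<And>u. (\<lambda>n. \<integral>w. iexp (\<Sum>t\<in>T. u t \<bullet> Y n t w) \<partial>P) \<longlonglongrightarrow> (\<integral>w. iexp (\<Sum>t\<in>T. u t \<bullet> Z t w) \<partial>P')"
    and e: "e > 0"
  obtains K where "K > 0"
    "measure P' {w\<in>space P'. \<exists>t\<in>T. \<exists>b\<in>Basis. \<bar>Z t w \<bullet> b\<bar> > K} \<le> e"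
    "\<forall>\<^sub>F n in sequentially. measure P {w\<in>space P. \<exists>t\<in>T. \<exists>b\<in>Basis. \<bar>Y n t w \<bullet> b\<bar> > K} \<le> e"
proof -
  interpret P: prob_space P by fact
  interpret P': prob_space P' by fact
  define J where "J = T \<times> (Basis :: 'v set)"
  have J: "finite J" using T by (simp add: J_def)
  \<comment> \<open>The share of \<open>e\<close> for each coordinate; the added 1 keeps it positive
    for empty \<open>T\<close>.\<close>
  define d where "d = e / (real (card J) + 1)"
  have d: "d > 0" "real (card J) * d \<le> e"
    using e by (auto simp: d_def field_simps)
  have "\<exists>K>0. measure P' {w\<in>space P'. \<bar>Z (fst p) w \<bullet> snd p\<bar> > K} < d \<and>
      (\<forall>\<^sub>F n in sequentially. measure P {w\<in>space P. \<bar>Y n (fst p) w \<bullet> snd p\<bar> > K} < d)" if p: "p \<in> J" for p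
  proof -
    obtain t b where [simp]: "p = (t, b)" and t: "t \<in> T" using p by (auto simp: J_def)
    have *: "(\<Sum>r\<in>T. (if r = t then s *\<^sub>R b else 0) \<bullet> x r) = s * (x t \<bullet> b)" for x :: "'t \<Rightarrow> 'v" and s
    proof -
      have "(\<Sum>r\<in>T. (if r = t then s *\<^sub>R b else 0) \<bullet> x r) = (\<Sum>r\<in>T. if r = t then s * (x t \<bullet> b) else 0)"
        by (intro sum.cong) (auto simp: inner_commute)
      then show ?thesis using T t by simp
    qed
    have cf': "(\<lambda>n. \<integral>w. iexp (s * (Y n t w \<bullet> b)) \<partial>P) \<longlonglongrightarrow> (\<integral>w. iexp (s * (Z t w \<bullet> b)) \<partial>P')" for s
      using cf[of "\<lambda>r. if r = t then s *\<^sub>R b else 0"] unfolding * .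
    have "(\<lambda>w. Y n t w \<bullet> b) \<in> borel_measurable P" for n
      by (intro borel_measurable_inner Y t borel_measurable_const)
    moreover have "(\<lambda>w. Z t w \<bullet> b) \<in> borel_measurable P'"
      by (intro borel_measurable_inner Z t borel_measurable_const)
    ultimately obtain K where "K > 0"
      "measure P' {w\<in>space P'. \<bar>Z t w \<bullet> b\<bar> > K} < d"
      "\<forall>\<^sub>F n in sequentially. measure P {w\<in>space P. \<bar>Y n t w \<bullet> b\<bar> > K} < d"
      by (rule tight_if_char_tendsto[OF prob _ _ cf' d(1)])
    then show ?thesis by auto
  qed
  then obtain k where "\<forall>p\<in>J. k p > 0 \<and> measure P' {w\<in>space P'. \<bar>Z (fst p) w \<bullet> snd p\<bar> > k p} < d \<and>
      (\<forall>\<^sub>F n in sequentially. measure P {w\<in>space P. \<bar>Y n (fst p) w \<bullet> snd p\<bar> > k p} < d)"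
    using bchoice[of J "\<lambda>p K. K > 0 \<and> measure P' {w\<in>space P'. \<bar>Z (fst p) w \<bullet> snd p\<bar> > K} < d \<and>
      (\<forall>\<^sub>F n in sequentially. measure P {w\<in>space P. \<bar>Y n (fst p) w \<bullet> snd p\<bar> > K} < d)"] by auto
  then have k: "\<And>p. p \<in> J \<Longrightarrow> k p > 0"
    "\<And>p. p \<in> J \<Longrightarrow> measure P' {w\<in>space P'. \<bar>Z (fst p) w \<bullet> snd p\<bar> > k p} < d"
    "\<And>p. p \<in> J \<Longrightarrow> \<forall>\<^sub>F n in sequentially. measure P {w\<in>space P. \<bar>Y n (fst p) w \<bullet> snd p\<bar> > k p} < d"
    by simp_all
  define K where "K = 1 + (\<Sum>p\<in>J. k p)"
  have K: "k p \<le> K" if "p \<in> J" for p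
    using member_le_sum[of p J k] that J k(1) by (force simp: K_def intro: less_imp_le)
  have bound: "measure Q {w\<in>space Q. \<exists>t\<in>T. \<exists>b\<in>Basis. \<bar>X t w \<bullet> b\<bar> > K} \<le> e"
    if "prob_space Q" and X: "\<And>t. t \<in> T \<Longrightarrow> X t \<in> borel_measurable Q"
      and le: "\<forall>p\<in>J. measure Q {w\<in>space Q. \<bar>X (fst p) w \<bullet> snd p\<bar> > k p} < d"
    for Q :: "'z measure" and X :: "'t \<Rightarrow> 'z \<Rightarrow> 'v"
  proof -
    interpret Q: prob_space Q by fact
    have m: "{w\<in>space Q. \<bar>X (fst p) w \<bullet> snd p\<bar> > k p} \<in> sets Q" if "p \<in> J" for p
    proof -
      have [measurable]: "X (fst p) \<in> borel_measurable Q"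
        using that X by (auto simp: J_def)
      show ?thesis by measurable
    qed
    have "measure Q {w\<in>space Q. \<exists>t\<in>T. \<exists>b\<in>Basis. \<bar>X t w \<bullet> b\<bar> > K} \<le>
        measure Q (\<Union>p\<in>J. {w\<in>space Q. \<bar>X (fst p) w \<bullet> snd p\<bar> > k p})"
      using m J K by (intro Q.finite_measure_mono sets.finite_UN) (force simp: J_def)+
    also have "\<dots> \<le> (\<Sum>p\<in>J. measure Q {w\<in>space Q. \<bar>X (fst p) w \<bullet> snd p\<bar> > k p})"
      using m J by (intro Q.finite_measure_subadditive_finite) auto
    also have "\<dots> \<le> (\<Sum>p\<in>J. d)"
      using le by (intro sum_mono) (auto intro: less_imp_le)
    finally show ?thesis using d by simp
  qed
  show ?thesis
  proof (rule that)
    have "sum k J \<ge> 0" by (intro sum_nonneg less_imp_le k(1))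
    then show "K > 0" by (simp add: K_def)
    show "measure P' {w\<in>space P'. \<exists>t\<in>T. \<exists>b\<in>Basis. \<bar>Z t w \<bullet> b\<bar> > K} \<le> e"
      using k(2) by (intro bound prob Z) auto
    have "\<forall>\<^sub>F n in sequentially. \<forall>p\<in>J. measure P {w\<in>space P. \<bar>Y n (fst p) w \<bullet> snd p\<bar> > k p} < d"
      using k(3) J by (intro eventually_ball_finite) auto
    then show "\<forall>\<^sub>F n in sequentially. measure P {w\<in>space P. \<exists>t\<in>T. \<exists>b\<in>Basis. \<bar>Y n t w \<bullet> b\<bar> > K} \<le> e"
      by eventually_elim (intro bound prob Y)
  qed
qed

text \<open>Outside an event of small probability all coordinates stay in a cube, where a
  trigonometric sum \<open>p\<close> approximates \<open>g\<close>. Replacing \<open>g\<close> by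
  \<open>p\<close> under both laws and comparing the means of \<open>p\<close> gives three
  errors.\<close>

theorem levy_continuity_finite_dimensional:
  fixes Y :: "nat \<Rightarrow> 't \<Rightarrow> 'w \<Rightarrow> 'v::euclidean_space" and Z :: "'t \<Rightarrow> 'w' \<Rightarrow> 'v"
  assumes prob: "prob_space P" "prob_space P'" and T: "finite T"
    and Y: "\<And>n t. t \<in> T \<Longrightarrow> Y n t \<in> borel_measurable P" and Z: "\<And>t. t \<in> T \<Longrightarrow> Z t \<in> borel_measurable P'"
    and cf: "\<And>u. (\<lambda>n. \<integral>w. iexp (\<Sum>t\<in>T. u t \<bullet> Y n t w) \<partial>P) \<longlonglongrightarrow> (\<integral>w. iexp (\<Sum>t\<in>T. u t \<bullet> Z t w) \<partial>P')"
    and g: "continuous_map (product_topology (\<lambda>_. euclidean) T) euclideanreal g"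
    and bounded: "bounded (g ` (T \<rightarrow>\<^sub>E UNIV))"
  shows "(\<lambda>n. \<integral>w. g (\<lambda>t\<in>T. Y n t w) \<partial>P) \<longlonglongrightarrow> (\<integral>w. g (\<lambda>t\<in>T. Z t w) \<partial>P')"
proof (rule LIMSEQ_I)
  interpret P: prob_space P by fact
  interpret P': prob_space P' by fact
  fix r :: real assume r: "r > 0"
  obtain B where B: "B > 0" "\<And>x. x \<in> T \<rightarrow>\<^sub>E UNIV \<Longrightarrow> \<bar>g x\<bar> \<le> B"
    using bounded unfolding bounded_pos by auto
  \<comment> \<open>Each replacement costs \<open>e + 2 * (B + e) * e\<close>: closeness on the
    cube, plus the bound \<open>B + e\<close> of both functions on the tail event. By
    \<open>e \<le> 1\<close> this is at most \<open>e * (3 + 2 * B)\<close>, hence at most a third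
    of \<open>r\<close>.\<close>
  define e where "e = min 1 (r / (3 * (3 + 2 * B)))"
  have e: "e > 0" "e \<le> 1" "3 * (e * (3 + 2 * B)) \<le> r"
  proof -
    have c: "3 * (3 + 2 * B) > 0" using B(1) by simp
    then show "e > 0" "e \<le> 1" using r by (simp_all add: e_def)
    have "e \<le> r / (3 * (3 + 2 * B))" by (simp add: e_def)
    then show "3 * (e * (3 + 2 * B)) \<le> r"
      using c by (simp add: pos_le_divide_eq mult.commute mult.left_commute)
  qed
  have "e * (1 + 2 * (B + e)) \<le> e * (3 + 2 * B)"
    using e by (intro mult_left_mono) auto
  then have e3: "3 * (e + 2 * (B + e) * e) \<le> r"
    using e(3) by (simp add: algebra_simps)
  obtain K where K: "K > 0" "measure P' {w\<in>space P'. \<exists>t\<in>T. \<exists>b\<in>Basis. \<bar>Z t w \<bullet> b\<bar> > K} \<le> e"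
    "\<forall>\<^sub>F n in sequentially. measure P {w\<in>space P. \<exists>t\<in>T. \<exists>b\<in>Basis. \<bar>Y n t w \<bullet> b\<bar> > K} \<le> e"
    by (rule tight_family_if_char_tendsto[OF prob T Y Z cf e(1)])
  obtain p where p: "trig_sum T p" "\<forall>x. \<bar>p x\<bar> \<le> B + e"
    "\<forall>x. (\<forall>t\<in>T. \<forall>b\<in>Basis. \<bar>x t \<bullet> b\<bar> \<le> K) \<longrightarrow> \<bar>g (restrict x T) - p x\<bar> < e"
    using trig_sum_approximation[OF T g B(2) K(1) e(1)] by auto
  have close: "\<bar>(\<integral>w. g (\<lambda>t\<in>T. X t w) \<partial>Q) - (\<integral>w. p (\<lambda>t. X t w) \<partial>Q)\<bar> \<le> e + 2 * (B + e) * e"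
    if Q: "prob_space Q" and X: "\<And>t. t \<in> T \<Longrightarrow> X t \<in> borel_measurable Q"
      and le: "measure Q {w\<in>space Q. \<exists>t\<in>T. \<exists>b\<in>Basis. \<bar>X t w \<bullet> b\<bar> > K} \<le> e"
    for Q :: "'z measure" and X :: "'t \<Rightarrow> 'z \<Rightarrow> 'v"
  proof -
    interpret Q: prob_space Q by fact
    let ?A = "{w\<in>space Q. \<exists>t\<in>T. \<exists>b\<in>Basis. \<bar>X t w \<bullet> b\<bar> > K}"
    have "{w\<in>space Q. \<bar>X t w \<bullet> b\<bar> > K} \<in> sets Q" if "t \<in> T" for t b
    proof -
      note X[OF that, measurable]
      show ?thesis by measurable
    qed
    then have A: "?A \<in> sets Q"
      using T by (intro sets.sets_Collect_finite_Ex) auto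
    have "\<bar>(\<integral>w. g (\<lambda>t\<in>T. X t w) \<partial>Q) - (\<integral>w. p (\<lambda>t. X t w) \<partial>Q)\<bar> \<le> e + 2 * (B + e) * measure Q ?A"
    proof (rule Q.integral_diff_le_if_close[OF _ _ A])
      show "(\<lambda>w. g (\<lambda>t\<in>T. X t w)) \<in> borel_measurable Q"
        by (rule borel_measurable_continuous_map_PiE[OF Q T g B(2) X])
      show "(\<lambda>w. p (\<lambda>t. X t w)) \<in> borel_measurable Q"
        using Q.borel_measurable_trig_sum[of T p X] p(1) X by blast
      show "\<bar>g (\<lambda>t\<in>T. X t w)\<bar> \<le> B + e" for w
        using B(2)[of "\<lambda>t\<in>T. X t w"] e(1) by simp
      show "\<bar>g (\<lambda>t\<in>T. X t w) - p (\<lambda>t. X t w)\<bar> \<le> e" if "w \<in> space Q - ?A" for w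
        using p(3)[rule_format, of "\<lambda>t. X t w"] that by (force simp: not_less)
    qed (use p(2) e(1) in auto)
    also have "\<dots> \<le> e + 2 * (B + e) * e"
      using le B(1) e(1) by (intro add_left_mono mult_left_mono) auto
    finally show ?thesis .
  qed
  have "(\<lambda>n. \<integral>w. p (\<lambda>t. Y n t w) \<partial>P) \<longlonglongrightarrow> (\<integral>w. p (\<lambda>t. Z t w) \<partial>P')"
    by (rule tendsto_integral_trig_sum[OF prob Y Z cf p(1)])
  then have "\<forall>\<^sub>F n in sequentially. \<bar>(\<integral>w. p (\<lambda>t. Y n t w) \<partial>P) - (\<integral>w. p (\<lambda>t. Z t w) \<partial>P')\<bar> < e"
    using tendstoD[OF _ e(1)] by (fastforce simp: dist_real_def)
  with K(3) have "\<forall>\<^sub>F n in sequentially. norm ((\<integral>w. g (\<lambda>t\<in>T. Y n t w) \<partial>P) - (\<integral>w. g (\<lambda>t\<in>T. Z t w) \<partial>P')) < r"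
  proof eventually_elim
    case (elim n)
    have "2 * (B + e) * e > 0" using B(1) e(1) by simp
    then show ?case
      using elim(2) close[OF prob(1) Y elim(1)] close[OF prob(2) Z K(2)] e3 by (auto simp: abs_le_iff abs_less_iff)
  qed
  then show "\<exists>N. \<forall>n\<ge>N. norm ((\<integral>w. g (\<lambda>t\<in>T. Y n t w) \<partial>P) - (\<integral>w. g (\<lambda>t\<in>T. Z t w) \<partial>P')) < r"
    by (simp add: eventually_sequentially)
qed

section \<open>Characteristic exponents\<close>

locale tempered_exponent =
  fixes \<sigma> :: "(real^'d) measure" and \<alpha> :: real
  assumes sets_\<sigma>: "sets \<sigma> = sets (restrict_space borel (sphere 0 1))"
    and finite_\<sigma>: "finite_measure \<sigma>"
    and \<alpha>: "0 < \<alpha>" "\<alpha> < 2"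
begin

definition radial_density :: "real \<Rightarrow> real \<Rightarrow> ennreal" where
  "radial_density l r = indicator {0<..} r * ennreal (r powr (- \<alpha> - 1) * exp (- l * r))"

text \<open>The negative of the log-characteristic function as an \<open>ennreal\<close> integral,
  so that Tonelli, Fatou and monotonicity apply before finiteness is known.\<close>

definition exponent :: "real \<Rightarrow> real^'d \<Rightarrow> ennreal" where
  "exponent l v = (\<integral>\<^sup>+ x. ennreal (1 - cos (v \<bullet> x)) \<partial>tempered_levy \<sigma> \<alpha> l)"

lemma space_\<sigma>: "space \<sigma> = sphere 0 1"
  using sets_eq_imp_space_eq[OF sets_\<sigma>] by (simp add: space_restrict_space)

lemma sets_tempered_levy [simp]: "sets (tempered_levy \<sigma> \<alpha> l) = sets borel"
  using sets.sigma_sets_eq[of borel] by (simp add: tempered_levy_def)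

lemma measurable_tempered_levy [simp]: "measurable (tempered_levy \<sigma> \<alpha> l) N = measurable borel N"
  by (rule measurable_cong_sets) simp_all

lemma measurable_radial_density [measurable]: "radial_density l \<in> borel_measurable borel"
  unfolding radial_density_def by measurable

lemma measurable_ident_\<sigma>: "(\<lambda>x. x) \<in> \<sigma> \<rightarrow>\<^sub>M borel"
  by (subst measurable_cong_sets[OF sets_\<sigma> refl]) (rule measurable_restrict_space1, simp)

lemma measurable_polar: "(\<lambda>p. snd p *\<^sub>R fst p) \<in> borel_measurable (\<sigma> \<Otimes>\<^sub>M lborel)"
  using measurable_compose[OF measurable_fst measurable_ident_\<sigma>, of lborel]
    measurable_compose[OF measurable_snd, of id lborel borel \<sigma>]
  by (intro borel_measurable_scaleR) (simp_all add: id_def)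

text \<open>Polar coordinates carry a weighted product measure to the Levy measure; once this is
  checked on sets, every integral against the Levy measure becomes a double integral.\<close>

lemma tempered_levy_eq_distr:
  "tempered_levy \<sigma> \<alpha> l =
    distr (density (\<sigma> \<Otimes>\<^sub>M lborel) (\<lambda>p. radial_density l (snd p))) borel (\<lambda>p. snd p *\<^sub>R fst p)"
proof (rule measure_eqI)
  fix A assume "A \<in> sets (tempered_levy \<sigma> \<alpha> l)"
  then have A [measurable]: "A \<in> sets borel" by simp
  note measurable_polar [measurable]
  have "emeasure (distr (density (\<sigma> \<Otimes>\<^sub>M lborel) (\<lambda>p. radial_density l (snd p))) borel (\<lambda>p. snd p *\<^sub>R fst p)) A =
      (\<integral>\<^sup>+ x. indicator A x \<partial>distr (density (\<sigma> \<Otimes>\<^sub>M lborel) (\<lambda>p. radial_density l (snd p))) borel (\<lambda>p. snd p *\<^sub>R fst p))"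
    by simp
  also have "\<dots> = (\<integral>\<^sup>+ p. radial_density l (snd p) * indicator A (snd p *\<^sub>R fst p) \<partial>(\<sigma> \<Otimes>\<^sub>M lborel))"
    by (subst nn_integral_distr) (simp_all add: nn_integral_density)
  also have "\<dots> = (\<integral>\<^sup>+ \<theta>. \<integral>\<^sup>+ r. radial_density l r * indicator A (r *\<^sub>R \<theta>) \<partial>lborel \<partial>\<sigma>)"
    by (subst lborel.nn_integral_fst[symmetric]) simp_all
  also have "\<dots> = emeasure (tempered_levy \<sigma> \<alpha> l) A"
    unfolding emeasure_tempered_levy[OF sets_\<sigma> A] radial_density_def by (simp add: ac_simps)
  finally show "emeasure (tempered_levy \<sigma> \<alpha> l) A =
    emeasure (distr (density (\<sigma> \<Otimes>\<^sub>M lborel) (\<lambda>p. radial_density l (snd p))) borel (\<lambda>p. snd p *\<^sub>R fst p)) A" ..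
qed simp

lemma nn_integral_tempered_levy:
  assumes [measurable]: "f \<in> borel_measurable borel"
  shows "(\<integral>\<^sup>+ x. f x \<partial>tempered_levy \<sigma> \<alpha> l) =
    (\<integral>\<^sup>+ p. radial_density l (snd p) * f (snd p *\<^sub>R fst p) \<partial>(\<sigma> \<Otimes>\<^sub>M lborel))"
proof -
  note measurable_polar [measurable]
  show ?thesis
    unfolding tempered_levy_eq_distr by (subst nn_integral_distr) (simp_all add: nn_integral_density)
qed

lemma exponent_eq:
  "exponent l v = (\<integral>\<^sup>+ p. radial_density l (snd p) * ennreal (1 - cos (v \<bullet> (snd p *\<^sub>R fst p))) \<partial>(\<sigma> \<Otimes>\<^sub>M lborel))"
  unfolding exponent_def by (rule nn_integral_tempered_levy) measurable

lemma radial_density_le: "0 \<le> l \<Longrightarrow> radial_density l r \<le> radial_density 0 r"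
  unfolding radial_density_def by (auto simp: indicator_def intro!: ennreal_leI mult_left_le)

lemma exponent_le: "0 \<le> l \<Longrightarrow> exponent l v \<le> exponent 0 v"
  unfolding exponent_eq by (intro nn_integral_mono mult_right_mono radial_density_le) auto

text \<open>Both bounds on \<open>\<alpha>\<close> enter here: near 0 the integrand is
  \<open>r powr (1 - \<alpha>)\<close>, integrable for \<open>\<alpha> < 2\<close>, and beyond 1 it
  is at most \<open>2 * r powr (- \<alpha> - 1)\<close>, integrable for \<open>0 < \<alpha>\<close>.
  The cut-off 2 is the maximum of \<open>1 - cos\<close>.\<close>

lemma nn_integral_radial_finite: "(\<integral>\<^sup>+ r. radial_density 0 r * ennreal (min 2 (r\<^sup>2)) \<partial>lborel) < \<infinity>"
proof -
  have 1: "(\<integral>\<^sup>+ r. indicator {0..1} r * ennreal (r powr (1 - \<alpha>)) \<partial>lborel) < \<infinity>"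
    using nn_integral_has_integral_lebesgue[OF _ has_integral_powr_from_0[of "1 - \<alpha>" 1]] \<alpha>
    by (simp add: ennreal_mult ennreal_indicator)
  have 2: "(\<integral>\<^sup>+ r. indicator {1..} r * ennreal (r powr (- \<alpha> - 1)) \<partial>lborel) < \<infinity>"
    using nn_integral_has_integral_lebesgue[OF _ has_integral_powr_to_inf[of "- \<alpha> - 1" 1]] \<alpha>
    by (simp add: ennreal_mult ennreal_indicator)
  have "(\<integral>\<^sup>+ r. radial_density 0 r * ennreal (min 2 (r\<^sup>2)) \<partial>lborel) \<le>
      (\<integral>\<^sup>+ r. indicator {0..1} r * ennreal (r powr (1 - \<alpha>)) + 2 * (indicator {1..} r * ennreal (r powr (- \<alpha> - 1))) \<partial>lborel)"
  proof (rule nn_integral_mono)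
    fix r :: real
    consider "r \<le> 0" | "0 < r" "r < 1" | "1 \<le> r" by linarith
    then show "radial_density 0 r * ennreal (min 2 (r\<^sup>2)) \<le>
      indicator {0..1} r * ennreal (r powr (1 - \<alpha>)) + 2 * (indicator {1..} r * ennreal (r powr (- \<alpha> - 1)))"
    proof cases
      case 2
      have "r powr (- \<alpha> - 1) * min 2 (r\<^sup>2) \<le> r powr (- \<alpha> - 1) * r powr 2"
        using 2 by (intro mult_left_mono) (auto simp: powr_numeral)
      also have "\<dots> = r powr (1 - \<alpha>)"
        by (simp flip: powr_add)
      finally show ?thesis
        using 2 by (simp add: radial_density_def ennreal_leI flip: ennreal_mult)
    next
      case 3
      have "ennreal (r powr (- \<alpha> - 1)) * ennreal (min 2 (r\<^sup>2)) \<le> ennreal (r powr (- \<alpha> - 1)) * 2"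
        by (intro mult_left_mono) (auto simp flip: ennreal_numeral intro: ennreal_leI)
      then show ?thesis
        using 3 by (simp add: radial_density_def mult.commute add_increasing)
    qed (simp add: radial_density_def)
  qed
  also have "\<dots> = (\<integral>\<^sup>+ r. indicator {0..1} r * ennreal (r powr (1 - \<alpha>)) \<partial>lborel) +
      2 * (\<integral>\<^sup>+ r. indicator {1..} r * ennreal (r powr (- \<alpha> - 1)) \<partial>lborel)"
    by (subst nn_integral_add) (simp_all add: nn_integral_cmult)
  also have "\<dots> < \<infinity>"
    using 1 2 by (simp add: ennreal_mult_less_top)
  finally show ?thesis .
qed

lemma tempered_levy_min_finite:
  "(\<integral>\<^sup>+ p. radial_density 0 (snd p) * ennreal (min 2 ((norm (snd p *\<^sub>R fst p))\<^sup>2)) \<partial>(\<sigma> \<Otimes>\<^sub>M lborel)) < \<infinity>"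
proof -
  note measurable_polar [measurable]
  have meas: "(\<lambda>p. radial_density 0 (snd p) * ennreal (min 2 ((norm (snd p *\<^sub>R fst p))\<^sup>2))) \<in> borel_measurable (\<sigma> \<Otimes>\<^sub>M lborel)"
    by measurable
  have "(\<integral>\<^sup>+ p. radial_density 0 (snd p) * ennreal (min 2 ((norm (snd p *\<^sub>R fst p))\<^sup>2)) \<partial>(\<sigma> \<Otimes>\<^sub>M lborel)) =
      (\<integral>\<^sup>+ \<theta>. \<integral>\<^sup>+ r. radial_density 0 r * ennreal (min 2 ((norm (r *\<^sub>R \<theta>))\<^sup>2)) \<partial>lborel \<partial>\<sigma>)"
    by (rule trans[OF lborel.nn_integral_fst[OF meas, symmetric]]) simp
  also have "\<dots> = (\<integral>\<^sup>+ \<theta>. (\<integral>\<^sup>+ r. radial_density 0 r * ennreal (min 2 (r\<^sup>2)) \<partial>lborel) \<partial>\<sigma>)"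
    by (intro nn_integral_cong) (simp add: space_\<sigma>)
  also have "\<dots> < \<infinity>"
    using nn_integral_radial_finite finite_measure.emeasure_finite[OF finite_\<sigma>, of "space \<sigma>"]
    by (simp add: ennreal_mult_less_top less_top)
  finally show ?thesis .
qed

text \<open>One branch of the minimum is trivial, the other uses the half-angle formula and
  Cauchy-Schwarz. With the frequency \<open>v\<close> in a separate factor the bound is uniform for
  bounded \<open>v\<close>, as dominated convergence demands; the summand 1 keeps the trivial branch
  valid for small \<open>v\<close>.\<close>

lemma one_minus_cos_le: "1 - cos (v \<bullet> x) \<le> (1 + (norm v)\<^sup>2) * min 2 ((norm x)\<^sup>2)" for v x :: "real^'d"
proof -
  have "1 - cos (v \<bullet> x) \<le> (1 + (norm v)\<^sup>2) * 2"
    using cos_ge_minus_one[of "v \<bullet> x"] by (smt (verit) zero_le_power2)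
  moreover have "1 - cos (v \<bullet> x) \<le> (1 + (norm v)\<^sup>2) * (norm x)\<^sup>2"
  proof -
    have "\<bar>sin (v \<bullet> x / 2)\<bar> \<le> \<bar>v \<bullet> x / 2\<bar>"
      by (rule abs_sin_x_le_abs_x)
    then have "(sin (v \<bullet> x / 2))\<^sup>2 \<le> (v \<bullet> x)\<^sup>2 / 4"
      unfolding abs_le_square_iff power_divide by simp
    moreover have "cos (v \<bullet> x) = 1 - 2 * (sin (v \<bullet> x / 2))\<^sup>2"
      using cos_double_sin[of "v \<bullet> x / 2"] by simp
    moreover have "(v \<bullet> x)\<^sup>2 \<le> (norm v)\<^sup>2 * (norm x)\<^sup>2"
      using Cauchy_Schwarz_ineq[of v x] by (simp add: power2_norm_eq_inner)
    ultimately have "1 - cos (v \<bullet> x) \<le> (norm v)\<^sup>2 * (norm x)\<^sup>2"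
      using zero_le_power2[of "sin (v \<bullet> x / 2)"] by linarith
    then show ?thesis
      by (simp add: distrib_right add_increasing)
  qed
  ultimately show ?thesis by (simp add: min_def)
qed

lemma exponent_finite:
  assumes "0 \<le> l"
  shows "exponent l v < \<infinity>"
proof -
  let ?c = "1 + (norm v)\<^sup>2"
  note measurable_polar [measurable]
  have "exponent 0 v \<le> (\<integral>\<^sup>+ p. ennreal ?c * (radial_density 0 (snd p) * ennreal (min 2 ((norm (snd p *\<^sub>R fst p))\<^sup>2))) \<partial>(\<sigma> \<Otimes>\<^sub>M lborel))"
    unfolding exponent_eq
  proof (rule nn_integral_mono)
    fix p :: "(real^'d) \<times> real"
    have "ennreal (1 - cos (v \<bullet> (snd p *\<^sub>R fst p))) \<le> ennreal ?c * ennreal (min 2 ((norm (snd p *\<^sub>R fst p))\<^sup>2))"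
      unfolding ennreal_mult[symmetric, OF add_nonneg_nonneg[OF zero_le_one zero_le_power2] min.boundedI[OF zero_le_numeral zero_le_power2]]
      by (rule ennreal_leI[OF one_minus_cos_le])
    then have "radial_density 0 (snd p) * ennreal (1 - cos (v \<bullet> (snd p *\<^sub>R fst p))) \<le>
        radial_density 0 (snd p) * (ennreal ?c * ennreal (min 2 ((norm (snd p *\<^sub>R fst p))\<^sup>2)))"
      by (rule mult_left_mono) simp
    then show "radial_density 0 (snd p) * ennreal (1 - cos (v \<bullet> (snd p *\<^sub>R fst p))) \<le>
        ennreal ?c * (radial_density 0 (snd p) * ennreal (min 2 ((norm (snd p *\<^sub>R fst p))\<^sup>2)))"
      by (simp only: mult.left_commute)
  qed
  also have "\<dots> = ennreal ?c * (\<integral>\<^sup>+ p. radial_density 0 (snd p) * ennreal (min 2 ((norm (snd p *\<^sub>R fst p))\<^sup>2)) \<partial>(\<sigma> \<Otimes>\<^sub>M lborel))"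
    by (rule nn_integral_cmult) measurable
  also have "\<dots> < \<infinity>"
    using tempered_levy_min_finite by (simp add: ennreal_mult_less_top)
  finally show ?thesis
    using exponent_le[OF assms, of v] by (rule le_less_trans[rotated])
qed

lemma log_char_eq:
  assumes "0 \<le> l"
  shows "ennreal (- log_char \<sigma> \<alpha> l v) = exponent l v" "log_char \<sigma> \<alpha> l v \<le> 0"
proof -
  have "- log_char \<sigma> \<alpha> l v = (\<integral>x. (1 - cos (v \<bullet> x)) \<partial>tempered_levy \<sigma> \<alpha> l)"
    unfolding log_char_def by (simp flip: integral_minus)
  also have "\<dots> = enn2real (exponent l v)"
    unfolding exponent_def by (rule integral_eq_nn_integral) auto
  finally have *: "- log_char \<sigma> \<alpha> l v = enn2real (exponent l v)" .
  then show "ennreal (- log_char \<sigma> \<alpha> l v) = exponent l v"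
    using exponent_finite[OF assms, of v] by (simp add: ennreal_enn2real)
  show "log_char \<sigma> \<alpha> l v \<le> 0"
    using * enn2real_nonneg[of "exponent l v"] by linarith
qed

lemma exponent_zero [simp]: "exponent l 0 = 0"
  by (simp add: exponent_def)

text \<open>Since \<open>1 - cos x = 2 * (sin (x / 2))\<^sup>2\<close> and the modulus of the sine
  is subadditive, this is Young's inequality for the square of \<open>s + t\<close>; the defect is
  \<open>(\<eta> * s - t)\<^sup>2 / \<eta>\<close>.\<close>

lemma one_minus_cos_add_le:
  fixes a b :: real
  assumes "\<eta> > 0"
  shows "1 - cos (a + b) \<le> (1 + \<eta>) * (1 - cos a) + (1 + 1 / \<eta>) * (1 - cos b)"
proof -
  have half: "1 - cos x = 2 * (sin (x / 2))\<^sup>2" for x :: real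
    using cos_double_sin[of "x / 2"] by simp
  let ?s = "\<bar>sin (a / 2)\<bar>" and ?t = "\<bar>sin (b / 2)\<bar>"
  have "\<bar>sin (a / 2 + b / 2)\<bar> \<le> \<bar>sin (a / 2) * cos (b / 2)\<bar> + \<bar>cos (a / 2) * sin (b / 2)\<bar>"
    unfolding sin_add by (rule abs_triangle_ineq)
  also have "\<dots> \<le> ?s * 1 + 1 * ?t"
    unfolding abs_mult by (intro add_mono mult_left_mono mult_right_mono) simp_all
  finally have "\<bar>sin ((a + b) / 2)\<bar> \<le> ?s + ?t"
    by (simp add: add_divide_distrib)
  then have "(sin ((a + b) / 2))\<^sup>2 \<le> (?s + ?t)\<^sup>2"
    by (rule abs_le_square_iff[THEN iffD1, OF order_trans]) simp
  also have "\<dots> \<le> (1 + \<eta>) * ?s\<^sup>2 + (1 + 1 / \<eta>) * ?t\<^sup>2"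
  proof -
    have "0 \<le> (\<eta> * ?s - ?t)\<^sup>2 / \<eta>"
      using assms by simp
    also have "\<dots> = (1 + \<eta>) * ?s\<^sup>2 + (1 + 1 / \<eta>) * ?t\<^sup>2 - (?s + ?t)\<^sup>2"
      using assms by (simp add: power2_eq_square field_simps)
    finally show ?thesis by simp
  qed
  finally show ?thesis
    unfolding half by (simp add: algebra_simps)
qed

lemma exponent_add_le:
  assumes "\<eta> > 0"
  shows "exponent l (v + w) \<le> ennreal (1 + \<eta>) * exponent l v + ennreal (1 + 1 / \<eta>) * exponent l w"
proof -
  have "exponent l (v + w) \<le> (\<integral>\<^sup>+ x. ennreal (1 + \<eta>) * ennreal (1 - cos (v \<bullet> x)) +
      ennreal (1 + 1 / \<eta>) * ennreal (1 - cos (w \<bullet> x)) \<partial>tempered_levy \<sigma> \<alpha> l)"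
    unfolding exponent_def
  proof (rule nn_integral_mono)
    fix x :: "real^'d"
    have "ennreal (1 - cos ((v + w) \<bullet> x)) \<le> ennreal ((1 + \<eta>) * (1 - cos (v \<bullet> x)) + (1 + 1 / \<eta>) * (1 - cos (w \<bullet> x)))"
      unfolding inner_add_left by (rule ennreal_leI[OF one_minus_cos_add_le[OF assms]])
    also have "\<dots> = ennreal (1 + \<eta>) * ennreal (1 - cos (v \<bullet> x)) + ennreal (1 + 1 / \<eta>) * ennreal (1 - cos (w \<bullet> x))"
      using assms by (simp add: ennreal_plus ennreal_mult)
    finally show "ennreal (1 - cos ((v + w) \<bullet> x)) \<le> \<dots>" .
  qed
  also have "\<dots> = ennreal (1 + \<eta>) * exponent l v + ennreal (1 + 1 / \<eta>) * exponent l w"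
    unfolding exponent_def
    by (subst nn_integral_add) (simp_all add: nn_integral_cmult)
  finally show ?thesis .
qed

text \<open>Joint continuity in tempering and frequency serves three purposes: measurability,
  Fatou's lemma at fixed tempering, and the removal of the tempering. The majorant takes the
  untempered density and a bound \<open>b\<close> for the frequencies.\<close>

lemma exponent_LIMSEQ:
  assumes l: "\<And>n. 0 \<le> l n" "l \<longlonglongrightarrow> l'" and v: "v \<longlonglongrightarrow> v'"
  shows "(\<lambda>n. exponent (l n) (v n)) \<longlonglongrightarrow> exponent l' v'"
proof -
  obtain b where b: "\<And>n. norm (v n) \<le> b"
    using Bseq_def convergent_imp_Bseq[OF convergentI[OF v]] by (auto simp: Bseq_def)
  define c where "c = 1 + b\<^sup>2"
  have c: "1 + (norm (v n))\<^sup>2 \<le> c" "c \<ge> 0" for n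
    using power_mono[OF b norm_ge_zero, of n 2] by (simp_all add: c_def)
  note measurable_polar [measurable]
  show ?thesis
    unfolding exponent_eq
  proof (rule nn_integral_dominated_convergence[where
      w = "\<lambda>p. ennreal c * (radial_density 0 (snd p) * ennreal (min 2 ((norm (snd p *\<^sub>R fst p))\<^sup>2)))"])
    show "(\<integral>\<^sup>+ p. ennreal c * (radial_density 0 (snd p) * ennreal (min 2 ((norm (snd p *\<^sub>R fst p))\<^sup>2))) \<partial>(\<sigma> \<Otimes>\<^sub>M lborel)) < \<infinity>"
      using tempered_levy_min_finite
      by (intro le_less_trans[OF eq_refl[OF nn_integral_cmult]]) (measurable, simp add: ennreal_mult_less_top)
    show "AE p in \<sigma> \<Otimes>\<^sub>M lborel. radial_density (l n) (snd p) * ennreal (1 - cos (v n \<bullet> (snd p *\<^sub>R fst p))) \<le>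
        ennreal c * (radial_density 0 (snd p) * ennreal (min 2 ((norm (snd p *\<^sub>R fst p))\<^sup>2)))" for n
    proof (rule AE_I2)
      fix p :: "(real^'d) \<times> real"
      let ?x = "snd p *\<^sub>R fst p"
      have "1 - cos (v n \<bullet> ?x) \<le> (1 + (norm (v n))\<^sup>2) * min 2 ((norm ?x)\<^sup>2)"
        by (rule one_minus_cos_le)
      also have "\<dots> \<le> c * min 2 ((norm ?x)\<^sup>2)"
        using c by (intro mult_right_mono) auto
      finally have "ennreal (1 - cos (v n \<bullet> ?x)) \<le> ennreal c * ennreal (min 2 ((norm ?x)\<^sup>2))"
        using c(2) by (simp add: ennreal_leI flip: ennreal_mult)
      then have "radial_density (l n) (snd p) * ennreal (1 - cos (v n \<bullet> ?x)) \<le>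
          radial_density 0 (snd p) * (ennreal c * ennreal (min 2 ((norm ?x)\<^sup>2)))"
        by (intro mult_mono radial_density_le l(1)) auto
      then show "radial_density (l n) (snd p) * ennreal (1 - cos (v n \<bullet> ?x)) \<le>
          ennreal c * (radial_density 0 (snd p) * ennreal (min 2 ((norm ?x)\<^sup>2)))"
        by (simp only: mult.left_commute)
    qed
    show "AE p in \<sigma> \<Otimes>\<^sub>M lborel. (\<lambda>n. radial_density (l n) (snd p) * ennreal (1 - cos (v n \<bullet> (snd p *\<^sub>R fst p))))
        \<longlonglongrightarrow> radial_density l' (snd p) * ennreal (1 - cos (v' \<bullet> (snd p *\<^sub>R fst p)))"
    proof (rule AE_I2)
      fix p :: "(real^'d) \<times> real"
      have *: "radial_density a r * ennreal (1 - cos y) = indicator {0<..} r * ennreal (r powr (- \<alpha> - 1) * exp (- a * r) * (1 - cos y))" for a r y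
        unfolding radial_density_def by (subst ennreal_mult) (simp_all add: mult.assoc)
      have "(\<lambda>n. ennreal (snd p powr (- \<alpha> - 1) * exp (- l n * snd p) * (1 - cos (v n \<bullet> (snd p *\<^sub>R fst p)))))
        \<longlonglongrightarrow> ennreal (snd p powr (- \<alpha> - 1) * exp (- l' * snd p) * (1 - cos (v' \<bullet> (snd p *\<^sub>R fst p))))"
        by (intro tendsto_ennrealI tendsto_intros l v)
      then show "(\<lambda>n. radial_density (l n) (snd p) * ennreal (1 - cos (v n \<bullet> (snd p *\<^sub>R fst p))))
        \<longlonglongrightarrow> radial_density l' (snd p) * ennreal (1 - cos (v' \<bullet> (snd p *\<^sub>R fst p)))"
        unfolding * by (cases "snd p > 0") simp_all
    qed
  qed measurable
qed

lemma continuous_on_exponent: "0 \<le> l \<Longrightarrow> continuous_on UNIV (exponent l)"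
  unfolding continuous_on_sequentially o_def by (auto intro!: exponent_LIMSEQ)

lemma measurable_exponent [measurable]: "0 \<le> l \<Longrightarrow> exponent l \<in> borel_measurable borel"
  by (rule borel_measurable_continuous_onI[OF continuous_on_exponent])

text \<open>Substituting \<open>a * r\<close> for the radius, the power law yields the factor
  \<open>a powr - \<alpha>\<close>, while the decay rate \<open>l / a\<close> becomes
  \<open>l\<close>. For \<open>l = 0\<close> this is the self-similarity of stable laws.\<close>

lemma exponent_scaleR:
  assumes "a > 0"
  shows "ennreal (a powr - \<alpha>) * exponent l (a *\<^sub>R v) = exponent (l / a) v"
proof -
  note measurable_polar [measurable]
  have meas: "(\<lambda>p. radial_density m (snd p) * ennreal (1 - cos (u \<bullet> (snd p *\<^sub>R fst p)))) \<in> borel_measurable (\<sigma> \<Otimes>\<^sub>M lborel)" for m u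
    by measurable
  have fst: "exponent m u = (\<integral>\<^sup>+ \<theta>. \<integral>\<^sup>+ r. radial_density m r * ennreal (1 - cos (u \<bullet> (r *\<^sub>R \<theta>))) \<partial>lborel \<partial>\<sigma>)" for m u
    unfolding exponent_eq by (rule trans[OF lborel.nn_integral_fst[OF meas, symmetric]]) simp
  have "(\<integral>\<^sup>+ r. radial_density (l / a) r * ennreal (1 - cos (v \<bullet> (r *\<^sub>R \<theta>))) \<partial>lborel) =
      (\<integral>\<^sup>+ r. ennreal (a powr - \<alpha>) * (radial_density l r * ennreal (1 - cos ((a *\<^sub>R v) \<bullet> (r *\<^sub>R \<theta>)))) \<partial>lborel)" for \<theta>
  proof -
    have "ennreal a * radial_density (l / a) (a * r) = ennreal (a powr - \<alpha>) * radial_density l r" for r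
    proof (cases "r > 0")
      case True
      have "a * ((a * r) powr (- \<alpha> - 1) * exp (- (l / a) * (a * r))) = a powr - \<alpha> * (r powr (- \<alpha> - 1) * exp (- l * r))"
        using True assms by (simp add: powr_mult powr_diff powr_minus field_simps)
      then show ?thesis
        using True assms by (simp add: radial_density_def ennreal_mult[symmetric])
    qed (use assms in \<open>simp add: radial_density_def zero_less_mult_iff\<close>)
    then have *: "ennreal a * (radial_density (l / a) (a * r) * z) = ennreal (a powr - \<alpha>) * (radial_density l r * z)" for r z
      by (simp only: mult.assoc[symmetric])
    have "(\<integral>\<^sup>+ r. radial_density (l / a) r * ennreal (1 - cos (v \<bullet> (r *\<^sub>R \<theta>))) \<partial>lborel) =
        ennreal \<bar>a\<bar> * (\<integral>\<^sup>+ r. radial_density (l / a) (0 + a * r) * ennreal (1 - cos (v \<bullet> ((0 + a * r) *\<^sub>R \<theta>))) \<partial>lborel)"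
      using assms by (intro nn_integral_real_affine) simp_all
    also have "\<dots> = (\<integral>\<^sup>+ r. ennreal a * (radial_density (l / a) (a * r) * ennreal (1 - cos (v \<bullet> ((a * r) *\<^sub>R \<theta>)))) \<partial>lborel)"
      using assms by (simp add: nn_integral_cmult)
    finally show ?thesis
      unfolding * by (simp add: ac_simps)
  qed
  then have "exponent (l / a) v =
      (\<integral>\<^sup>+ \<theta>. \<integral>\<^sup>+ r. ennreal (a powr - \<alpha>) * (radial_density l r * ennreal (1 - cos ((a *\<^sub>R v) \<bullet> (r *\<^sub>R \<theta>)))) \<partial>lborel \<partial>\<sigma>)"
    unfolding fst by (simp only:)
  also have "\<dots> = (\<integral>\<^sup>+ p. ennreal (a powr - \<alpha>) * (radial_density l (snd p) * ennreal (1 - cos ((a *\<^sub>R v) \<bullet> (snd p *\<^sub>R fst p)))) \<partial>(\<sigma> \<Otimes>\<^sub>M lborel))"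
    by (rule trans[OF _ lborel.nn_integral_fst]) (simp, measurable)
  also have "\<dots> = ennreal (a powr - \<alpha>) * exponent l (a *\<^sub>R v)"
    unfolding exponent_eq by (rule nn_integral_cmult) measurable
  finally show ?thesis ..
qed

end

section \<open>Scalar stochastic integrals\<close>

locale tempered_random_field = tempered_exponent \<sigma> \<alpha>
  for \<sigma> :: "(real^'d) measure" and \<alpha> :: real +
  fixes l :: real and P :: "'w measure" and M :: "(real^'n) set \<Rightarrow> 'w \<Rightarrow> real^'d"
  assumes l: "0 \<le> l" and M: "tempered_random_measure \<sigma> \<alpha> l P M"
begin

sublocale prob_space P
  using M by (simp add: tempered_random_measure_def)

lemma M_measurable: "A \<in> fmeasurable lborel \<Longrightarrow> M A \<in> borel_measurable P"
  using M unfolding tempered_random_measure_def by blast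

lemma M_indep:
  assumes "\<And>i. A i \<in> fmeasurable lborel" "disjoint_family A"
  shows "indep_vars (\<lambda>_. borel) (\<lambda>i::nat. M (A i)) UNIV"
proof -
  have "range A \<subseteq> fmeasurable lborel \<and> disjoint_family A"
    using assms by blast
  then show ?thesis
    using M unfolding tempered_random_measure_def by simp
qed

lemma M_sums:
  assumes "\<And>i. A i \<in> fmeasurable lborel" "disjoint_family A" "(\<Union>i::nat. A i) \<in> fmeasurable lborel"
  shows "AE w in P. (\<lambda>i. M (A i) w) sums M (\<Union>i. A i) w"
proof -
  have "range A \<subseteq> fmeasurable lborel \<and> disjoint_family A \<and> (\<Union>i::nat. A i) \<in> fmeasurable lborel"
    using assms by blast
  then show ?thesis
    using M unfolding tempered_random_measure_def by simp
qed

lemma M_char: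
  "A \<in> fmeasurable lborel \<Longrightarrow>
    (\<integral>w. iexp (u \<bullet> M A w) \<partial>P) = exp (complex_of_real (measure lborel A * log_char \<sigma> \<alpha> l u))"
  using M unfolding tempered_random_measure_def by blast

text \<open>Additivity over a sequence of empty sets makes a constant series converge, so its terms
  vanish.\<close>

lemma M_empty: "AE w in P. M {} w = 0"
proof -
  have "AE w in P. (\<lambda>i::nat. M {} w) sums M {} w"
    using M_sums[of "\<lambda>_. {}"] by (simp add: disjoint_family_on_def)
  then show ?thesis
  proof eventually_elim
    case (elim w)
    then have "(\<lambda>i::nat. M {} w) \<longlonglongrightarrow> 0"
      by (intro summable_LIMSEQ_zero sums_summable)
    then show ?case by (simp add: LIMSEQ_const_iff)
  qed
qed

lemma M_Un:
  assumes "A \<in> fmeasurable lborel" "B \<in> fmeasurable lborel" "A \<inter> B = {}"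
  shows "AE w in P. M (A \<union> B) w = M A w + M B w"
proof -
  have "AE w in P. (\<lambda>i. M (binaryset A B i) w) sums M (\<Union>i. binaryset A B i) w"
  proof (rule M_sums)
    show "binaryset A B i \<in> fmeasurable lborel" for i
      using assms by (simp add: binaryset_def)
    show "disjoint_family (binaryset A B)"
      using assms(3) by (auto simp: disjoint_family_on_def binaryset_def)
    show "(\<Union>i. binaryset A B i) \<in> fmeasurable lborel"
      using assms by (simp add: UN_binaryset_eq fmeasurable.Un)
  qed
  with M_empty show ?thesis
  proof eventually_elim
    case (elim w)
    then show ?case
      using sums_unique2[OF elim(2)] binaryset_sums[of "\<lambda>A. M A w" A B] by (simp add: UN_binaryset_eq)
  qed
qed

lemma M_finite_UN:
  assumes "finite I" "\<And>i. i \<in> I \<Longrightarrow> A i \<in> fmeasurable lborel" "disjoint_family_on A I"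
  shows "AE w in P. M (\<Union>i\<in>I. A i) w = (\<Sum>i\<in>I. M (A i) w)"
  using assms
proof (induction I)
  case empty
  then show ?case using M_empty by simp
next
  case (insert i I)
  have "AE w in P. M (\<Union>i\<in>I. A i) w = (\<Sum>i\<in>I. M (A i) w)"
    using insert.prems by (intro insert.IH) (auto simp: disjoint_family_on_def)
  moreover have "AE w in P. M (A i \<union> (\<Union>i\<in>I. A i)) w = M (A i) w + M (\<Union>i\<in>I. A i) w"
  proof (rule M_Un)
    show "(\<Union>i\<in>I. A i) \<in> fmeasurable lborel"
      using insert by (intro fmeasurable.finite_UN) auto
    show "A i \<inter> (\<Union>i\<in>I. A i) = {}"
      using insert.prems(2) insert.hyps(2) by (auto simp: disjoint_family_on_def)
  qed (use insert in auto)
  ultimately show ?case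
    by eventually_elim (use insert.hyps in simp)
qed

abbreviation simple :: "(real^'n \<Rightarrow> 'b::real_vector) \<Rightarrow> bool" where
  "simple \<equiv> Bochner_Integration.simple_bochner_integrable lborel"

lemma simple_facts:
  fixes G :: "real^'n \<Rightarrow> 'b::real_vector"
  assumes "simple G"
  shows "finite (range G)" "\<And>b. G -` {b} \<in> sets borel"
    "\<And>b. b \<noteq> 0 \<Longrightarrow> {s. G s = b} \<in> fmeasurable lborel"
proof -
  have sf: "simple_function lborel G" and fin: "emeasure lborel {y. G y \<noteq> 0} \<noteq> \<infinity>"
    using assms by (auto elim: Bochner_Integration.simple_bochner_integrable.cases)
  then show fr: "finite (range G)"
    by (simp add: simple_function_def)
  have pre: "G -` {b} \<in> sets borel" for b
  proof (cases "b \<in> range G")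
    case False
    then have "G -` {b} = {}" by auto
    then show ?thesis by simp
  qed (use sf in \<open>auto simp: simple_function_def\<close>)
  then show "\<And>b. G -` {b} \<in> sets borel" .
  fix b :: 'b assume "b \<noteq> 0"
  have "{y. G y \<noteq> 0} = - (G -` {0})" by auto
  then have "{y. G y \<noteq> 0} \<in> sets lborel"
    using pre[of 0] by simp
  then have "emeasure lborel {s. G s = b} \<le> emeasure lborel {y. G y \<noteq> 0}"
    using \<open>b \<noteq> 0\<close> by (intro emeasure_mono) auto
  then have "emeasure lborel {s. G s = b} < \<infinity>"
    using fin by (auto simp: less_top intro: le_less_trans)
  with pre[of b] show "{s. G s = b} \<in> fmeasurable lborel"
    by (simp add: fmeasurable_def vimage_def)
qed

text \<open>Vector-valued integrands suffice because
  \<open>u \<bullet> (A *v m) = (u v* A) \<bullet> m\<close> moves a matrix to the other side. As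
  the canonical representation is used, linearity is available only almost surely.\<close>

definition simple_integral :: "(real^'n \<Rightarrow> real^'d) \<Rightarrow> 'w \<Rightarrow> real" where
  "simple_integral v w = (\<Sum>y\<in>range v - {0}. y \<bullet> M {s. v s = y} w)"

lemma simple_integral_measurable [measurable]:
  assumes "simple v"
  shows "simple_integral v \<in> borel_measurable P"
  unfolding simple_integral_def
  by (intro borel_measurable_sum borel_measurable_inner borel_measurable_const M_measurable
      simple_facts(3)[OF assms]) auto

text \<open>Taking for \<open>G\<close> a pair of simple functions yields additivity of the integral almost surely.\<close>

lemma simple_integral_compose:
  fixes G :: "real^'n \<Rightarrow> 'b::real_vector" and h :: "'b \<Rightarrow> real^'d"
  assumes G: "simple G" and h: "h 0 = 0"
  shows "AE w in P. simple_integral (\<lambda>s. h (G s)) w = (\<Sum>b\<in>range G - {0}. h b \<bullet> M {s. G s = b} w)"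
proof -
  note G_facts = simple_facts[OF G]
  let ?R = "range (\<lambda>s. h (G s)) - {0}"
  \<comment> \<open>The level set of \<open>h \<circ> G\<close> at \<open>y\<close> splits into the
    level sets of \<open>G\<close> at the points of \<open>I y\<close>. Leaving out the value 0
    keeps these of finite measure, and by \<open>h 0 = 0\<close> it affects no level
    \<open>y\<close> other than 0.\<close>
  define I where "I y = {b \<in> range G - {0}. h b = y}" for y
  have finI: "finite (I y)" for y
    using G_facts(1) by (simp add: I_def)
  have finR: "finite ?R"
    using G_facts(1) by (simp add: image_image[symmetric])
  have "AE w in P. M (\<Union>b\<in>I y. {s. G s = b}) w = (\<Sum>b\<in>I y. M {s. G s = b} w)" for y
    by (intro M_finite_UN finI G_facts(3)) (auto simp: I_def disjoint_family_on_def)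
  then have "AE w in P. \<forall>y\<in>?R. M (\<Union>b\<in>I y. {s. G s = b}) w = (\<Sum>b\<in>I y. M {s. G s = b} w)"
    using finR by (simp add: AE_finite_all)
  then show ?thesis
  proof eventually_elim
    case (elim w)
    have "simple_integral (\<lambda>s. h (G s)) w = (\<Sum>y\<in>?R. \<Sum>b\<in>I y. h b \<bullet> M {s. G s = b} w)"
      unfolding simple_integral_def
    proof (rule sum.cong[OF refl])
      fix y assume y: "y \<in> ?R"
      have "{s. h (G s) = y} = (\<Union>b\<in>I y. {s. G s = b})"
        using y h by (auto simp: I_def)
      then have "y \<bullet> M {s. h (G s) = y} w = (\<Sum>b\<in>I y. y \<bullet> M {s. G s = b} w)"
        using elim y by (simp add: inner_sum_right)
      also have "\<dots> = (\<Sum>b\<in>I y. h b \<bullet> M {s. G s = b} w)"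
        by (intro sum.cong) (auto simp: I_def)
      finally show "y \<bullet> M {s. h (G s) = y} w = (\<Sum>b\<in>I y. h b \<bullet> M {s. G s = b} w)" .
    qed
    also have "\<dots> = (\<Sum>b\<in>{b\<in>range G - {0}. h b \<noteq> 0}. h b \<bullet> M {s. G s = b} w)"
    proof -
      let ?A = "{b\<in>range G - {0}. h b \<noteq> 0}"
      have "(\<Sum>y\<in>?R. \<Sum>b\<in>I y. h b \<bullet> M {s. G s = b} w) = (\<Sum>y\<in>?R. \<Sum>b\<in>{b\<in>?A. h b = y}. h b \<bullet> M {s. G s = b} w)"
        by (rule sum.cong[OF refl], rule sum.cong) (auto simp: I_def)
      also have "\<dots> = (\<Sum>b\<in>?A. h b \<bullet> M {s. G s = b} w)"
        using finR G_facts(1) by (intro sum.group) auto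
      finally show ?thesis .
    qed
    also have "\<dots> = (\<Sum>b\<in>range G - {0}. h b \<bullet> M {s. G s = b} w)"
      using G_facts(1) by (intro sum.mono_neutral_left) auto
    finally show ?case .
  qed
qed

lemma simple_integral_diff:
  assumes "simple v" "simple v'"
  shows "AE w in P. simple_integral (\<lambda>s. v s - v' s) w = simple_integral v w - simple_integral v' w"
proof -
  define G where "G s = (v s, v' s)" for s
  have G: "simple G"
    unfolding G_def
    by (rule simple_bochner_integrable_compose2[where p = Pair, OF _ assms]) (simp add: zero_prod_def)
  have "AE w in P. simple_integral (\<lambda>s. fst (G s) - snd (G s)) w = (\<Sum>b\<in>range G - {0}. (fst b - snd b) \<bullet> M {s. G s = b} w)"
    by (rule simple_integral_compose[OF G, of "\<lambda>b. fst b - snd b"]) simp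
  moreover have "AE w in P. simple_integral (\<lambda>s. fst (G s)) w = (\<Sum>b\<in>range G - {0}. fst b \<bullet> M {s. G s = b} w)"
    by (rule simple_integral_compose[OF G]) simp
  moreover have "AE w in P. simple_integral (\<lambda>s. snd (G s)) w = (\<Sum>b\<in>range G - {0}. snd b \<bullet> M {s. G s = b} w)"
    by (rule simple_integral_compose[OF G]) simp
  ultimately show ?thesis
    by eventually_elim (simp add: G_def inner_diff_left sum_subtractf)
qed

lemma simple_integral_add:
  assumes "simple v" "simple v'"
  shows "AE w in P. simple_integral (\<lambda>s. v s + v' s) w = simple_integral v w + simple_integral v' w"
proof -
  define G where "G s = (v s, v' s)" for s
  have G: "simple G"
    unfolding G_def
    by (rule simple_bochner_integrable_compose2[where p = Pair, OF _ assms]) (simp add: zero_prod_def)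
  have "AE w in P. simple_integral (\<lambda>s. fst (G s) + snd (G s)) w = (\<Sum>b\<in>range G - {0}. (fst b + snd b) \<bullet> M {s. G s = b} w)"
    by (rule simple_integral_compose[OF G, of "\<lambda>b. fst b + snd b"]) simp
  moreover have "AE w in P. simple_integral (\<lambda>s. fst (G s)) w = (\<Sum>b\<in>range G - {0}. fst b \<bullet> M {s. G s = b} w)"
    by (rule simple_integral_compose[OF G]) simp
  moreover have "AE w in P. simple_integral (\<lambda>s. snd (G s)) w = (\<Sum>b\<in>range G - {0}. snd b \<bullet> M {s. G s = b} w)"
    by (rule simple_integral_compose[OF G]) simp
  ultimately show ?thesis
    by eventually_elim (simp add: G_def inner_add_left sum.distrib)
qed

lemma simple_integral_matrix:
  assumes "simple F"
  shows "AE w in P. simple_integral (\<lambda>s. u v* F s) w = u \<bullet> simple_stoch_integral M F w"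
proof -
  have "AE w in P. simple_integral (\<lambda>s. u v* F s) w = (\<Sum>D\<in>range F - {0}. (u v* D) \<bullet> M {s. F s = D} w)"
    by (rule simple_integral_compose[OF assms]) (simp add: vector_matrix_mult_def vec_eq_iff)
  then show ?thesis
    by eventually_elim (simp add: simple_stoch_integral_def inner_sum_right dot_lmul_matrix)
qed

text \<open>The values of \<open>M\<close> on the disjoint level sets are independent, so the
  characteristic function factors; the exponents add up to an integral because the integrand is
  constant on each level set.\<close>

lemma simple_integral_char:
  assumes v: "simple v"
  shows "(\<integral>\<^sup>+ s. exponent l (v s) \<partial>lborel) < \<infinity>"
    "(\<integral>w. iexp (simple_integral v w) \<partial>P) = exp (complex_of_real (- enn2real (\<integral>\<^sup>+ s. exponent l (v s) \<partial>lborel)))"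
proof -
  note v_facts = simple_facts[OF v]
  let ?R = "range v - {0}" and ?A = "\<lambda>y. {s. v s = y}"
  have R: "finite ?R" using v_facts(1) by simp
  have A: "?A y \<in> fmeasurable lborel" if "y \<in> ?R" for y
    using v_facts(3)[of y] that by simp
  define c where "c = (\<Sum>y\<in>?R. measure lborel (?A y) * log_char \<sigma> \<alpha> l y)"
  have c: "c \<le> 0"
    unfolding c_def by (intro sum_nonpos mult_nonneg_nonpos log_char_eq l) simp
  have "exponent l (v s) = (\<Sum>y\<in>?R. exponent l y * indicator (?A y) s)" for s
  proof -
    have "(\<Sum>y\<in>?R. exponent l y * indicator (?A y) s) = (\<Sum>y\<in>?R. if y = v s then exponent l y else 0)"
      by (intro sum.cong) (auto simp: indicator_def)
    also have "\<dots> = exponent l (v s)"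
      using R by simp
    finally show ?thesis ..
  qed
  then have "(\<integral>\<^sup>+ s. exponent l (v s) \<partial>lborel) = (\<integral>\<^sup>+ s. (\<Sum>y\<in>?R. exponent l y * indicator (?A y) s) \<partial>lborel)"
    by simp
  also have "\<dots> = (\<Sum>y\<in>?R. \<integral>\<^sup>+ s. exponent l y * indicator (?A y) s \<partial>lborel)"
    using A by (intro nn_integral_sum) (auto dest: fmeasurableD)
  also have "\<dots> = (\<Sum>y\<in>?R. ennreal (- (measure lborel (?A y) * log_char \<sigma> \<alpha> l y)))"
  proof (rule sum.cong[OF refl])
    fix y assume y: "y \<in> ?R"
    have "(\<integral>\<^sup>+ s. exponent l y * indicator (?A y) s \<partial>lborel) = exponent l y * ennreal (measure lborel (?A y))"
      unfolding emeasure_eq_measure2[OF A[OF y], symmetric]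
      by (rule nn_integral_cmult_indicator[OF fmeasurableD[OF A[OF y]]])
    also have "\<dots> = ennreal (- log_char \<sigma> \<alpha> l y * measure lborel (?A y))"
      unfolding log_char_eq(1)[OF l, symmetric]
      by (rule ennreal_mult[symmetric]) (use log_char_eq(2)[OF l, of y] in simp_all)
    finally show "(\<integral>\<^sup>+ s. exponent l y * indicator (?A y) s \<partial>lborel) = ennreal (- (measure lborel (?A y) * log_char \<sigma> \<alpha> l y))"
      by (simp add: mult.commute)
  qed
  also have "\<dots> = ennreal (\<Sum>y\<in>?R. - (measure lborel (?A y) * log_char \<sigma> \<alpha> l y))"
    using log_char_eq(2)[OF l] by (intro sum_ennreal) (simp add: mult_nonneg_nonpos)
  also have "\<dots> = ennreal (- c)"
    by (simp add: c_def sum_negf)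
  finally have int: "(\<integral>\<^sup>+ s. exponent l (v s) \<partial>lborel) = ennreal (- c)" .
  then show "(\<integral>\<^sup>+ s. exponent l (v s) \<partial>lborel) < \<infinity>" by simp
  obtain e where e: "bij_betw e {0..<card ?R} ?R"
    using ex_bij_betw_nat_finite[OF R] by blast
  let ?m = "card ?R"
  \<comment> \<open>Independence is stated for sequences of sets, so the finitely many level sets
    are continued by empty ones.\<close>
  define B where "B k = (if k < ?m then ?A (e k) else {})" for k
  have B: "B k \<in> fmeasurable lborel" for k
    using A bij_betwE[OF e] by (auto simp: B_def)
  have "disjoint_family B"
    using bij_betw_imp_inj_on[OF e] by (auto simp: disjoint_family_on_def B_def inj_on_def)
  then have "indep_vars (\<lambda>_. borel) (\<lambda>k. M (B k)) {0..<?m}"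
    by (intro indep_vars_subset[OF M_indep] B) auto
  then have ind: "indep_vars (\<lambda>_. borel) (\<lambda>k w. iexp (e k \<bullet> M (B k) w)) {0..<?m}"
    by (rule indep_vars_compose2) measurable
  have BM [measurable]: "M (B k) \<in> borel_measurable P" for k
    by (rule M_measurable[OF B])
  have "iexp (simple_integral v w) = (\<Prod>k\<in>{0..<?m}. iexp (e k \<bullet> M (B k) w))" for w
  proof -
    have "simple_integral v w = (\<Sum>k\<in>{0..<?m}. e k \<bullet> M (?A (e k)) w)"
      unfolding simple_integral_def by (rule sum.reindex_bij_betw[OF e, symmetric])
    also have "\<dots> = (\<Sum>k\<in>{0..<?m}. e k \<bullet> M (B k) w)"
      by (intro sum.cong) (auto simp: B_def)
    finally show ?thesis
      by (simp add: exp_sum sum_distrib_left)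
  qed
  then have "(\<integral>w. iexp (simple_integral v w) \<partial>P) = (\<integral>w. (\<Prod>k\<in>{0..<?m}. iexp (e k \<bullet> M (B k) w)) \<partial>P)"
    by (simp only:)
  also have "\<dots> = (\<Prod>k\<in>{0..<?m}. \<integral>w. iexp (e k \<bullet> M (B k) w) \<partial>P)"
    by (rule indep_vars_lebesgue_integral[OF _ ind]) (auto intro!: integrable_const_bound[where B = 1])
  also have "\<dots> = (\<Prod>k\<in>{0..<?m}. exp (complex_of_real (measure lborel (?A (e k)) * log_char \<sigma> \<alpha> l (e k))))"
  proof (rule prod.cong[OF refl])
    fix k assume "k \<in> {0..<?m}"
    then have "B k = ?A (e k)" by (simp add: B_def)
    then show "(\<integral>w. iexp (e k \<bullet> M (B k) w) \<partial>P) = exp (complex_of_real (measure lborel (?A (e k)) * log_char \<sigma> \<alpha> l (e k)))"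
      using M_char[OF B[of k], of "e k"] by (simp only:)
  qed
  also have "\<dots> = exp (complex_of_real (\<Sum>k\<in>{0..<?m}. measure lborel (?A (e k)) * log_char \<sigma> \<alpha> l (e k)))"
    by (simp only: exp_sum finite_atLeastLessThan of_real_sum)
  also have "(\<Sum>k\<in>{0..<?m}. measure lborel (?A (e k)) * log_char \<sigma> \<alpha> l (e k)) = c"
    unfolding c_def by (rule sum.reindex_bij_betw[OF e])
  also have "c = - enn2real (\<integral>\<^sup>+ s. exponent l (v s) \<partial>lborel)"
    using int c by simp
  finally show "(\<integral>w. iexp (simple_integral v w) \<partial>P) = exp (complex_of_real (- enn2real (\<integral>\<^sup>+ s. exponent l (v s) \<partial>lborel)))" .
qed

end

section \<open>Truncated means\<close>

lemma (in prob_space) integrable_min_1 [simp]: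
  fixes f :: "'a \<Rightarrow> real"
  assumes "f \<in> borel_measurable M"
  shows "integrable M (\<lambda>w. min 1 \<bar>f w\<bar>)"
  using assms by (intro integrable_const_bound[where B = 1]) auto

lemma (in prob_space) tendsto_min_1_if_converges_in_prob:
  fixes Y :: "nat \<Rightarrow> 'a \<Rightarrow> 'v::euclidean_space"
  assumes [measurable]: "\<And>k. Y k \<in> borel_measurable M" "Z \<in> borel_measurable M"
    and conv: "converges_in_prob M Y Z"
  shows "(\<lambda>k. \<integral>w. min 1 (norm (Y k w - Z w)) \<partial>M) \<longlonglongrightarrow> 0"
proof (rule LIMSEQ_I)
  fix r :: real assume r: "r > 0"
  have "(\<lambda>k. measure M {w\<in>space M. norm (Y k w - Z w) > r / 2}) \<longlonglongrightarrow> 0"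
    by (rule conv[unfolded converges_in_prob_def, rule_format]) (use r in simp)
  then have "\<forall>\<^sub>F k in sequentially. measure M {w\<in>space M. norm (Y k w - Z w) > r / 2} < r / 2"
    by (rule order_tendstoD) (use r in simp)
  then have "\<forall>\<^sub>F k in sequentially. norm ((\<integral>w. min 1 (norm (Y k w - Z w)) \<partial>M) - 0) < r"
  proof eventually_elim
    case (elim k)
    let ?A = "{w\<in>space M. norm (Y k w - Z w) > r / 2}"
    have ind: "integrable M (indicator ?A :: 'a \<Rightarrow> real)"
      by (rule integrable_const_bound[where B = 1]) auto
    have "(\<integral>w. min 1 (norm (Y k w - Z w)) \<partial>M) \<le> (\<integral>w. r / 2 + indicator ?A w \<partial>M)"
    proof (rule integral_mono)
      show "integrable M (\<lambda>w. min 1 (norm (Y k w - Z w)))"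
        by (rule integrable_const_bound[where B = 1]) auto
      show "integrable M (\<lambda>w. r / 2 + indicator ?A w)"
        using ind by simp
      show "min 1 (norm (Y k w - Z w)) \<le> r / 2 + indicator ?A w" if "w \<in> space M" for w
        using that r by (auto simp: indicator_def)
    qed
    also have "\<dots> = r / 2 + measure M ?A"
      using ind by (simp add: prob_space Int_def conj_commute)
    finally have "(\<integral>w. min 1 (norm (Y k w - Z w)) \<partial>M) < r"
      using elim by simp
    moreover have "0 \<le> (\<integral>w. min 1 (norm (Y k w - Z w)) \<partial>M)"
      by (rule integral_nonneg_AE) simp
    ultimately show ?case by simp
  qed
  then show "\<exists>K. \<forall>k\<ge>K. norm ((\<integral>w. min 1 (norm (Y k w - Z w)) \<partial>M) - 0) < r"
    by (simp add: eventually_sequentially)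
qed

lemma norm_one_minus_iexp_le: "cmod (1 - iexp x) \<le> 2 * min 1 \<bar>x\<bar>"
proof -
  have "cmod (iexp x - 1) \<le> \<bar>x\<bar>"
    using iexp_approx1[of x 0] by simp
  moreover have "cmod (1 - iexp x) \<le> cmod 1 + cmod (iexp x)"
    by (rule norm_triangle_ineq4)
  moreover have "cmod (iexp x) = 1" by simp
  ultimately show ?thesis
    using abs_ge_zero[of x] by (auto simp: norm_minus_commute min_def)
qed

text \<open>Factoring out \<open>iexp (g w)\<close>, of modulus 1, leaves
  \<open>1 - iexp (f w - g w)\<close>; characteristic functions are thus Lipschitz for the truncated
  mean.\<close>

lemma (in prob_space) norm_integral_iexp_diff_le:
  fixes f g :: "'a \<Rightarrow> real"
  assumes [measurable]: "f \<in> borel_measurable M" "g \<in> borel_measurable M"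
  shows "cmod ((\<integral>w. iexp (f w) \<partial>M) - (\<integral>w. iexp (g w) \<partial>M)) \<le> 2 * (\<integral>w. min 1 \<bar>f w - g w\<bar> \<partial>M)"
proof -
  have int: "integrable M (\<lambda>w. iexp (f w))" "integrable M (\<lambda>w. iexp (g w))"
    by (rule integrable_const_bound[where B = 1]; simp)+
  have "cmod ((\<integral>w. iexp (f w) \<partial>M) - (\<integral>w. iexp (g w) \<partial>M)) = cmod (\<integral>w. iexp (f w) - iexp (g w) \<partial>M)"
    using int by simp
  also have "\<dots> \<le> (\<integral>w. cmod (iexp (f w) - iexp (g w)) \<partial>M)"
    by (rule integral_norm_bound)
  also have "\<dots> \<le> (\<integral>w. 2 * min 1 \<bar>f w - g w\<bar> \<partial>M)"
  proof (rule integral_mono)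
    show "integrable M (\<lambda>w. cmod (iexp (f w) - iexp (g w)))"
      using int by simp
    show "integrable M (\<lambda>w. 2 * min 1 \<bar>f w - g w\<bar>)"
      by simp
    fix w
    have "iexp (f w) - iexp (g w) = - (iexp (g w) * (1 - iexp (f w - g w)))"
      by (simp add: right_diff_distrib flip: exp_add)
    then have "cmod (iexp (f w) - iexp (g w)) = cmod (1 - iexp (f w - g w))"
      by (simp only: norm_minus_cancel norm_mult norm_exp_i_times mult_1)
    then show "cmod (iexp (f w) - iexp (g w)) \<le> 2 * min 1 \<bar>f w - g w\<bar>"
      using norm_one_minus_iexp_le[of "f w - g w"] by (simp only:)
  qed
  also have "\<dots> = 2 * (\<integral>w. min 1 \<bar>f w - g w\<bar> \<partial>M)"
    by simp
  finally show ?thesis .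
qed

lemma tendsto_zero_if_le:
  fixes f g :: "nat \<Rightarrow> real"
  assumes "\<And>k. 0 \<le> f k" "\<And>k. f k \<le> g k" "g \<longlonglongrightarrow> 0"
  shows "f \<longlonglongrightarrow> 0"
  by (rule tendsto_sandwich[OF _ _ tendsto_const assms(3)]) (simp_all add: assms(1,2))

text \<open>Sending \<open>\<eta>\<close> to 0 together with \<open>r k\<close> could let the factor
  \<open>1 + 1 / \<eta>\<close> blow up. Hence \<open>\<eta>\<close> is fixed before the limit, and
  the upper bound on \<open>q k\<close> is established first, to control \<open>\<eta> * q k\<close>
  in the lower one.\<close>

lemma tendsto_if_quasi_triangle:
  fixes q r :: "nat \<Rightarrow> real"
  assumes q: "\<And>k. 0 \<le> q k" and Q: "0 \<le> Q" and r: "r \<longlonglongrightarrow> 0"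
    and le: "\<And>\<eta>. \<eta> > 0 \<Longrightarrow> \<forall>\<^sub>F k in sequentially. q k \<le> (1 + \<eta>) * Q + (1 + 1 / \<eta>) * r k"
    and ge: "\<And>\<eta>. \<eta> > 0 \<Longrightarrow> \<forall>\<^sub>F k in sequentially. Q \<le> (1 + \<eta>) * q k + (1 + 1 / \<eta>) * r k"
  shows "q \<longlonglongrightarrow> Q"
proof (rule LIMSEQ_I)
  fix \<epsilon> :: real assume \<epsilon>: "\<epsilon> > 0"
  \<comment> \<open>Chosen so that \<open>\<eta> * Q\<close> and, once
    \<open>q k < Q + \<epsilon>\<close> is known, also \<open>\<eta> * q k\<close> stay below
    \<open>\<epsilon> / 2\<close>.\<close>
  define \<eta> where "\<eta> = \<epsilon> / (2 * (Q + \<epsilon> + 1))"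
  have \<eta>: "\<eta> > 0" and "\<eta> * (Q + \<epsilon> + 1) = \<epsilon> / 2"
    using \<epsilon> Q by (simp_all add: \<eta>_def field_simps add_pos_pos add_nonneg_pos)
  then have \<eta>Q: "\<eta> * Q + \<eta> * \<epsilon> + \<eta> = \<epsilon> / 2" by (simp add: algebra_simps)
  have "\<eta> * Q \<ge> 0" "\<eta> * \<epsilon> \<ge> 0" using \<eta> Q \<epsilon> by simp_all
  have "(\<lambda>k. (1 + 1 / \<eta>) * r k) \<longlonglongrightarrow> (1 + 1 / \<eta>) * 0"
    by (intro tendsto_intros r)
  then have "\<forall>\<^sub>F k in sequentially. (1 + 1 / \<eta>) * r k < \<epsilon> / 2"
    by (rule order_tendstoD) (use \<epsilon> in simp)
  with le[OF \<eta>] ge[OF \<eta>] have "\<forall>\<^sub>F k in sequentially. norm (q k - Q) < \<epsilon>"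
  proof eventually_elim
    case (elim k)
    have up: "q k < Q + \<epsilon>"
      using elim(1,3) \<eta>Q \<open>\<eta> * \<epsilon> \<ge> 0\<close> \<eta> unfolding distrib_right[of 1 \<eta> Q] by linarith
    then have "\<eta> * q k \<le> \<eta> * (Q + \<epsilon>)"
      using \<eta> by (intro mult_left_mono) auto
    then have "Q < q k + \<epsilon>"
      using elim(2,3) \<eta>Q \<eta> unfolding distrib_right[of 1 \<eta> "q k"] distrib_left[of \<eta> Q \<epsilon>] by linarith
    with up show ?case by auto
  qed
  then show "\<exists>K. \<forall>k\<ge>K. norm (q k - Q) < \<epsilon>"
    by (simp add: eventually_sequentially)
qed

context tempered_random_field
begin

text \<open>\<open>S\<close> is a version of the integral of the vector-valued integrand \<open>v\<close> paired with \<open>M\<close>. The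
  truncated mean metrizes convergence in probability and, unlike tail probabilities, is subadditive.\<close>

definition scalar_integral :: "(real^'n \<Rightarrow> real^'d) \<Rightarrow> ('w \<Rightarrow> real) \<Rightarrow> bool" where
  "scalar_integral v S \<longleftrightarrow> v \<in> borel_measurable borel \<and> S \<in> borel_measurable P \<and>
    (\<exists>V. (\<forall>k. simple (V k)) \<and> (AE s in lborel. (\<lambda>k. V k s) \<longlonglongrightarrow> v s) \<and>
      (\<lambda>k. \<integral>w. min 1 \<bar>simple_integral (V k) w - S w\<bar> \<partial>P) \<longlonglongrightarrow> 0)"

lemma simple_stoch_integral_measurable:
  assumes "simple F"
  shows "simple_stoch_integral M F \<in> borel_measurable P"
  unfolding simple_stoch_integral_def
proof (intro borel_measurable_sum)
  fix D assume "D \<in> range F - {0}"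
  then have [measurable]: "M {s. F s = D} \<in> borel_measurable P"
    by (intro M_measurable simple_facts(3)[OF assms]) auto
  have "(\<lambda>x. D *v x) \<in> borel_measurable borel"
    by (intro borel_measurable_continuous_onI matrix_vector_mult_linear_continuous_on)
  then show "(\<lambda>w. D *v M {s. F s = D} w) \<in> borel_measurable P"
    by measurable
qed

lemma simple_vector_matrix_mult:
  assumes "simple F"
  shows "simple (\<lambda>s. u v* F s)"
  by (rule simple_bochner_integrable_compose2[where p = "\<lambda>x y. u v* x", OF _ assms assms])
    (simp add: vector_matrix_mult_def vec_eq_iff)

lemma min_1_mult_le: "min 1 (c * x) \<le> c * min 1 x" if "1 \<le> c" for c x :: real
  using that by (cases "x \<le> 1") auto

lemma scalar_integral_if_has_stoch_integral:
  assumes "has_stoch_integral P M f Z"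
  shows "scalar_integral (\<lambda>s. u v* f s) (\<lambda>w. u \<bullet> Z w)"
proof -
  obtain F where f [measurable]: "f \<in> borel_measurable borel" and Z [measurable]: "Z \<in> borel_measurable P"
    and F: "\<And>k. simple (F k)" "AE s in lborel. (\<lambda>k. F k s) \<longlonglongrightarrow> f s"
      "converges_in_prob P (\<lambda>k. simple_stoch_integral M (F k)) Z"
    using assms unfolding has_stoch_integral_def by blast
  have cont: "continuous_on UNIV (\<lambda>A :: real^'d^'d. u v* A)"
    unfolding vector_matrix_mult_def by (intro continuous_intros)
  note FM [measurable] = simple_stoch_integral_measurable[OF F(1)]
  \<comment> \<open>At least 1, as \<open>min_1_mult_le\<close> requires for pulling the constant
    out of the truncation; \<open>norm u\<close> alone may be smaller.\<close>
  let ?c = "1 + norm u"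
  have lim: "(\<lambda>k. \<integral>w. min 1 (norm (simple_stoch_integral M (F k) w - Z w)) \<partial>P) \<longlonglongrightarrow> 0"
    by (rule tendsto_min_1_if_converges_in_prob[OF FM Z F(3)])
  have le: "(\<integral>w. min 1 \<bar>simple_integral (\<lambda>s. u v* F k s) w - u \<bullet> Z w\<bar> \<partial>P) \<le>
      ?c * (\<integral>w. min 1 (norm (simple_stoch_integral M (F k) w - Z w)) \<partial>P)" for k
  proof -
    note [measurable] = simple_integral_measurable[OF simple_vector_matrix_mult[OF F(1)]]
    have int: "integrable P (\<lambda>w. min 1 (norm (simple_stoch_integral M (F k) w - Z w)))"
      by (rule integrable_const_bound[where B = 1]) auto
    have "(\<integral>w. min 1 \<bar>simple_integral (\<lambda>s. u v* F k s) w - u \<bullet> Z w\<bar> \<partial>P) \<le>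
        (\<integral>w. ?c * min 1 (norm (simple_stoch_integral M (F k) w - Z w)) \<partial>P)"
    proof (rule integral_mono_AE)
      show "integrable P (\<lambda>w. min 1 \<bar>simple_integral (\<lambda>s. u v* F k s) w - u \<bullet> Z w\<bar>)"
        by (rule integrable_min_1) measurable
      show "integrable P (\<lambda>w. ?c * min 1 (norm (simple_stoch_integral M (F k) w - Z w)))"
        using int by simp
      show "AE w in P. min 1 \<bar>simple_integral (\<lambda>s. u v* F k s) w - u \<bullet> Z w\<bar> \<le>
          ?c * min 1 (norm (simple_stoch_integral M (F k) w - Z w))"
        using simple_integral_matrix[OF F(1)[of k], of u]
      proof eventually_elim
        case (elim w)
        let ?d = "norm (simple_stoch_integral M (F k) w - Z w)"
        have "\<bar>u \<bullet> (simple_stoch_integral M (F k) w - Z w)\<bar> \<le> norm u * ?d"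
          by (rule Cauchy_Schwarz_ineq2)
        also have "\<dots> \<le> ?c * ?d"
          by (intro mult_right_mono) auto
        finally have "min 1 \<bar>simple_integral (\<lambda>s. u v* F k s) w - u \<bullet> Z w\<bar> \<le> min 1 (?c * ?d)"
          by (simp add: elim inner_diff_right)
        also have "\<dots> \<le> ?c * min 1 ?d"
          by (rule min_1_mult_le) simp
        finally show ?case .
      qed
    qed
    then show ?thesis by simp
  qed
  have lim': "(\<lambda>k. ?c * (\<integral>w. min 1 (norm (simple_stoch_integral M (F k) w - Z w)) \<partial>P)) \<longlonglongrightarrow> 0"
    using tendsto_mult_right_zero[OF lim] by simp
  have "(\<lambda>k. \<integral>w. min 1 \<bar>simple_integral (\<lambda>s. u v* F k s) w - u \<bullet> Z w\<bar> \<partial>P) \<longlonglongrightarrow> 0"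
    by (rule tendsto_zero_if_le[OF _ le lim']) (rule integral_nonneg_AE, simp)
  moreover have "AE s in lborel. (\<lambda>k. u v* F k s) \<longlonglongrightarrow> u v* f s"
    using F(2)
  proof eventually_elim
    case (elim s)
    then show ?case
      by (rule continuous_on_tendsto_compose[OF cont]) auto
  qed
  moreover have "(\<lambda>s. u v* f s) \<in> borel_measurable borel"
    by (rule measurable_compose[OF f borel_measurable_continuous_onI[OF cont]])
  ultimately show ?thesis
    unfolding scalar_integral_def
    by (intro conjI exI[of _ "\<lambda>k s. u v* F k s"] allI simple_vector_matrix_mult F(1)) auto
qed

lemma scalar_integral_zero: "scalar_integral (\<lambda>s. 0) (\<lambda>w. 0)"
  unfolding scalar_integral_def
proof (intro conjI exI[of _ "\<lambda>k s. 0"] allI)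
  show "simple (\<lambda>s. 0 :: real^'d)"
    by (intro Bochner_Integration.simple_bochner_integrable.intros) auto
qed (auto simp: simple_integral_def)

lemma scalar_integral_add:
  assumes "scalar_integral v S" "scalar_integral v' S'"
  shows "scalar_integral (\<lambda>s. v s + v' s) (\<lambda>w. S w + S' w)"
proof -
  obtain V V' where [measurable]: "v \<in> borel_measurable borel" "S \<in> borel_measurable P"
      "v' \<in> borel_measurable borel" "S' \<in> borel_measurable P"
    and V: "\<And>k. simple (V k)" "AE s in lborel. (\<lambda>k. V k s) \<longlonglongrightarrow> v s"
      "(\<lambda>k. \<integral>w. min 1 \<bar>simple_integral (V k) w - S w\<bar> \<partial>P) \<longlonglongrightarrow> 0"
    and V': "\<And>k. simple (V' k)" "AE s in lborel. (\<lambda>k. V' k s) \<longlonglongrightarrow> v' s"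
      "(\<lambda>k. \<integral>w. min 1 \<bar>simple_integral (V' k) w - S' w\<bar> \<partial>P) \<longlonglongrightarrow> 0"
    using assms unfolding scalar_integral_def by blast
  have simple: "simple (\<lambda>s. V k s + V' k s)" for k
    by (rule simple_bochner_integrable_compose2[OF _ V(1) V'(1)]) simp
  note [measurable] = simple_integral_measurable[OF V(1)] simple_integral_measurable[OF V'(1)]
    simple_integral_measurable[OF simple]
  have le: "(\<integral>w. min 1 \<bar>simple_integral (\<lambda>s. V k s + V' k s) w - (S w + S' w)\<bar> \<partial>P) \<le>
      (\<integral>w. min 1 \<bar>simple_integral (V k) w - S w\<bar> \<partial>P) + (\<integral>w. min 1 \<bar>simple_integral (V' k) w - S' w\<bar> \<partial>P)" for k
  proof -
    have int: "integrable P (\<lambda>w. min 1 \<bar>simple_integral (V k) w - S w\<bar>)"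
        "integrable P (\<lambda>w. min 1 \<bar>simple_integral (V' k) w - S' w\<bar>)"
        "integrable P (\<lambda>w. min 1 \<bar>simple_integral (\<lambda>s. V k s + V' k s) w - (S w + S' w)\<bar>)"
      by (rule integrable_min_1; measurable)+
    have "(\<integral>w. min 1 \<bar>simple_integral (\<lambda>s. V k s + V' k s) w - (S w + S' w)\<bar> \<partial>P) \<le>
        (\<integral>w. min 1 \<bar>simple_integral (V k) w - S w\<bar> + min 1 \<bar>simple_integral (V' k) w - S' w\<bar> \<partial>P)"
    proof (rule integral_mono_AE)
      show "AE w in P. min 1 \<bar>simple_integral (\<lambda>s. V k s + V' k s) w - (S w + S' w)\<bar> \<le>
          min 1 \<bar>simple_integral (V k) w - S w\<bar> + min 1 \<bar>simple_integral (V' k) w - S' w\<bar>"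
        using simple_integral_add[OF V(1)[of k] V'(1)[of k]] by eventually_elim auto
    qed (use int in simp_all)
    then show ?thesis using int by simp
  qed
  have "(\<lambda>k. \<integral>w. min 1 \<bar>simple_integral (\<lambda>s. V k s + V' k s) w - (S w + S' w)\<bar> \<partial>P) \<longlonglongrightarrow> 0"
    by (rule tendsto_zero_if_le[OF _ le tendsto_add_zero[OF V(3) V'(3)]]) (rule integral_nonneg_AE, simp)
  moreover have "AE s in lborel. (\<lambda>k. V k s + V' k s) \<longlonglongrightarrow> v s + v' s"
    using V(2) V'(2) by eventually_elim (rule tendsto_add)
  ultimately show ?thesis
    unfolding scalar_integral_def
    by (intro conjI exI[of _ "\<lambda>k s. V k s + V' k s"] allI simple) auto
qed

lemma scalar_integral_sum:
  assumes "finite I" "\<And>i. i \<in> I \<Longrightarrow> scalar_integral (v i) (S i)"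
  shows "scalar_integral (\<lambda>s. \<Sum>i\<in>I. v i s) (\<lambda>w. \<Sum>i\<in>I. S i w)"
  using assms by (induction I) (simp_all add: scalar_integral_zero scalar_integral_add)

end

section \<open>Characteristic function of the integral\<close>

context tempered_exponent
begin

lemma exponent_minus [simp]: "exponent l (- v) = exponent l v"
  by (simp add: exponent_def)

lemma exponent_minus_commute: "exponent l (v - w) = exponent l (w - v)"
  using exponent_minus[of l "v - w"] by simp

end

context tempered_random_field
begin

abbreviation mean_exponent :: "(real^'n \<Rightarrow> real^'d) \<Rightarrow> ennreal" where
  "mean_exponent v \<equiv> \<integral>\<^sup>+ s. exponent l (v s) \<partial>lborel"

lemma simple_borel_measurable:
  assumes "simple (v :: real^'n \<Rightarrow> real^'d)"
  shows "v \<in> borel_measurable borel"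
proof -
  have "simple_function lborel v"
    using assms by (rule Bochner_Integration.simple_bochner_integrable.cases)
  then have "v \<in> borel_measurable lborel"
    by (rule borel_measurable_simple_function)
  then show ?thesis by simp
qed

lemma mean_exponent_add_le:
  assumes [measurable]: "v \<in> borel_measurable borel" "w \<in> borel_measurable borel" and "\<eta> > 0"
  shows "mean_exponent (\<lambda>s. v s + w s) \<le> ennreal (1 + \<eta>) * mean_exponent v + ennreal (1 + 1 / \<eta>) * mean_exponent w"
proof -
  note [measurable] = measurable_exponent[OF l]
  have "mean_exponent (\<lambda>s. v s + w s) \<le> (\<integral>\<^sup>+ s. ennreal (1 + \<eta>) * exponent l (v s) + ennreal (1 + 1 / \<eta>) * exponent l (w s) \<partial>lborel)"
    by (intro nn_integral_mono exponent_add_le assms)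
  also have "\<dots> = (\<integral>\<^sup>+ s. ennreal (1 + \<eta>) * exponent l (v s) \<partial>lborel) + (\<integral>\<^sup>+ s. ennreal (1 + 1 / \<eta>) * exponent l (w s) \<partial>lborel)"
    by (rule nn_integral_add) measurable
  also have "\<dots> = ennreal (1 + \<eta>) * mean_exponent v + ennreal (1 + 1 / \<eta>) * mean_exponent w"
    by (intro arg_cong2[where f = "(+)"] nn_integral_cmult) measurable
  finally show ?thesis .
qed

lemma enn2real_mean_exponent_le:
  assumes "v \<in> borel_measurable borel" "w \<in> borel_measurable borel" "\<eta> > 0"
    and fin: "mean_exponent v < \<infinity>" "mean_exponent w < \<infinity>"
  shows "mean_exponent (\<lambda>s. v s + w s) < \<infinity>"
    "enn2real (mean_exponent (\<lambda>s. v s + w s)) \<le> (1 + \<eta>) * enn2real (mean_exponent v) + (1 + 1 / \<eta>) * enn2real (mean_exponent w)"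
proof -
  have le: "mean_exponent (\<lambda>s. v s + w s) \<le>
      ennreal ((1 + \<eta>) * enn2real (mean_exponent v) + (1 + 1 / \<eta>) * enn2real (mean_exponent w))"
  proof -
    have "ennreal ((1 + \<eta>) * enn2real (mean_exponent v) + (1 + 1 / \<eta>) * enn2real (mean_exponent w)) =
        ennreal (1 + \<eta>) * mean_exponent v + ennreal (1 + 1 / \<eta>) * mean_exponent w"
      using fin \<open>\<eta> > 0\<close> by (simp add: ennreal_plus ennreal_mult ennreal_enn2real)
    then show ?thesis
      using mean_exponent_add_le[OF assms(1,2,3)] by (simp only:)
  qed
  then show "mean_exponent (\<lambda>s. v s + w s) < \<infinity>"
    by (rule le_less_trans) simp
  show "enn2real (mean_exponent (\<lambda>s. v s + w s)) \<le> (1 + \<eta>) * enn2real (mean_exponent v) + (1 + 1 / \<eta>) * enn2real (mean_exponent w)"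
    by (rule enn2real_leI[OF _ le]) (use \<open>\<eta> > 0\<close> in simp)
qed

text \<open>Here convergence in probability becomes a bound for the integrands: the left side is the
  distance from 1 of the characteristic function of the integral of \<open>v - v'\<close>, and the
  truncated mean of that integral splits at the common reference \<open>S\<close>.\<close>

lemma mean_exponent_simple_diff_le:
  assumes V: "simple v" "simple v'" and [measurable]: "S \<in> borel_measurable P"
  shows "1 - exp (- enn2real (mean_exponent (\<lambda>s. v s - v' s))) \<le>
    2 * ((\<integral>w. min 1 \<bar>simple_integral v w - S w\<bar> \<partial>P) + (\<integral>w. min 1 \<bar>simple_integral v' w - S w\<bar> \<partial>P))"
proof -
  have simple: "simple (\<lambda>s. v s - v' s)"
    by (rule simple_bochner_integrable_compose2[OF _ V]) simp
  note [measurable] = simple_integral_measurable[OF V(1)] simple_integral_measurable[OF V(2)]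
    simple_integral_measurable[OF simple]
  have int: "integrable P (\<lambda>w. min 1 \<bar>simple_integral v w - S w\<bar>)"
      "integrable P (\<lambda>w. min 1 \<bar>simple_integral v' w - S w\<bar>)"
      "integrable P (\<lambda>w. min 1 \<bar>0 - simple_integral (\<lambda>s. v s - v' s) w\<bar>)"
    by (rule integrable_min_1; measurable)+
  have "1 - exp (- enn2real (mean_exponent (\<lambda>s. v s - v' s))) \<le>
      cmod (complex_of_real (1 - exp (- enn2real (mean_exponent (\<lambda>s. v s - v' s)))))"
    by (simp only: norm_of_real abs_ge_self)
  also have "\<dots> = cmod ((\<integral>w. iexp ((\<lambda>_. 0) w) \<partial>P) - (\<integral>w. iexp (simple_integral (\<lambda>s. v s - v' s) w) \<partial>P))"
    by (subst simple_integral_char(2)[OF simple]) (simp add: prob_space flip: exp_of_real)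
  also have "\<dots> \<le> 2 * (\<integral>w. min 1 \<bar>0 - simple_integral (\<lambda>s. v s - v' s) w\<bar> \<partial>P)"
    by (rule norm_integral_iexp_diff_le) measurable
  finally have 1: "1 - exp (- enn2real (mean_exponent (\<lambda>s. v s - v' s))) \<le>
      2 * (\<integral>w. min 1 \<bar>0 - simple_integral (\<lambda>s. v s - v' s) w\<bar> \<partial>P)" .
  have "(\<integral>w. min 1 \<bar>0 - simple_integral (\<lambda>s. v s - v' s) w\<bar> \<partial>P) \<le>
      (\<integral>w. min 1 \<bar>simple_integral v w - S w\<bar> + min 1 \<bar>simple_integral v' w - S w\<bar> \<partial>P)"
  proof (rule integral_mono_AE)
    show "AE w in P. min 1 \<bar>0 - simple_integral (\<lambda>s. v s - v' s) w\<bar> \<le>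
        min 1 \<bar>simple_integral v w - S w\<bar> + min 1 \<bar>simple_integral v' w - S w\<bar>"
      using simple_integral_diff[OF V] by eventually_elim auto
  qed (use int in simp_all)
  also have "\<dots> = (\<integral>w. min 1 \<bar>simple_integral v w - S w\<bar> \<partial>P) + (\<integral>w. min 1 \<bar>simple_integral v' w - S w\<bar> \<partial>P)"
    by (rule Bochner_Integration.integral_add[OF int(1,2)])
  finally show ?thesis
    by (intro order_trans[OF 1] mult_left_mono) simp_all
qed

text \<open>Fatou's lemma fits because only an upper bound along the sequence is known; continuity
  of \<open>exponent\<close> identifies the pointwise lower limit.\<close>

lemma mean_exponent_Fatou:
  assumes v: "v \<in> borel_measurable borel" and V: "\<And>m. V m \<in> borel_measurable borel"
    and lim: "AE s in lborel. (\<lambda>m. V m s) \<longlonglongrightarrow> v s"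
    and le: "\<forall>\<^sub>F m in sequentially. mean_exponent (\<lambda>s. u s - V m s) \<le> c" and u: "u \<in> borel_measurable borel"
  shows "mean_exponent (\<lambda>s. u s - v s) \<le> c"
proof -
  note [measurable] = measurable_exponent[OF l] v V u
  have "AE s in lborel. exponent l (u s - v s) = liminf (\<lambda>m. exponent l (u s - V m s))"
    using lim
  proof eventually_elim
    case (elim s)
    have "(\<lambda>m. exponent l (u s - V m s)) \<longlonglongrightarrow> exponent l (u s - v s)"
      by (intro exponent_LIMSEQ tendsto_intros elim l)
    then show ?case
      by (rule lim_imp_Liminf[symmetric, rotated]) simp
  qed
  then have "mean_exponent (\<lambda>s. u s - v s) = (\<integral>\<^sup>+ s. liminf (\<lambda>m. exponent l (u s - V m s)) \<partial>lborel)"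
    by (rule nn_integral_cong_AE)
  also have "\<dots> \<le> liminf (\<lambda>m. mean_exponent (\<lambda>s. u s - V m s))"
    by (rule nn_integral_liminf) measurable
  also have "\<dots> \<le> limsup (\<lambda>m. mean_exponent (\<lambda>s. u s - V m s))"
    by (rule Liminf_le_Limsup) simp
  also have "\<dots> \<le> c"
    by (rule Limsup_bounded[OF le])
  finally show ?thesis .
qed

lemma scalar_integral_char:
  assumes "scalar_integral v S"
  shows "mean_exponent v < \<infinity>"
    "(\<integral>w. iexp (S w) \<partial>P) = exp (complex_of_real (- enn2real (mean_exponent v)))"
proof -
  obtain V where v: "v \<in> borel_measurable borel" and S [measurable]: "S \<in> borel_measurable P"
    and V: "\<And>k. simple (V k)" "AE s in lborel. (\<lambda>k. V k s) \<longlonglongrightarrow> v s"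
      "(\<lambda>k. \<integral>w. min 1 \<bar>simple_integral (V k) w - S w\<bar> \<partial>P) \<longlonglongrightarrow> 0"
    using assms unfolding scalar_integral_def by blast
  define d where "d k = (\<integral>w. min 1 \<bar>simple_integral (V k) w - S w\<bar> \<partial>P)" for k
  note VM = simple_borel_measurable[OF V(1)]
  define r where "r k = mean_exponent (\<lambda>s. V k s - v s)" for k
  have diff_meas: "(\<lambda>s. V k s - v s) \<in> borel_measurable borel" "(\<lambda>s. v s - V k s) \<in> borel_measurable borel" for k
    using VM v by (intro borel_measurable_diff; simp)+
  have r: "\<forall>\<^sub>F k in sequentially. r k \<le> ennreal e" if "e > 0" for e
  proof -
    \<comment> \<open>The inequality \<open>1 - exp (- x) < \<delta>\<close> means
      \<open>x < e\<close>. Two distances below \<open>\<delta> / 4\<close>, with the factor 2 of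
      \<open>mean_exponent_simple_diff_le\<close>, stay below \<open>\<delta>\<close>.\<close>
    define \<delta> where "\<delta> = 1 - exp (- e)"
    have "\<delta> > 0" using that by (simp add: \<delta>_def)
    then have "\<forall>\<^sub>F k in sequentially. d k < \<delta> / 4"
      using V(3) unfolding d_def by (intro order_tendstoD) auto
    then obtain K where K: "\<And>k. k \<ge> K \<Longrightarrow> d k < \<delta> / 4"
      by (auto simp: eventually_sequentially)
    have "mean_exponent (\<lambda>s. V k s - V m s) \<le> ennreal e" if "k \<ge> K" "m \<ge> K" for k m
    proof -
      have "1 - exp (- enn2real (mean_exponent (\<lambda>s. V k s - V m s))) \<le> 2 * (d k + d m)"
        unfolding d_def by (rule mean_exponent_simple_diff_le[OF V(1) V(1) S])
      also have "\<dots> < \<delta>"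
        using K[OF that(1)] K[OF that(2)] by simp
      finally have "exp (- e) < exp (- enn2real (mean_exponent (\<lambda>s. V k s - V m s)))"
        by (simp add: \<delta>_def)
      then have e: "enn2real (mean_exponent (\<lambda>s. V k s - V m s)) \<le> e" by simp
      have "simple (\<lambda>s. V k s - V m s)"
        by (rule simple_bochner_integrable_compose2[OF _ V(1) V(1)]) simp
      from simple_integral_char(1)[OF this]
      have eq: "ennreal (enn2real (mean_exponent (\<lambda>s. V k s - V m s))) = mean_exponent (\<lambda>s. V k s - V m s)"
        by (intro ennreal_enn2real) simp
      show ?thesis
        using ennreal_leI[OF e] unfolding eq .
    qed
    then have "r k \<le> ennreal e" if "k \<ge> K" for k
      unfolding r_def using that
      by (intro mean_exponent_Fatou[OF v VM V(2) _ VM] eventually_sequentiallyI[of K]) auto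
    then show ?thesis by (auto intro: eventually_sequentiallyI)
  qed
  have r_fin: "\<forall>\<^sub>F k in sequentially. r k < \<infinity>"
    using r[of 1] by (auto elim!: eventually_mono intro: le_less_trans)
  have "(\<lambda>k. enn2real (r k)) \<longlonglongrightarrow> 0"
  proof (rule LIMSEQ_I)
    fix e :: real assume "e > 0"
    then have "\<forall>\<^sub>F k in sequentially. norm (enn2real (r k) - 0) < e"
      using eventually_mono[OF r[of "e / 2"], where Q = "\<lambda>k. norm (enn2real (r k) - 0) < e"]
        enn2real_leI[of "e / 2"] by (simp add: le_less_trans[of _ "e / 2"])
    then show "\<exists>K. \<forall>k\<ge>K. norm (enn2real (r k) - 0) < e"
      by (simp add: eventually_sequentially)
  qed
  note r_lim = this
  have V_fin: "mean_exponent (V k) < \<infinity>" for k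
    by (rule simple_integral_char(1)[OF V(1)])
  have r': "mean_exponent (\<lambda>s. v s - V k s) = r k" for k
    unfolding r_def by (simp only: exponent_minus_commute)
  \<comment> \<open>From \<open>v = V k + (v - V k)\<close>, where both summands have finite
    exponents. A single such index gives the finiteness of \<open>mean_exponent v\<close>, which the
    reverse estimate then presupposes.\<close>
  have ge: "mean_exponent v < \<infinity>"
      "enn2real (mean_exponent v) \<le> (1 + \<eta>) * enn2real (mean_exponent (V k)) + (1 + 1 / \<eta>) * enn2real (r k)"
    if "\<eta> > 0" "r k < \<infinity>" for k \<eta>
    using enn2real_mean_exponent_le[OF VM diff_meas(2) that(1) V_fin, of k k] that(2)
    by (simp_all add: r')
  obtain k0 where "r k0 < \<infinity>"
    using eventually_happens[OF r_fin] by auto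
  then show fin: "mean_exponent v < \<infinity>"
    by (rule ge(1)[OF zero_less_one])
  have le: "enn2real (mean_exponent (V k)) \<le> (1 + \<eta>) * enn2real (mean_exponent v) + (1 + 1 / \<eta>) * enn2real (r k)"
    if "\<eta> > 0" "r k < \<infinity>" for k \<eta>
    using enn2real_mean_exponent_le(2)[OF v diff_meas(1) that(1) fin, of k] that(2)
    by (simp flip: r_def)
  have "(\<lambda>k. enn2real (mean_exponent (V k))) \<longlonglongrightarrow> enn2real (mean_exponent v)"
    by (rule tendsto_if_quasi_triangle[OF _ _ r_lim]) (auto intro: eventually_mono[OF r_fin] le ge)
  then have "(\<lambda>k. exp (complex_of_real (- enn2real (mean_exponent (V k))))) \<longlonglongrightarrow>
      exp (complex_of_real (- enn2real (mean_exponent v)))"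
    by (rule tendsto_exp[OF tendsto_of_real[OF tendsto_minus]])
  then have "(\<lambda>k. \<integral>w. iexp (simple_integral (V k) w) \<partial>P) \<longlonglongrightarrow>
      exp (complex_of_real (- enn2real (mean_exponent v)))"
    by (simp only: simple_integral_char(2)[OF V(1)])
  moreover have "(\<lambda>k. \<integral>w. iexp (simple_integral (V k) w) \<partial>P) \<longlonglongrightarrow> (\<integral>w. iexp (S w) \<partial>P)"
  proof (rule LIM_zero_cancel, rule Lim_null_comparison)
    show "\<forall>\<^sub>F k in sequentially. norm ((\<integral>w. iexp (simple_integral (V k) w) \<partial>P) - (\<integral>w. iexp (S w) \<partial>P)) \<le> 2 * d k"
      unfolding d_def
      by (intro always_eventually allI norm_integral_iexp_diff_le simple_integral_measurable V(1) S)
    show "(\<lambda>k. 2 * d k) \<longlonglongrightarrow> 0"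
      unfolding d_def by (rule tendsto_mult_right_zero[OF V(3)])
  qed
  ultimately show "(\<integral>w. iexp (S w) \<partial>P) = exp (complex_of_real (- enn2real (mean_exponent v)))"
    by (rule LIMSEQ_unique[symmetric])
qed

end

section \<open>Localisability\<close>

text \<open>The terms with \<open>\<phi>\<close> at minus the integration variable cancel in the
  difference of the two kernels. In what remains \<open>x\<close> drops out and
  \<open>\<phi>\<close> is evaluated at the images of \<open>t - s\<close> and \<open>- s\<close>
  under \<open>matrix_powr c E\<close>; these two vectors have to be nonzero because homogeneity and
  positivity of \<open>\<phi>\<close> speak of nonzero points only.\<close>

lemma ma_kernel_scaling:
  fixes E :: "real^'n^'n" and D :: "real^'d^'d"
  assumes \<phi>: "E_homogeneous E \<phi>" "\<And>y. y \<noteq> 0 \<Longrightarrow> \<phi> y > 0" and c: "c > 0" and s: "s \<noteq> t" "s \<noteq> 0"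
  shows "ma_kernel \<alpha> E D \<phi> (x + matrix_powr c E *v t) (x + matrix_powr c E *v s) -
      ma_kernel \<alpha> E D \<phi> x (x + matrix_powr c E *v s) =
    c powr - (trace E / \<alpha>) *\<^sub>R (matrix_powr c D ** ma_kernel \<alpha> E D \<phi> t s)"
proof -
  let ?B = "D - (trace E / \<alpha>) *\<^sub>R mat 1"
  have scale: "matrix_powr (\<phi> (matrix_powr c E *v y)) ?B =
      c powr - (trace E / \<alpha>) *\<^sub>R (matrix_powr c D ** matrix_powr (\<phi> y) ?B)" if "y \<noteq> 0" for y
  proof -
    have "\<phi> (matrix_powr c E *v y) = c * \<phi> y"
      using \<phi>(1) c that by (simp add: E_homogeneous_def)
    then show ?thesis
      using matrix_powr_mult[OF c \<phi>(2)[OF that], of ?B]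
      by (simp only: matrix_powr_diff_scaled_mat_1[OF c] matrix_scaleR_mult_commute)
  qed
  have "x + matrix_powr c E *v t - (x + matrix_powr c E *v s) = matrix_powr c E *v (t - s)"
      "x - (x + matrix_powr c E *v s) = matrix_powr c E *v (- s)"
    using matrix_vector_mult_diff_distrib[of "matrix_powr c E" 0 s]
    by (simp_all add: matrix_vector_mult_diff_distrib)
  moreover have "A ** (B - C) = A ** B - A ** C" for A B C :: "real^'d^'d"
    by (simp add: matrix_eq matrix_vector_mult_diff_rdistrib matrix_vector_mult_diff_distrib flip: matrix_vector_mul_assoc)
  ultimately show ?thesis
    using s scale[of "t - s"] scale[of "- s"]
    by (simp add: ma_kernel_def scaleR_diff_right)
qed

lemma (in tempered_random_field) mean_exponent_scaling:
  fixes E :: "real^'n^'n"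
  assumes v: "v \<in> borel_measurable borel" "v' \<in> borel_measurable borel" and c: "c > 0"
    and scaling: "AE s in lborel. v (x + matrix_powr c E *v s) = c powr - (trace E / \<alpha>) *\<^sub>R v' s"
  shows "mean_exponent v = (\<integral>\<^sup>+ s. exponent (l * c powr (trace E / \<alpha>)) (v' s) \<partial>lborel)"
proof -
  note [measurable] = measurable_exponent[OF l] v
  let ?a = "c powr - (trace E / \<alpha>)"
  have a: "?a > 0" using c by simp
  have "?a powr - \<alpha> = c powr trace E"
    using \<alpha> by (simp add: powr_powr)
  moreover have "l / ?a = l * c powr (trace E / \<alpha>)"
    by (simp add: powr_minus divide_inverse)
  ultimately have eq: "ennreal (c powr trace E) * exponent l (?a *\<^sub>R u) = exponent (l * c powr (trace E / \<alpha>)) u" for u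
    using exponent_scaleR[OF a, of l u] by simp
  have det: "det (matrix_powr c E) = c powr trace E"
    by (rule det_matrix_powr[OF c])
  have "mean_exponent v = ennreal (c powr trace E) * (\<integral>\<^sup>+ s. exponent l (v (x + matrix_powr c E *v s)) \<partial>lborel)"
    using nn_integral_lborel_affine_matrix[of "matrix_powr c E" "\<lambda>s. exponent l (v s)" x] c
    by (simp add: det)
  also have "(\<integral>\<^sup>+ s. exponent l (v (x + matrix_powr c E *v s)) \<partial>lborel) = (\<integral>\<^sup>+ s. exponent l (?a *\<^sub>R v' s) \<partial>lborel)"
    using scaling by (intro nn_integral_cong_AE) auto
  also have "ennreal (c powr trace E) * \<dots> = (\<integral>\<^sup>+ s. ennreal (c powr trace E) * exponent l (?a *\<^sub>R v' s) \<partial>lborel)"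
    by (rule nn_integral_cmult[symmetric]) measurable
  also have "\<dots> = (\<integral>\<^sup>+ s. exponent (l * c powr (trace E / \<alpha>)) (v' s) \<partial>lborel)"
    by (simp only: eq)
  finally show ?thesis .
qed

theorem theorem4p9:
  fixes \<alpha> \<beta> :: real
    and \<sigma> :: "(real^'d) measure"
    and P :: "real \<Rightarrow> 'w measure"
    and M :: "real \<Rightarrow> (real^'n) set \<Rightarrow> 'w \<Rightarrow> real^'d"
    and E :: "real^'n^'n"
    and N \<phi> :: "real^'n \<Rightarrow> real"
    and D :: "real^'d^'d"
    and X :: "real \<Rightarrow> real^'n \<Rightarrow> 'w \<Rightarrow> real^'d"
  assumes "0 < \<alpha>" "\<alpha> < 2"
    and "spectral_measure \<sigma>"
    and "\<And>l. l \<ge> 0 \<Longrightarrow> tempered_random_measure \<sigma> \<alpha> l (P l) (M l)"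
    and "E \<in> pos_spectrum" "polar_norm E N"
    and "\<beta> > 0" "E_homogeneous E \<phi>" "admissible \<beta> E N \<phi>"
    and "D \<in> pos_spectrum" "Max (Re ` eigenvalues D) < \<beta>"
    and "\<And>l t. l \<ge> 0 \<Longrightarrow> has_stoch_integral (P l) (M l) (ma_kernel \<alpha> E D \<phi> t) (X l t)"
  shows "\<forall>l>0. \<forall>x. localisable E D x (P l) (X l) (P 0) (X 0)"
proof (intro allI impI)
  fix l :: real and x :: "real^'n"
  assume "l > 0"
  interpret tempered_exponent \<sigma> \<alpha>
    by (rule tempered_exponent.intro) (use assms(1-3) in \<open>simp_all add: spectral_measure_def\<close>)
  interpret L: tempered_random_field \<sigma> \<alpha> l "P l" "M l"
    using \<open>l > 0\<close> assms(4) by unfold_locales simp_all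
  interpret L0: tempered_random_field \<sigma> \<alpha> 0 "P 0" "M 0"
    using assms(4) by unfold_locales simp_all
  let ?K = "ma_kernel \<alpha> E D \<phi>"
  let ?Y = "\<lambda>c t w. matrix_powr c (- D) *v (X l (x + matrix_powr c E *v t) w - X l x w)"
  have q: "trace E > 0"
    by (rule trace_pos_if_pos_spectrum[OF assms(5)])
  have pos: "\<phi> y > 0" if "y \<noteq> 0" for y
    using assms(9) that by (simp add: admissible_def)
  have X_stoch: "has_stoch_integral (P l) (M l) (?K t) (X l t)" for t
    using assms(12)[of l t] \<open>l > 0\<close> by simp
  have X0_stoch: "has_stoch_integral (P 0) (M 0) (?K t) (X 0 t)" for t
    using assms(12)[of 0 t] by simp
  have X_meas: "X l t \<in> borel_measurable (P l)" for t
    using X_stoch by (simp add: has_stoch_integral_def)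
  have X0_meas: "X 0 t \<in> borel_measurable (P 0)" for t
    using X0_stoch by (simp add: has_stoch_integral_def)
  have Y_meas: "?Y c t \<in> borel_measurable (P l)" for c t
    using X_meas
    by (intro measurable_compose[OF borel_measurable_diff
          borel_measurable_continuous_onI[OF matrix_vector_mult_linear_continuous_on]])
  show "localisable E D x (P l) (X l) (P 0) (X 0)"
    unfolding localisable_def random_field_def fdd_converges_def
  proof (intro conjI allI impI)
    show "prob_space (P l)" "prob_space (P 0)"
      by unfold_locales
    show "X l t \<in> borel_measurable (P l)" "X 0 t \<in> borel_measurable (P 0)" for t
      by (rule X_meas X0_meas)+
    fix T and g :: "(real^'n \<Rightarrow> real^'d) \<Rightarrow> real"
    assume Tg: "finite T \<and> continuous_map (product_topology (\<lambda>_. euclidean) T) euclideanreal g \<and>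
      bounded (g ` (T \<rightarrow>\<^sub>E UNIV))"
    show "((\<lambda>c. \<integral>w. g (\<lambda>t\<in>T. ?Y c t w) \<partial>P l) \<longlongrightarrow> (\<integral>w. g (\<lambda>t\<in>T. X 0 t w) \<partial>P 0)) (at_right 0)"
    \<comment> \<open>Dominated convergence and Levy continuity concern sequences, and these
      determine a one-sided limit.\<close>
    proof (rule tendsto_at_right_sequentially[OF zero_less_one])
      fix c :: "nat \<Rightarrow> real"
      assume c: "\<And>n. 0 < c n" "c \<longlonglongrightarrow> 0"
      show "(\<lambda>n. \<integral>w. g (\<lambda>t\<in>T. ?Y (c n) t w) \<partial>P l) \<longlonglongrightarrow> (\<integral>w. g (\<lambda>t\<in>T. X 0 t w) \<partial>P 0)"
      proof (rule levy_continuity_finite_dimensional[OF L.prob_space_axioms L0.prob_space_axioms])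
        fix u :: "real^'n \<Rightarrow> real^'d"
        define v where "v s = (\<Sum>t\<in>T. u t v* ?K t s)" for s
        \<comment> \<open>The matrix \<open>matrix_powr (c n) (- D)\<close> is moved onto
          \<open>u t\<close>, and the increment becomes a sum with the negated vector at
          \<open>x\<close>, so that additivity of the integral is enough.\<close>
        define v' where "v' n s = (\<Sum>t\<in>T. (u t v* matrix_powr (c n) (- D)) v* ?K (x + matrix_powr (c n) E *v t) s +
          (- (u t v* matrix_powr (c n) (- D))) v* ?K x s)" for n s
        have v: "L0.scalar_integral v (\<lambda>w. \<Sum>t\<in>T. u t \<bullet> X 0 t w)"
          unfolding v_def using Tg
          by (intro L0.scalar_integral_sum L0.scalar_integral_if_has_stoch_integral X0_stoch) simp
        have v': "L.scalar_integral (v' n) (\<lambda>w. \<Sum>t\<in>T. u t \<bullet> ?Y (c n) t w)" for n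
        proof -
          have "u t \<bullet> ?Y (c n) t w =
              (u t v* matrix_powr (c n) (- D)) \<bullet> X l (x + matrix_powr (c n) E *v t) w +
              (- (u t v* matrix_powr (c n) (- D))) \<bullet> X l x w" for t w
            by (simp only: dot_lmul_matrix[symmetric] inner_diff_right inner_minus_left add_uminus_conv_diff)
          then show ?thesis
            unfolding v'_def using Tg
            by (simp only:) (intro L.scalar_integral_sum L.scalar_integral_add
                L.scalar_integral_if_has_stoch_integral X_stoch, simp)
        qed
        have v_meas: "v \<in> borel_measurable borel" and v'_meas: "v' n \<in> borel_measurable borel" for n
          using v v' unfolding L.scalar_integral_def L0.scalar_integral_def by blast+
        \<comment> \<open>These are the points where a rescaled kernel would evaluate
          \<open>\<phi>\<close> at 0; being finitely many, they form a null set.\<close>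
        have "AE s in lborel. s \<notin> insert 0 T"
          using Tg by (intro AE_not_in finite_imp_null_set_lborel) simp
        then have scaling: "AE s in lborel. v' n (x + matrix_powr (c n) E *v s) = c n powr - (trace E / \<alpha>) *\<^sub>R v s" for n
        proof eventually_elim
          case (elim s)
          have "(u t v* matrix_powr (c n) (- D)) v* ?K (x + matrix_powr (c n) E *v t) (x + matrix_powr (c n) E *v s) +
              (- (u t v* matrix_powr (c n) (- D))) v* ?K x (x + matrix_powr (c n) E *v s) =
              c n powr - (trace E / \<alpha>) *\<^sub>R (u t v* ?K t s)" if "t \<in> T" for t
          proof -
            let ?u = "u t v* matrix_powr (c n) (- D)" and ?s = "x + matrix_powr (c n) E *v s"
            have "?u v* ?K (x + matrix_powr (c n) E *v t) ?s + (- ?u) v* ?K x ?s =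
                ?u v* (?K (x + matrix_powr (c n) E *v t) ?s - ?K x ?s)"
              using scaleR_vector_matrix_assoc[of "- 1" ?u "?K x ?s"]
              by (simp add: vector_matrix_mult_diff_rdistrib)
            also have "\<dots> = ?u v* (c n powr - (trace E / \<alpha>) *\<^sub>R (matrix_powr (c n) D ** ?K t s))"
              using elim that by (subst ma_kernel_scaling[OF assms(8) pos c(1)]) auto
            also have "\<dots> = c n powr - (trace E / \<alpha>) *\<^sub>R (u t v* (matrix_powr (c n) (- D) ** matrix_powr (c n) D ** ?K t s))"
              by (simp only: vector_scaleR_matrix_ac vector_matrix_mul_assoc matrix_mul_assoc)
            finally show ?thesis
              by (simp only: matrix_powr_uminus matrix_mul_lid)
          qed
          then show ?case
            by (simp add: v_def v'_def scaleR_sum_right)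
        qed
        define l' where "l' n = l * c n powr (trace E / \<alpha>)" for n
        have l': "0 \<le> l' n" for n
          using \<open>l > 0\<close> by (simp add: l'_def)
        \<comment> \<open>This is what \<open>trace_pos_if_pos_spectrum\<close> is for: the
          tempering rate tends to 0 because the exponent of \<open>c n\<close> is positive.\<close>
        have "(\<lambda>n. c n powr (trace E / \<alpha>)) \<longlonglongrightarrow> 0 powr (trace E / \<alpha>)"
          using c q assms(1) by (intro tendsto_powr' tendsto_const) (auto intro!: always_eventually less_imp_le)
        then have "l' \<longlonglongrightarrow> 0"
          unfolding l'_def by (auto intro: tendsto_mult_right_zero)
        have exp_v': "L.mean_exponent (v' n) = (\<integral>\<^sup>+ s. exponent (l' n) (v s) \<partial>lborel)" for n
          unfolding l'_def by (rule L.mean_exponent_scaling[OF v'_meas v_meas c(1) scaling])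
        have "(\<lambda>n. \<integral>\<^sup>+ s. exponent (l' n) (v s) \<partial>lborel) \<longlonglongrightarrow> L0.mean_exponent v"
        proof (rule nn_integral_dominated_convergence[where w = "\<lambda>s. exponent 0 (v s)"])
          show "(\<lambda>s. exponent (l' n) (v s)) \<in> borel_measurable lborel" for n
            using measurable_compose[OF v_meas measurable_exponent[OF l']] by simp
          show "(\<lambda>s. exponent 0 (v s)) \<in> borel_measurable lborel"
            "(\<lambda>s. exponent 0 (v s)) \<in> borel_measurable lborel"
            using measurable_compose[OF v_meas measurable_exponent[OF order_refl]] by simp_all
          show "L0.mean_exponent v < \<infinity>"
            by (rule L0.scalar_integral_char(1)[OF v])
          show "AE s in lborel. (\<lambda>n. exponent (l' n) (v s)) \<longlonglongrightarrow> exponent 0 (v s)"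
            by (intro AE_I2 exponent_LIMSEQ l' \<open>l' \<longlonglongrightarrow> 0\<close> tendsto_const)
          show "AE s in lborel. exponent (l' n) (v s) \<le> exponent 0 (v s)" for n
            by (intro AE_I2 exponent_le l')
        qed
        then have "(\<lambda>n. enn2real (L.mean_exponent (v' n))) \<longlonglongrightarrow> enn2real (L0.mean_exponent v)"
          unfolding exp_v' using L0.scalar_integral_char(1)[OF v]
          by (intro tendsto_enn2real) (simp_all add: ennreal_enn2real)
        then have "(\<lambda>n. exp (complex_of_real (- enn2real (L.mean_exponent (v' n))))) \<longlonglongrightarrow>
            exp (complex_of_real (- enn2real (L0.mean_exponent v)))"
          by (rule tendsto_exp[OF tendsto_of_real[OF tendsto_minus]])
        then show "(\<lambda>n. \<integral>w. iexp (\<Sum>t\<in>T. u t \<bullet> ?Y (c n) t w) \<partial>P l) \<longlonglongrightarrow>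
            (\<integral>w. iexp (\<Sum>t\<in>T. u t \<bullet> X 0 t w) \<partial>P 0)"
          by (simp only: L.scalar_integral_char(2)[OF v'] L0.scalar_integral_char(2)[OF v])
      qed (use Tg Y_meas X0_meas in simp_all)
    qed
  qed
qed

end
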